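(* Let $\Xi\subset\mathbb{R}^d$ be a simple polyhedron (with at least one vertex). Consider the two-stage problem with optimal value $v^\star$, and its sample robust and multi-policy approximations with optimal values $\hat v_N^{\mathrm{SRO}}$ and $\hat v_N^{\mathrm{MP}}$, all as defined in the context. Assume that: (A1) the radius $\epsilon_N$ satisfies $\epsilon_N\to0$ as $N\to\infty$; (A2) $v^\star$ is finite and $\mathbb{E}[\|\tilde{\bm\xi}\|]<\infty$; (A3) the set of optimal first-stage decisions of the two-stage problem is nonempty and bounded; (A4a) there exists $\bm x\in\mathbb{R}^n$ such that $Q(\bm x,\bm\zeta)<\infty$ for all $\bm\zeta\in\Xi$. Then $$\lim_{N\to\infty}\hat v_N^{\mathrm{SRO}}=\lim_{N\to\infty}\hat v_N^{\mathrm{MP}}=v^\star\quad\text{almost surely},$$ and any accumulation point of $\{\bm x_N^{\mathrm{SRO}}\}_{N\in\mathbb{N}}$ or of $\{\bm x_N^{\mathrm{MP}}\}_{N\in\mathbb{N}}$ is almost surely an optimal first-stage decision of the two-stage problem, where $\bm x_N^{\mathrm{SRO}}$ and $\bm x_N^{\mathrm{MP}}$ are optimal first-stage decisions of the sample robust problem and of the multi-policy problem, respectively.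
   Context: Simple polyhedron: every vertex of $\Xi$ is incident to exactly $\dim(\Xi)$ edges (one-dimensional faces, possibly unbounded) of $\Xi$. Data: $\bm T\in\mathbb{R}^{m\times n}$, $\bm W\in\mathbb{R}^{m\times r}$, $\bm H\in\mathbb{R}^{m\times d}$, $\bm c\in\mathbb{R}^n$, $\bm q\in\mathbb{R}^r$, $\bm h_0\in\mathbb{R}^m$, and $\bm h(\bm\xi)=-\bm H\bm\xi+\bm h_0$. The random vector $\tilde{\bm\xi}$ has distribution $\mathbb{P}$ supported on the polyhedron $\Xi\subset\mathbb{R}^d$, and $\bm\xi^1,\bm\xi^2,\ldots$ are independent samples from $\mathbb{P}$. $\|\cdot\|$ is a fixed norm on $\mathbb{R}^d$. Two-stage problem: $$v^\star=\min_{\bm x\in\mathbb{R}^n}\ \bm c^\top\bm x+\mathbb{E}[Q(\bm x,\tilde{\bm\xi})],\qquad Q(\bm x,\bm\xi)=\min_{\bm y\in\mathbb{R}^r}\{\bm q^\top\bm y:\bm T\bm x+\bm W\bm y\ge\bm h(\bm\xi)\},$$ with $Q=+\infty$ when the inner problem is infeasible. For $\epsilon_N\geq 0$ let $\mathcal{U}_N^i=\Xi\cap\{\bm\xi:\|\bm\xi-\bm\xi^i\|\le\epsilon_N\}$, $i=1,\ldots,N$. Sample robust problem: $$\hat v_N^{\mathrm{SRO}}=\min_{\bm x\in\mathbb{R}^n,\ \bm y(\cdot)}\ \bm c^\top\bm x+\frac1N\sum_{i=1}^N\sup_{\bm\zeta\in\mathcal{U}_N^i}\bm q^\top\bm y(\bm\zeta)\quad\text{s.t.}\quad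 \bm T\bm x+\bm W\bm y(\bm\zeta)\ge\bm h(\bm\zeta)\ \ \forall\bm\zeta\in\bigcup_{i=1}^N\mathcal{U}_N^i,$$ where $\bm y(\cdot)$ ranges over all functions $\mathbb{R}^d\to\mathbb{R}^r$. Multi-policy problem (with linear decision rules): $$\hat v_N^{\mathrm{MP}}=\min_{\bm x\in\mathbb{R}^n,\ \bm y^1(\cdot),\ldots,\bm y^N(\cdot)\in\mathcal{L}}\ \bm c^\top\bm x+\frac1N\sum_{i=1}^N\sup_{\bm\zeta\in\mathcal{U}_N^i}\bm q^\top\bm y^i(\bm\zeta)\quad\text{s.t.}\quad \bm T\bm x+\bm W\bm y^i(\bm\zeta)\ge\bm h(\bm\zeta)\ \ \forall\bm\zeta\in\mathcal{U}_N^i,\ i=1,\ldots,N,$$ where $\mathcal{L}$ is the set of all affine functions $\mathbb{R}^d\to\mathbb{R}^r$. A first-stage decision is the $\bm x$-component of a solution. *)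

theory Defs
  imports "HOL-Probability.Probability"
begin

definition is_norm :: "('a::real_vector \<Rightarrow> real) \<Rightarrow> bool" where
  "is_norm \<nu> \<longleftrightarrow>
     (\<forall>x. \<nu> x = 0 \<longleftrightarrow> x = 0) \<and>
     (\<forall>a x. \<nu> (a *\<^sub>R x) = \<bar>a\<bar> * \<nu> x) \<and>
     (\<forall>x y. \<nu> (x + y) \<le> \<nu> x + \<nu> y)"

(* Dimension means affine dimension, so the polyhedron need not be full-dimensional;
   edge_of (faces of affine dimension one) includes unbounded edges. *)
definition simple_polyhedron :: "'a::euclidean_space set \<Rightarrow> bool" where
  "simple_polyhedron S \<longleftrightarrow> polyhedron S \<and>
     (\<forall>v. v extreme_point_of S \<longrightarrow> int (card {e. e edge_of S \<and> v \<in> e}) = aff_dim S)"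

(* Expectation of an extended-real function, E[f^+] - E[f^-].  In type ereal the
   value of \<infinity> - \<infinity> is \<infinity>, the usual convention for minimization. *)
definition ereal_expectation :: "'a measure \<Rightarrow> ('a \<Rightarrow> ereal) \<Rightarrow> ereal" where
  "ereal_expectation M f =
     enn2ereal (\<integral>\<^sup>+ z. e2ennreal (f z) \<partial>M) - enn2ereal (\<integral>\<^sup>+ z. e2ennreal (- f z) \<partial>M)"

definition affine_map :: "(real^'d \<Rightarrow> real^'r) \<Rightarrow> bool" where
  "affine_map f \<longleftrightarrow> (\<exists>A b. \<forall>\<zeta>. f \<zeta> = A *v \<zeta> + b)"

definition rhs :: "real^'d^'m \<Rightarrow> real^'m \<Rightarrow> real^'d \<Rightarrow> real^'m" where
  "rhs H h0 \<xi> = - (H *v \<xi>) + h0"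

(* Throughout, the order on real vectors is componentwise, optimal values are infima
   in the extended reals, and an infeasible problem has value \<infinity>. *)

definition second_stage_cost ::
  "real^'r \<Rightarrow> real^'n^'m \<Rightarrow> real^'r^'m \<Rightarrow> real^'d^'m \<Rightarrow> real^'m \<Rightarrow> real^'n \<Rightarrow> real^'d \<Rightarrow> ereal" where
  "second_stage_cost q T W H h0 x \<xi> =
     (INF y \<in> {y. T *v x + W *v y \<ge> rhs H h0 \<xi>}. ereal (q \<bullet> y))"

definition two_stage_objective ::
  "(real^'d) measure \<Rightarrow> real^'n \<Rightarrow> real^'r \<Rightarrow> real^'n^'m \<Rightarrow> real^'r^'m \<Rightarrow> real^'d^'m \<Rightarrow> real^'m
     \<Rightarrow> real^'n \<Rightarrow> ereal" where
  "two_stage_objective P c q T W H h0 x =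
     ereal (c \<bullet> x) + ereal_expectation P (second_stage_cost q T W H h0 x)"

definition two_stage_value ::
  "(real^'d) measure \<Rightarrow> real^'n \<Rightarrow> real^'r \<Rightarrow> real^'n^'m \<Rightarrow> real^'r^'m \<Rightarrow> real^'d^'m \<Rightarrow> real^'m
     \<Rightarrow> ereal" where
  "two_stage_value P c q T W H h0 = (INF x. two_stage_objective P c q T W H h0 x)"

definition two_stage_decisions ::
  "(real^'d) measure \<Rightarrow> real^'n \<Rightarrow> real^'r \<Rightarrow> real^'n^'m \<Rightarrow> real^'r^'m \<Rightarrow> real^'d^'m \<Rightarrow> real^'m
     \<Rightarrow> (real^'n) set" where
  "two_stage_decisions P c q T W H h0 =
     {x. two_stage_objective P c q T W H h0 x = two_stage_value P c q T W H h0 \<and>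
         two_stage_objective P c q T W H h0 x < \<infinity>}"

definition uncertainty_set ::
  "('a::real_vector \<Rightarrow> real) \<Rightarrow> 'a set \<Rightarrow> real \<Rightarrow> 'a \<Rightarrow> 'a set" where
  "uncertainty_set \<nu> \<Xi> \<epsilon> \<xi> = \<Xi> \<inter> {\<zeta>. \<nu> (\<zeta> - \<xi>) \<le> \<epsilon>}"

(* In the two approximations U i is the uncertainty set around the i-th sample,
   for i = 1, ..., N. *)

definition sro_feasible ::
  "real^'n^'m \<Rightarrow> real^'r^'m \<Rightarrow> real^'d^'m \<Rightarrow> real^'m \<Rightarrow> nat \<Rightarrow> (nat \<Rightarrow> (real^'d) set)
     \<Rightarrow> ((real^'n) \<times> (real^'d \<Rightarrow> real^'r)) set" where
  "sro_feasible T W H h0 N U =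
     {(x, y). \<forall>\<zeta> \<in> (\<Union>i\<in>{1..N}. U i). T *v x + W *v y \<zeta> \<ge> rhs H h0 \<zeta>}"

definition sro_objective ::
  "real^'n \<Rightarrow> real^'r \<Rightarrow> nat \<Rightarrow> (nat \<Rightarrow> (real^'d) set)
     \<Rightarrow> (real^'n) \<times> (real^'d \<Rightarrow> real^'r) \<Rightarrow> ereal" where
  "sro_objective c q N U = (\<lambda>(x, y).
     ereal (c \<bullet> x) + ereal (1 / real N) * (\<Sum>i\<in>{1..N}. SUP \<zeta>\<in>U i. ereal (q \<bullet> y \<zeta>)))"

definition sro_value ::
  "real^'n \<Rightarrow> real^'r \<Rightarrow> real^'n^'m \<Rightarrow> real^'r^'m \<Rightarrow> real^'d^'m \<Rightarrow> real^'m
     \<Rightarrow> nat \<Rightarrow> (nat \<Rightarrow> (real^'d) set) \<Rightarrow> ereal" where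
  "sro_value c q T W H h0 N U = (INF z \<in> sro_feasible T W H h0 N U. sro_objective c q N U z)"

definition sro_decisions ::
  "real^'n \<Rightarrow> real^'r \<Rightarrow> real^'n^'m \<Rightarrow> real^'r^'m \<Rightarrow> real^'d^'m \<Rightarrow> real^'m
     \<Rightarrow> nat \<Rightarrow> (nat \<Rightarrow> (real^'d) set) \<Rightarrow> (real^'n) set" where
  "sro_decisions c q T W H h0 N U =
     {x. \<exists>y. (x, y) \<in> sro_feasible T W H h0 N U \<and>
             sro_objective c q N U (x, y) = sro_value c q T W H h0 N U}"

(* Only the policies y 1, ..., y N enter the problem; the remaining values of y are
   unconstrained. *)
definition mp_feasible ::
  "real^'n^'m \<Rightarrow> real^'r^'m \<Rightarrow> real^'d^'m \<Rightarrow> real^'m \<Rightarrow> nat \<Rightarrow> (nat \<Rightarrow> (real^'d) set)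
     \<Rightarrow> ((real^'n) \<times> (nat \<Rightarrow> real^'d \<Rightarrow> real^'r)) set" where
  "mp_feasible T W H h0 N U =
     {(x, y). \<forall>i\<in>{1..N}. affine_map (y i) \<and>
        (\<forall>\<zeta> \<in> U i. T *v x + W *v y i \<zeta> \<ge> rhs H h0 \<zeta>)}"

definition mp_objective ::
  "real^'n \<Rightarrow> real^'r \<Rightarrow> nat \<Rightarrow> (nat \<Rightarrow> (real^'d) set)
     \<Rightarrow> (real^'n) \<times> (nat \<Rightarrow> real^'d \<Rightarrow> real^'r) \<Rightarrow> ereal" where
  "mp_objective c q N U = (\<lambda>(x, y).
     ereal (c \<bullet> x) + ereal (1 / real N) * (\<Sum>i\<in>{1..N}. SUP \<zeta>\<in>U i. ereal (q \<bullet> y i \<zeta>)))"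

definition mp_value ::
  "real^'n \<Rightarrow> real^'r \<Rightarrow> real^'n^'m \<Rightarrow> real^'r^'m \<Rightarrow> real^'d^'m \<Rightarrow> real^'m
     \<Rightarrow> nat \<Rightarrow> (nat \<Rightarrow> (real^'d) set) \<Rightarrow> ereal" where
  "mp_value c q T W H h0 N U = (INF z \<in> mp_feasible T W H h0 N U. mp_objective c q N U z)"

definition mp_decisions ::
  "real^'n \<Rightarrow> real^'r \<Rightarrow> real^'n^'m \<Rightarrow> real^'r^'m \<Rightarrow> real^'d^'m \<Rightarrow> real^'m
     \<Rightarrow> nat \<Rightarrow> (nat \<Rightarrow> (real^'d) set) \<Rightarrow> (real^'n) set" where
  "mp_decisions c q T W H h0 N U =
     {x. \<exists>y. (x, y) \<in> mp_feasible T W H h0 N U \<and>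
             mp_objective c q N U (x, y) = mp_value c q T W H h0 N U}"

(* D N is the set of optimal decisions of the N-th problem.  A sequence x_N of optimal
   decisions need not be defined for every N, because a problem may be infeasible or
   its minimum may not be attained.  Hence optimality is required only along the
   subsequence that converges to the accumulation point. *)
definition accumulation_point_of_decisions ::
  "(nat \<Rightarrow> 'a::topological_space set) \<Rightarrow> 'a \<Rightarrow> bool" where
  "accumulation_point_of_decisions D a \<longleftrightarrow>
     (\<exists>(x :: nat \<Rightarrow> 'a) r. strict_mono r \<and> (\<forall>k. x (r k) \<in> D (r k)) \<and> (x \<circ> r) \<longlonglongrightarrow> a)"

end

theory Submission
  imports Defs
begin

text \<open>
The recourse problem sees the decision x and the scenario z only through the residual
h(z) - T x. By linear programming duality, and since the two-stage value is not \<open>- \<infinity>\<close>, its value is finite exactly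
where finitely many linear forms of the residual are nonpositive, and there it is the largest of finitely many other linear
forms (\<open>linear_program_value\<close>). Hence the two-stage problem minimizes a finite, convex and Lipschitz
function f, namely x \<mapsto> c x + E[max of linear forms], over a closed convex set X of almost surely
feasible decisions. For a sample of size N let \<open>f\<^sub>N\<close> be the sample average of the same cost and
\<open>X\<^sub>N\<close> the set of decisions that are feasible at the N sample points.

Lower bound. Every uncertainty set contains its sample point, so the values of both approximations
are at least the infimum of \<open>f\<^sub>N\<close> over \<open>X\<^sub>N\<close>. The strong law of large numbers, used on a countable
dense set of decisions and extended by a common Lipschitz constant, gives \<open>f\<^sub>N\<close> \<rightarrow> f locally uniformly.
It is also applied to the constraint violation, whose mean vanishes exactly on X; so limits of points of
\<open>X\<^sub>N\<close> lie in X. Since the optimal set is bounded, convexity keeps near-optimal points of \<open>X\<^sub>N\<close> from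
escaping to infinity: such a point could be moved along a segment towards an optimal decision until it
stays at a fixed positive distance from all optimal decisions, and a limit would be an optimal decision
(\<open>eventually_lower_bound_convex\<close>). The same limits identify the accumulation points.

Upper bound. Move an optimal decision slightly towards a decision that is feasible on all of \<Xi>. As
there are finitely many constraints and only their right-hand sides depend on the scenario, the new
decision is feasible at all points of \<Xi> within a fixed distance of any sample point
(\<open>feasible_nearby\<close>), and by Lipschitz continuity its cost on a small uncertainty set exceeds the cost
at the sample point by little. Choosing optimal recourse pointwise bounds the sample robust value.

The multi-policy problem needs an affine policy on each uncertainty set, and this is where \<Xi> has to be
simple. At a vertex of a simple polyhedron the edge directions are linearly independent and the
polyhedron lies in the simplicial cone that they span; the coordinates of this cone are affine functions. Every point
of \<Xi> has a vertex such that the inequalities that are loose at the vertex are loose at the point by a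
fixed amount (\<open>exists_vertex_slack_bound\<close>), so close to the point \<Xi> coincides with that cone. Therefore
a piece of \<Xi> of radius e lies in a simplex with vertices in \<Xi> and diameter of order e, on which the
barycentric coordinates are affine (\<open>simple_polyhedron_affine_coordinates\<close>). Interpolating optimal
recourse decisions at the vertices of the simplex gives a feasible affine policy with almost the same cost
(\<open>affine_policy_from_coordinates\<close>).
\<close>

section \<open>Systems of linear inequalities and their vertices\<close>

text \<open>
The pair (a, b) stands for the inequality \<open>a \<bullet> x \<le> b\<close>.
\<close>

type_synonym 'a inequality = "'a \<times> real"

definition slack :: "'a::real_inner inequality \<Rightarrow> 'a \<Rightarrow> real" where
  "slack p z = snd p - fst p \<bullet> z"

definition solutions :: "'a::real_inner inequality set \<Rightarrow> 'a set" where
  "solutions F = {z. \<forall>p\<in>F. 0 \<le> slack p z}"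

definition loose :: "'a::real_inner inequality set \<Rightarrow> 'a \<Rightarrow> 'a inequality set" where
  "loose F z = {p \<in> F. 0 < slack p z}"

lemma slack_add: "slack p (z + d) = slack p z - fst p \<bullet> d"
  by (simp add: slack_def inner_add_right)

lemma polyhedron_eq_solutions:
  fixes S :: "'a::euclidean_space set"
  assumes "polyhedron S"
  obtains F :: "'a inequality set" where "finite F" "S = solutions F"
proof -
  obtain \<H> where fin: "finite \<H>" and S: "S = \<Inter>\<H>"
    and half: "\<forall>h\<in>\<H>. \<exists>a b. a \<noteq> 0 \<and> h = {x. a \<bullet> x \<le> b}"
    using assms unfolding polyhedron_def by blast
  have "\<forall>h\<in>\<H>. \<exists>p. h = {x. 0 \<le> slack p x}"
    using half by (fastforce simp: slack_def)
  then obtain P where P: "\<And>h. h \<in> \<H> \<Longrightarrow> h = {x. 0 \<le> slack (P h) x}" by metis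
  show ?thesis
  proof
    show "finite (P ` \<H>)" using fin by simp
    show "S = solutions (P ` \<H>)" unfolding S solutions_def using P by blast
  qed
qed

lemma convex_solutions: "convex (solutions F)"
proof -
  have "solutions F = (\<Inter>p\<in>F. {x. fst p \<bullet> x \<le> snd p})"
    by (auto simp: solutions_def slack_def)
  then show ?thesis by (simp add: convex_INT convex_halfspace_le)
qed

lemma slack_convex_combination:
  "slack p ((1 - u) *\<^sub>R x + u *\<^sub>R y) = (1 - u) * slack p x + u * slack p y"
  by (simp add: slack_def inner_add_right algebra_simps)

lemma slack_zero_open_segment:
  assumes "x \<in> open_segment a b" "0 \<le> slack p a" "0 \<le> slack p b" "slack p x = 0"
  shows "slack p a = 0" "slack p b = 0"
proof -
  obtain u where u: "0 < u" "u < 1" "x = (1 - u) *\<^sub>R a + u *\<^sub>R b"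
    using assms(1) by (auto simp: in_segment)
  have "(1 - u) * slack p a + u * slack p b = 0"
    using assms(4) unfolding u(3) slack_convex_combination .
  moreover have "0 \<le> (1 - u) * slack p a" "0 \<le> u * slack p b" using u assms by auto
  ultimately have "(1 - u) * slack p a = 0" "u * slack p b = 0" by linarith+
  then show "slack p a = 0" "slack p b = 0" using u by auto
qed

text \<open>
From z one moves in a direction d that keeps all tight inequalities tight, and stops as soon as a loose
inequality becomes tight. The number of loose inequalities thus drops, which is the measure of both
inductions below.
\<close>

lemma move_to_boundary:
  fixes z d :: "'a::real_inner"
  assumes fin: "finite F" and z: "z \<in> solutions F"
    and tight: "\<And>p. p \<in> F \<Longrightarrow> slack p z = 0 \<Longrightarrow> fst p \<bullet> d = 0"
    and ex: "p0 \<in> F" "fst p0 \<bullet> d > 0"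
  obtains t where "t > 0" "z + t *\<^sub>R d \<in> solutions F" "loose F (z + t *\<^sub>R d) \<subset> loose F z"
proof -
  define A where "A = {p \<in> F. fst p \<bullet> d > 0}"
  define r where "r p = slack p z / (fst p \<bullet> d)" for p
  have A: "finite A" "A \<noteq> {}" using fin ex unfolding A_def by (simp, blast)
  define t where "t = Min (r ` A)"
  have "t \<in> r ` A" unfolding t_def using A by (intro Min_in) auto
  then obtain p where p: "p \<in> A" "t = r p" by blast
  have pos: "slack q z > 0" if "q \<in> A" for q
    using that z tight[of q] by (force simp: A_def solutions_def)
  have t: "t > 0" using p pos[of p] by (simp add: r_def A_def)
  have le: "t * (fst q \<bullet> d) \<le> slack q z" if "q \<in> A" for q
  proof -
    have "t \<le> r q" unfolding t_def using that A by auto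
    then show ?thesis using that by (simp add: r_def A_def field_simps)
  qed
  have sol: "z + t *\<^sub>R d \<in> solutions F"
    unfolding solutions_def
  proof (safe)
    fix a b assume q: "(a, b) \<in> F"
    show "0 \<le> slack (a, b) (z + t *\<^sub>R d)"
    proof (cases "(a, b) \<in> A")
      case True
      then show ?thesis using le[of "(a, b)"] by (simp add: slack_add)
    next
      case False
      then have "t * (a \<bullet> d) \<le> 0" using q t by (simp add: A_def mult_nonneg_nonpos)
      moreover have "0 \<le> slack (a, b) z" using z q by (auto simp: solutions_def)
      ultimately show ?thesis by (simp add: slack_add)
    qed
  qed
  have sub: "loose F (z + t *\<^sub>R d) \<subseteq> loose F z"
  proof
    fix q assume q: "q \<in> loose F (z + t *\<^sub>R d)"
    then have "q \<in> F" "0 < slack q z - t * (fst q \<bullet> d)" by (auto simp: loose_def slack_add)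
    moreover have "0 \<le> slack q z" using z \<open>q \<in> F\<close> by (auto simp: solutions_def)
    ultimately show "q \<in> loose F z" using tight[of q] by (force simp: loose_def)
  qed
  have "p \<in> loose F z" using p pos by (auto simp: loose_def A_def)
  moreover have "p \<notin> loose F (z + t *\<^sub>R d)"
    using p by (auto simp: loose_def slack_add r_def A_def)
  ultimately show ?thesis using that[OF t sol] sub by blast
qed

lemma solutions_small_step:
  fixes v d :: "'a::real_inner"
  assumes fin: "finite F" and v: "v \<in> solutions F"
    and tight: "\<And>p. p \<in> F \<Longrightarrow> slack p v = 0 \<Longrightarrow> fst p \<bullet> d \<le> 0"
  obtains t where "t > 0" "v + t *\<^sub>R d \<in> solutions F"
proof -
  have "\<forall>\<^sub>F t in at_right 0. \<forall>p\<in>F. 0 \<le> slack p (v + t *\<^sub>R d)"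
  proof (rule eventually_ball_finite[OF fin], rule ballI)
    fix p assume p: "p \<in> F"
    show "\<forall>\<^sub>F t in at_right 0. 0 \<le> slack p (v + t *\<^sub>R d)"
    proof (cases "slack p v = 0")
      case True
      have "\<forall>\<^sub>F t in at_right (0::real). t > 0" by (simp add: eventually_at_right_less)
      then show ?thesis
        by eventually_elim (use tight[OF p True] True in \<open>simp add: slack_add mult_nonneg_nonpos\<close>)
    next
      case False
      then have "0 < slack p v" using v p by (force simp: solutions_def)
      moreover have "((\<lambda>t. slack p (v + t *\<^sub>R d)) \<longlongrightarrow> slack p (v + 0 *\<^sub>R d)) (at_right 0)"
        unfolding slack_def by (intro tendsto_intros)
      ultimately have "\<forall>\<^sub>F t in at_right 0. 0 < slack p (v + t *\<^sub>R d)"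
        by (intro order_tendstoD(1)) auto
      then show ?thesis by eventually_elim simp
    qed
  qed
  then have "\<forall>\<^sub>F t in at_right (0::real). t > 0 \<and> v + t *\<^sub>R d \<in> solutions F"
    using eventually_at_right_less[of "0::real"] by eventually_elim (auto simp: solutions_def)
  then obtain t where "t > 0" "v + t *\<^sub>R d \<in> solutions F"
    using eventually_happens[of _ "at_right (0::real)"] by force
  then show ?thesis using that by blast
qed

text \<open>
The normals of the inequalities that are tight at an extreme point span the space: a direction
orthogonal to all of them could be followed a little both ways.
\<close>

lemma extreme_point_tight_normals:
  fixes v d :: "'a::euclidean_space"
  assumes fin: "finite F" and v: "v extreme_point_of solutions F"
    and orth: "\<And>p. p \<in> F \<Longrightarrow> slack p v = 0 \<Longrightarrow> fst p \<bullet> d = 0"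
  shows "d = 0"
proof (rule ccontr)
  assume d: "d \<noteq> 0"
  have vs: "v \<in> solutions F" using v by (simp add: extreme_point_of_def)
  obtain s where s: "s > 0" "v + s *\<^sub>R d \<in> solutions F"
    using solutions_small_step[OF fin vs, of d] orth by force
  obtain t where t: "t > 0" "v + t *\<^sub>R (- d) \<in> solutions F"
    using solutions_small_step[OF fin vs, of "- d"] orth by force
  have "v \<in> open_segment (v + s *\<^sub>R d) (v + t *\<^sub>R (- d))"
    unfolding in_segment
  proof (intro conjI exI[of _ "s / (s + t)"])
    show "v + s *\<^sub>R d \<noteq> v + t *\<^sub>R - d"
    proof
      assume "v + s *\<^sub>R d = v + t *\<^sub>R - d"
      then have "(s + t) *\<^sub>R d = 0" by (simp add: algebra_simps)
      then show False using s t d by simp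
    qed
    have "(1 - s / (s + t)) * s - s / (s + t) * t = 0" using s t by (simp add: field_simps)
    moreover have "(1 - u) *\<^sub>R (v + s *\<^sub>R d) + u *\<^sub>R (v + t *\<^sub>R - d) = v + ((1 - u) * s - u * t) *\<^sub>R d" for u
      by (simp add: algebra_simps)
    ultimately show "v = (1 - s / (s + t)) *\<^sub>R (v + s *\<^sub>R d) + (s / (s + t)) *\<^sub>R (v + t *\<^sub>R - d)"
      by simp
  qed (use s t in auto)
  then show False using v s t by (auto simp: extreme_point_of_def)
qed

lemma not_extreme_point_tight_direction:
  fixes z :: "'a::euclidean_space"
  assumes z: "z \<in> solutions F" and nz: "\<not> z extreme_point_of solutions F"
  obtains d where "d \<noteq> 0" "\<And>p. p \<in> F \<Longrightarrow> slack p z = 0 \<Longrightarrow> fst p \<bullet> d = 0"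
proof -
  obtain a b where ab: "a \<in> solutions F" "b \<in> solutions F" "z \<in> open_segment a b"
    using z nz by (auto simp: extreme_point_of_def)
  show ?thesis
  proof
    show "b - a \<noteq> 0" using ab by auto
    fix p assume p: "p \<in> F" "slack p z = 0"
    have "slack p a = 0" "slack p b = 0"
      using slack_zero_open_segment[OF ab(3), of p] ab p by (auto simp: solutions_def)
    then show "fst p \<bullet> (b - a) = 0" by (simp add: slack_def inner_diff_right)
  qed
qed

text \<open>
A point that is not extreme lies between two points with fewer loose inequalities, or on a ray from one
such point along which no slack decreases. One of these endpoints has weight at least one half, so its slacks are at
most twice those of the point; iterating ends at a vertex. No compactness enters, so the bound holds on
unbounded polyhedra too. In particular, an inequality that is loose at the vertex is loose at the point by a fixed
amount, because there are finitely many vertices.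
\<close>

lemma exists_vertex_slack_bound:
  fixes z :: "'a::euclidean_space"
  assumes fin: "finite F" and pointed: "\<And>d. (\<And>p. p \<in> F \<Longrightarrow> fst p \<bullet> d = 0) \<Longrightarrow> d = 0"
    and z: "z \<in> solutions F"
  shows "\<exists>v. v extreme_point_of solutions F \<and> (\<forall>p\<in>F. slack p v \<le> 2 ^ card (loose F z) * slack p z)"
  using z
proof (induction "card (loose F z)" arbitrary: z rule: less_induct)
  case less
  note nn = \<open>z \<in> solutions F\<close>
  have snn: "0 \<le> slack p z" if "p \<in> F" for p using nn that by (auto simp: solutions_def)
  \<comment> \<open>induction step: it suffices to find y with fewer loose inequalities and at most doubled slacks\<close>
  have close: "\<exists>v. v extreme_point_of solutions F \<and> (\<forall>p\<in>F. slack p v \<le> 2 ^ card (loose F z) * slack p z)"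
    if y: "y \<in> solutions F" "loose F y \<subset> loose F z" and le: "\<And>p. p \<in> F \<Longrightarrow> slack p y \<le> 2 * slack p z" for y
  proof -
    have c: "card (loose F y) < card (loose F z)"
      using y fin by (intro psubset_card_mono) (auto simp: loose_def)
    obtain v where v: "v extreme_point_of solutions F"
      "\<forall>p\<in>F. slack p v \<le> 2 ^ card (loose F y) * slack p y"
      using less(1)[OF c y(1)] by blast
    have "slack p v \<le> 2 ^ card (loose F z) * slack p z" if p: "p \<in> F" for p
    proof -
      have "slack p v \<le> 2 ^ card (loose F y) * slack p y" using v p by blast
      also have "\<dots> \<le> 2 ^ card (loose F y) * (2 * slack p z)" using le[OF p] by (intro mult_left_mono) auto
      also have "\<dots> = 2 ^ Suc (card (loose F y)) * slack p z" by simp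
      also have "\<dots> \<le> 2 ^ card (loose F z) * slack p z"
        using c snn[OF p] by (intro mult_right_mono power_increasing) auto
      finally show ?thesis .
    qed
    then show ?thesis using v by blast
  qed
  show ?case
  proof (cases "z extreme_point_of solutions F")
    case True
    have "slack p z \<le> 2 ^ card (loose F z) * slack p z" if "p \<in> F" for p
      using mult_right_mono[of 1 "2 ^ card (loose F z)", OF _ snn[OF that]] by simp
    then show ?thesis using True by blast
  next
    case False
    then obtain d0 where d0: "d0 \<noteq> 0" "\<And>p. p \<in> F \<Longrightarrow> slack p z = 0 \<Longrightarrow> fst p \<bullet> d0 = 0"
      using not_extreme_point_tight_direction[OF nn] by blast
    obtain p0 where p0: "p0 \<in> F" "fst p0 \<bullet> d0 \<noteq> 0" using pointed[of d0] d0(1) by blast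
    define d where "d = (if fst p0 \<bullet> d0 > 0 then d0 else - d0)"
    have d: "fst p0 \<bullet> d > 0" "\<And>p. p \<in> F \<Longrightarrow> slack p z = 0 \<Longrightarrow> fst p \<bullet> d = 0"
      using p0 d0 by (auto simp: d_def)
    obtain s where s: "s > 0" "z + s *\<^sub>R d \<in> solutions F" "loose F (z + s *\<^sub>R d) \<subset> loose F z"
      using move_to_boundary[OF fin nn d(2) p0(1) d(1)] by blast
    show ?thesis
    proof (cases "\<exists>p\<in>F. fst p \<bullet> d < 0")
      case False
      have "slack p (z + s *\<^sub>R d) \<le> 2 * slack p z" if "p \<in> F" for p
      proof -
        have "0 \<le> s * (fst p \<bullet> d)" using False that s(1) by (auto simp: not_less)
        then show ?thesis using snn[OF that] by (simp add: slack_add)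
      qed
      then show ?thesis by (intro close[OF s(2,3)])
    next
      case True
      then obtain p1 where p1: "p1 \<in> F" "fst p1 \<bullet> (- d) > 0" by auto
      obtain t where t: "t > 0" "z + t *\<^sub>R (- d) \<in> solutions F" "loose F (z + t *\<^sub>R (- d)) \<subset> loose F z"
      proof (rule move_to_boundary[OF fin nn _ p1])
        show "fst p \<bullet> (- d) = 0" if "p \<in> F" "slack p z = 0" for p using d(2)[OF that] by simp
      qed blast
      have comb: "t * slack p (z + s *\<^sub>R d) + s * slack p (z + t *\<^sub>R (- d)) = (s + t) * slack p z" for p
        by (simp add: slack_def inner_add_right inner_diff_right algebra_simps)
      have nnt: "0 \<le> slack p (z + s *\<^sub>R d)" "0 \<le> slack p (z + t *\<^sub>R (- d))" if "p \<in> F" for p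
        using s t that by (auto simp: solutions_def)
      show ?thesis
      proof (cases "s \<le> t")
        case True
        show ?thesis
        proof (rule close[OF s(2,3)])
          fix p assume p: "p \<in> F"
          have "t * slack p (z + s *\<^sub>R d) \<le> (s + t) * slack p z"
            using comb[of p] nnt[OF p] s(1) by (smt (verit) mult_nonneg_nonneg)
          also have "\<dots> \<le> (2 * t) * slack p z" using True snn[OF p] by (intro mult_right_mono) auto
          finally show "slack p (z + s *\<^sub>R d) \<le> 2 * slack p z" using t(1) by simp
        qed
      next
        case False
        show ?thesis
        proof (rule close[OF t(2,3)])
          fix p assume p: "p \<in> F"
          have "s * slack p (z + t *\<^sub>R (- d)) \<le> (s + t) * slack p z"
            using comb[of p] nnt[OF p] t(1) by (smt (verit) mult_nonneg_nonneg)
          also have "\<dots> \<le> (2 * s) * slack p z" using False snn[OF p] by (intro mult_right_mono) auto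
          finally show "slack p (z + t *\<^sub>R (- d)) \<le> 2 * slack p z" using s(1) by simp
        qed
      qed
    qed
  qed
qed

text \<open>
The edges at a vertex v generate the tangent cone. A tangent direction u whose minimal face is a ray
comes from an edge. Otherwise there is a further direction d along which the tight inequalities of u stay tight,
and d can be chosen in the kernel of the functional g, the sum of all normals tight at v. As g is negative on
the nonzero part of the cone, neither d nor -d belongs to the cone, so u lies between two points with fewer loose inequalities.
\<close>

lemma mem_convex_cone_hull_edge_directions:
  fixes v u :: "'a::euclidean_space"
  assumes fin: "finite F" and v: "v extreme_point_of solutions F"
    and dir: "\<And>e. e edge_of solutions F \<Longrightarrow> v \<in> e \<Longrightarrow> w e \<in> e - {v}"
    and u: "\<And>p. p \<in> F \<Longrightarrow> slack p v = 0 \<Longrightarrow> fst p \<bullet> u \<le> 0"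
  shows "u \<in> convex_cone hull ((\<lambda>e. w e - v) ` {e. e edge_of solutions F \<and> v \<in> e})"
proof -
  let ?B = "(\<lambda>e. w e - v) ` {e. e edge_of solutions F \<and> v \<in> e}"
  define Tv where "Tv = {p \<in> F. slack p v = 0}"
  \<comment> \<open>the inequalities of the tangent cone at v, translated to the origin\<close>
  define G where "G = (\<lambda>p. (fst p, 0::real)) ` Tv"
  have finG: "finite G" "finite Tv" using fin by (auto simp: G_def Tv_def)
  have vs: "v \<in> solutions F" using v by (simp add: extreme_point_of_def)
  have sG: "slack p x = - (fst p \<bullet> x)" if "p \<in> G" for p x
    using that by (auto simp: G_def slack_def)
  have pointed: "d = 0" if "\<forall>p\<in>Tv. fst p \<bullet> d = 0" for d
    by (rule extreme_point_tight_normals[OF fin v], rule bspec[OF that]) (simp add: Tv_def)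
  define g where "g = (\<Sum>p\<in>Tv. fst p)"
  have "u \<in> solutions G" using u by (auto simp: solutions_def G_def Tv_def slack_def)
  then show ?thesis
  proof (induction "card (loose G u)" arbitrary: u rule: less_induct)
    case less
    note uG = \<open>u \<in> solutions G\<close>
    have ule: "fst p \<bullet> u \<le> 0" if "p \<in> Tv" for p
      using uG that by (auto simp: solutions_def G_def slack_def)
    define Z where "Z = {p \<in> Tv. fst p \<bullet> u = 0}"
    show ?case
    proof (cases "u = 0")
      case True
      then show ?thesis by (simp add: convex_cone_hull_contains_0)
    next
      case u0: False
      show ?thesis
      proof (cases "\<forall>x. (\<forall>p\<in>Z. fst p \<bullet> x = 0) \<longrightarrow> x \<in> span {u}")
        case True
        \<comment> \<open>the minimal face is a ray, so it points along an edge e at v\<close>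
        define e where "e = {z \<in> solutions F. \<forall>p\<in>Z. slack p z = 0}"
        have Zv: "slack p v = 0" if "p \<in> Z" for p using that by (auto simp: Z_def Tv_def)
        have face: "e face_of solutions F"
          unfolding face_of_def
        proof (intro conjI ballI impI)
          show "e \<subseteq> solutions F" by (auto simp: e_def)
          have "{z. slack p z = 0} = {z. fst p \<bullet> z = snd p}" for p :: "'a \<times> real"
            by (auto simp: slack_def)
          moreover have "e = solutions F \<inter> (\<Inter>p\<in>Z. {z. slack p z = 0})"
            by (auto simp: e_def)
          ultimately have "e = solutions F \<inter> (\<Inter>p\<in>Z. {z. fst p \<bullet> z = snd p})" by simp
          then show "convex e"
            by (simp add: convex_Int convex_INT convex_hyperplane convex_solutions)
          fix a b x assume ab: "a \<in> solutions F" "b \<in> solutions F" and x: "x \<in> e" "x \<in> open_segment a b"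
          have "slack p a = 0 \<and> slack p b = 0" if "p \<in> Z" for p
          proof -
            have "p \<in> F" using that by (auto simp: Z_def Tv_def)
            then show ?thesis
              using slack_zero_open_segment[OF x(2), of p] ab x(1) that by (auto simp: e_def solutions_def)
          qed
          then show "a \<in> e" "b \<in> e" using ab by (auto simp: e_def)
        qed
        obtain t where t: "t > 0" "v + t *\<^sub>R u \<in> solutions F"
          by (rule solutions_small_step[OF fin vs, of u]) (use ule in \<open>auto simp: Tv_def\<close>)
        have te: "v + t *\<^sub>R u \<in> e"
          using t(2) Zv by (auto simp: e_def slack_add) (auto simp: Z_def)
        have ve: "v \<in> e" using vs Zv by (auto simp: e_def)
        have line: "\<exists>r. z = v + r *\<^sub>R u" if "z \<in> e" for z
        proof -
          have "fst p \<bullet> (z - v) = 0" if "p \<in> Z" for p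
            using Zv[OF that] \<open>z \<in> e\<close> that by (auto simp: e_def slack_def inner_diff_right)
          then have "z - v \<in> span {u}" using True by blast
          then obtain r where "z - v = r *\<^sub>R u" by (auto simp: span_singleton)
          then show ?thesis by (intro exI[of _ r]) (simp add: algebra_simps)
        qed
        have ne: "v \<noteq> v + t *\<^sub>R u" using t u0 by simp
        have "e \<subseteq> affine hull {v, v + t *\<^sub>R u}"
        proof
          fix z assume "z \<in> e"
          then obtain r where r: "z = v + r *\<^sub>R u" using line by blast
          have "z = (1 - r / t) *\<^sub>R v + (r / t) *\<^sub>R (v + t *\<^sub>R u)"
            using t r by (simp add: algebra_simps)
          then show "z \<in> affine hull {v, v + t *\<^sub>R u}"
            unfolding affine_hull_2 by (intro CollectI exI[of _ "1 - r / t"] exI[of _ "r / t"]) auto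
        qed
        then have "aff_dim e \<le> 1"
          using aff_dim_subset[of e "affine hull {v, v + t *\<^sub>R u}"] ne by simp
        moreover have "1 \<le> aff_dim e"
          using aff_dim_subset[of "{v, v + t *\<^sub>R u}" e] ne te ve by simp
        ultimately have edge: "e edge_of solutions F" using face by (simp add: edge_of_def)
        have we: "w e \<in> e" "w e \<noteq> v" using dir[OF edge ve] by auto
        obtain r where r: "w e = v + r *\<^sub>R u" using line we by blast
        have "r > 0"
        proof (rule ccontr)
          assume "\<not> r > 0"
          then have r0: "r < 0" using r we u0 by (cases "r = 0") auto
          have "v \<in> open_segment (v + t *\<^sub>R u) (w e)"
            unfolding in_segment
          proof (intro conjI exI[of _ "t / (t - r)"])
            have "v + t *\<^sub>R u - w e = (t - r) *\<^sub>R u" by (simp add: r algebra_simps)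
            then show "v + t *\<^sub>R u \<noteq> w e" using u0 r0 t by auto
            have "(1 - t / (t - r)) * t + t / (t - r) * r = 0" using r0 t by (simp add: field_simps)
            moreover have "(1 - q) *\<^sub>R (v + t *\<^sub>R u) + q *\<^sub>R w e = v + ((1 - q) * t + q * r) *\<^sub>R u" for q
              by (simp add: r algebra_simps)
            ultimately show "v = (1 - t / (t - r)) *\<^sub>R (v + t *\<^sub>R u) + (t / (t - r)) *\<^sub>R w e" by simp
          qed (use r0 t in auto)
          moreover have "w e \<in> solutions F" using we by (simp add: e_def)
          ultimately show False using v t by (auto simp: extreme_point_of_def)
        qed
        then have "u = (1 / r) *\<^sub>R (w e - v)" by (simp add: r)
        moreover have "w e - v \<in> convex_cone hull ?B"
          using edge ve by (intro hull_inc) auto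
        ultimately show ?thesis using \<open>r > 0\<close> by (metis convex_cone_hull_mul divide_nonneg_pos zero_le_one)
      next
        case False
        then obtain x where x: "\<And>p. p \<in> Z \<Longrightarrow> fst p \<bullet> x = 0" "x \<notin> span {u}" by blast
        have gu: "g \<bullet> u \<noteq> 0"
        proof
          assume "g \<bullet> u = 0"
          then have "(\<Sum>p\<in>Tv. - (fst p \<bullet> u)) = 0" by (simp add: g_def inner_sum_left sum_negf)
          then have "\<forall>p\<in>Tv. fst p \<bullet> u = 0"
            using ule finG by (subst (asm) sum_nonneg_eq_0_iff) auto
          then show False using pointed u0 by blast
        qed
        \<comment> \<open>projecting x along u into the kernel of g\<close>
        define d where "d = x - ((g \<bullet> x) / (g \<bullet> u)) *\<^sub>R u"
        have d0: "d \<noteq> 0"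
        proof
          assume "d = 0"
          then have "x = ((g \<bullet> x) / (g \<bullet> u)) *\<^sub>R u" by (simp add: d_def)
          moreover have "((g \<bullet> x) / (g \<bullet> u)) *\<^sub>R u \<in> span {u}" by (intro span_scale span_base) simp
          ultimately show False using x(2) by simp
        qed
        have gd: "g \<bullet> d = 0" using gu by (simp add: d_def inner_diff_right)
        have dZ: "fst p \<bullet> d = 0" if "p \<in> Z" for p
          using x(1)[OF that] that by (simp add: d_def inner_diff_right Z_def)
        have sumd: "(\<Sum>p\<in>Tv. fst p \<bullet> d) = 0" using gd by (simp add: g_def inner_sum_left)
        have nz: "\<exists>p\<in>Tv. fst p \<bullet> d \<noteq> 0" using pointed d0 by blast
        have "\<exists>p\<in>Tv. fst p \<bullet> d > 0"
        proof (rule ccontr)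
          assume n: "\<not> ?thesis"
          have "(\<Sum>p\<in>Tv. - (fst p \<bullet> d)) = 0" using sumd by (simp add: sum_negf)
          then have "\<forall>p\<in>Tv. fst p \<bullet> d = 0"
            using n finG by (subst (asm) sum_nonneg_eq_0_iff) (auto simp: not_less)
          then show False using nz by blast
        qed
        then obtain r1 where r1: "r1 \<in> Tv" "fst r1 \<bullet> d > 0" by blast
        then have p1: "(fst r1, 0) \<in> G" "fst (fst r1, 0::real) \<bullet> d > 0" by (simp_all add: G_def)
        have "\<exists>p\<in>Tv. fst p \<bullet> d < 0"
        proof (rule ccontr)
          assume n: "\<not> ?thesis"
          have "\<forall>p\<in>Tv. fst p \<bullet> d = 0"
            using n finG sumd by (subst (asm) sum_nonneg_eq_0_iff) (auto simp: not_less)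
          then show False using nz by blast
        qed
        then obtain r2 where r2: "r2 \<in> Tv" "fst r2 \<bullet> (- d) > 0" by (metis inner_minus_right neg_0_less_iff_less)
        then have p2: "(fst r2, 0) \<in> G" "fst (fst r2, 0::real) \<bullet> (- d) > 0" by (simp_all add: G_def)
        have tight: "fst p \<bullet> d = 0" if inG: "p \<in> G" "slack p u = 0" for p
        proof -
          obtain p' where p': "p' \<in> Tv" "p = (fst p', 0)" using inG(1) unfolding G_def by blast
          then have "p' \<in> Z" using inG(2) by (simp add: slack_def Z_def)
          then show ?thesis using dZ p' by simp
        qed
        then have tight': "fst p \<bullet> (- d) = 0" if "p \<in> G" "slack p u = 0" for p
          using that by simp
        have finl: "finite (loose G u)" using finG by (simp add: loose_def)
        obtain s where s: "s > 0" "u + s *\<^sub>R d \<in> solutions G" "loose G (u + s *\<^sub>R d) \<subset> loose G u"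
          using move_to_boundary[OF finG(1) uG tight p1] by blast
        obtain t where t: "t > 0" "u + t *\<^sub>R (- d) \<in> solutions G" "loose G (u + t *\<^sub>R (- d)) \<subset> loose G u"
          using move_to_boundary[OF finG(1) uG tight' p2] by blast
        have 1: "u + s *\<^sub>R d \<in> convex_cone hull ?B"
          using less(1)[OF psubset_card_mono[OF finl s(3)] s(2)] .
        have 2: "u + t *\<^sub>R (- d) \<in> convex_cone hull ?B"
          using less(1)[OF psubset_card_mono[OF finl t(3)] t(2)] .
        have "(s + t) *\<^sub>R u = t *\<^sub>R (u + s *\<^sub>R d) + s *\<^sub>R (u + t *\<^sub>R (- d))"
          by (simp add: algebra_simps)
        then have "u = (1 / (s + t)) *\<^sub>R (t *\<^sub>R (u + s *\<^sub>R d) + s *\<^sub>R (u + t *\<^sub>R (- d)))"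
          using s(1) t(1) by (metis add_pos_pos divide_self_if less_irrefl scaleR_one scaleR_scaleR times_divide_eq_left mult_1)
        moreover have "(1 / (s + t)) *\<^sub>R (t *\<^sub>R (u + s *\<^sub>R d) + s *\<^sub>R (u + t *\<^sub>R (- d))) \<in> convex_cone hull ?B"
          using s(1) t(1)
          by (intro convex_cone_hull_mul[OF convex_cone_hull_add[OF convex_cone_hull_mul[OF 1] convex_cone_hull_mul[OF 2]]]) simp_all
        ultimately show ?thesis by simp
      qed
    qed
  qed
qed

section \<open>Affine coordinates on small pieces of a simple polyhedron\<close>

text \<open>
Linear functionals that pick out the coordinates with respect to an independent set, represented by vectors.
\<close>

lemma dual_basis:
  fixes B :: "'a::euclidean_space set"
  assumes "independent B"
  obtains \<beta> :: "'a \<Rightarrow> 'a" where "\<And>d d'. d \<in> B \<Longrightarrow> d' \<in> B \<Longrightarrow> \<beta> d \<bullet> d' = (if d = d' then 1 else 0)"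
proof -
  have "\<exists>b. \<forall>d'\<in>B. b \<bullet> d' = (if d = d' then 1 else 0)" for d
  proof -
    obtain g :: "'a \<Rightarrow> real" where g: "linear g" "\<forall>x\<in>B. g x = (if d = x then 1 else 0)"
      using linear_independent_extend[OF assms, of "\<lambda>x. if d = x then 1 else 0"] by blast
    have "adjoint g 1 \<bullet> x = g x" for x
      using adjoint_works[OF g(1), of x 1] by (simp add: inner_commute)
    then show ?thesis using g(2) by metis
  qed
  then show ?thesis using that by metis
qed

lemma convex_cone_hull_subset_combinations:
  fixes B :: "'a::euclidean_space set"
  assumes fin: "finite B"
  shows "convex_cone hull B \<subseteq> {z. \<exists>t. (\<forall>d\<in>B. 0 \<le> t d) \<and> z = (\<Sum>d\<in>B. t d *\<^sub>R d)}" (is "_ \<subseteq> ?C")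
proof (rule hull_minimal)
  show "B \<subseteq> ?C"
  proof
    fix x assume "x \<in> B"
    have "(\<Sum>d\<in>B. (if d = x then 1 else 0) *\<^sub>R d) = (\<Sum>d\<in>B. if d = x then x else 0)"
      by (intro sum.cong) auto
    also have "\<dots> = x" using fin \<open>x \<in> B\<close> by simp
    finally show "x \<in> ?C" by (intro CollectI exI[of _ "\<lambda>d. if d = x then 1 else 0"]) auto
  qed
  show "convex_cone ?C"
    unfolding convex_cone_iff
  proof (intro conjI allI impI ballI)
    show "0 \<in> ?C" by (intro CollectI exI[of _ "\<lambda>_. 0"]) auto
    fix x y assume "x \<in> ?C" "y \<in> ?C"
    then obtain s t where "\<forall>d\<in>B. 0 \<le> s d" "x = (\<Sum>d\<in>B. s d *\<^sub>R d)" "\<forall>d\<in>B. 0 \<le> t d" "y = (\<Sum>d\<in>B. t d *\<^sub>R d)"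
      by blast
    then show "x + y \<in> ?C"
      by (intro CollectI exI[of _ "\<lambda>d. s d + t d"]) (auto simp: algebra_simps sum.distrib)
  next
    fix x and c :: real assume a: "x \<in> ?C" "0 \<le> c"
    then obtain s where "\<forall>d\<in>B. 0 \<le> s d" "x = (\<Sum>d\<in>B. s d *\<^sub>R d)" by blast
    then show "c *\<^sub>R x \<in> ?C" using a
      by (intro CollectI exI[of _ "\<lambda>d. c * s d"]) (auto simp: scaleR_sum_right)
  qed
qed

text \<open>
The edge directions at a vertex span the affine hull, translated to the origin. Simplicity says that
there are no more of them than its dimension, so they are linearly independent and the coordinates of
a point with respect to them are unique, nonnegative, and affine in the point.
\<close>

lemma simple_polyhedron_vertex_coordinates:
  fixes S :: "'a::euclidean_space set"
  assumes S: "simple_polyhedron S" and v: "v extreme_point_of S"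
  obtains B :: "'a set" and \<beta> :: "'a \<Rightarrow> 'a" where "finite B" "\<forall>d\<in>B. v + d \<in> S"
    "\<forall>d\<in>B. \<forall>d'\<in>B. \<beta> d \<bullet> d' = (if d = d' then 1 else 0)"
    "\<forall>z\<in>S. (\<forall>d\<in>B. 0 \<le> \<beta> d \<bullet> (z - v)) \<and> z - v = (\<Sum>d\<in>B. (\<beta> d \<bullet> (z - v)) *\<^sub>R d)"
proof -
  have poly: "polyhedron S" using S by (simp add: simple_polyhedron_def)
  obtain F where F: "finite F" "S = solutions F" using polyhedron_eq_solutions[OF poly] .
  let ?E = "{e. e edge_of S \<and> v \<in> e}"
  have vs: "v \<in> S" using v by (simp add: extreme_point_of_def)
  have finE: "finite ?E"
    by (rule finite_subset[OF _ finite_polyhedron_faces[OF poly]]) (auto simp: edge_of_def)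
  have "\<exists>x. x \<in> e - {v}" if "e edge_of S" for e
  proof (rule ccontr)
    assume "\<not> ?thesis"
    then have "e \<subseteq> {v}" by auto
    then have "aff_dim e \<le> 0" using aff_dim_subset[of e "{v}"] by simp
    then show False using that by (simp add: edge_of_def)
  qed
  \<comment> \<open>a second point on each edge fixes its direction; its distance from v is immaterial as long as it lies in S\<close>
  then obtain w where w: "\<And>e. e edge_of S \<Longrightarrow> w e \<in> e - {v}" by metis
  define B where "B = (\<lambda>e. w e - v) ` ?E"
  have finB: "finite B" using finE by (simp add: B_def)
  have vB: "v + d \<in> S" if "d \<in> B" for d
    using that w edge_of_imp_subset by (fastforce simp: B_def)
  have cone: "z - v \<in> convex_cone hull B" if "z \<in> S" for z
    unfolding B_def F(2)
  proof (rule mem_convex_cone_hull_edge_directions[OF F(1)])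
    show "v extreme_point_of solutions F" using v F by simp
    show "w e \<in> e - {v}" if "e edge_of solutions F" for e using w that F by simp
    show "fst p \<bullet> (z - v) \<le> 0" if "p \<in> F" "slack p v = 0" for p
      using \<open>z \<in> S\<close> that F by (auto simp: solutions_def slack_def inner_diff_right)
  qed
  have comb: "\<exists>t. (\<forall>d\<in>B. 0 \<le> t d) \<and> z - v = (\<Sum>d\<in>B. t d *\<^sub>R d)" if "z \<in> S" for z
    using cone[OF that] convex_cone_hull_subset_combinations[OF finB] by blast
  have "(+) (- v) ` S \<subseteq> span B"
  proof safe
    fix z assume "z \<in> S"
    then obtain t where "z - v = (\<Sum>d\<in>B. t d *\<^sub>R d)" using comb by blast
    then have "- v + z = (\<Sum>d\<in>B. t d *\<^sub>R d)" by simp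
    then show "- v + z \<in> span B" by (auto intro!: span_sum span_scale intro: span_base)
  qed
  then have "dim ((+) (- v) ` S) \<le> dim B" by (metis dim_mono dim_span)
  moreover have "aff_dim S = int (dim ((+) (- v) ` S))"
    using vs by (intro aff_dim_eq_dim) (simp add: hull_inc)
  moreover have "int (card ?E) = aff_dim S" using S v by (simp add: simple_polyhedron_def)
  moreover have "card B \<le> card ?E" unfolding B_def using finE by (rule card_image_le)
  ultimately have "card B \<le> dim B" by linarith
  then have ind: "independent B"
    using card_le_dim_spanning[of B "span B"] finB span_superset[of B] by simp
  obtain \<beta> where \<beta>: "\<And>d d'. d \<in> B \<Longrightarrow> d' \<in> B \<Longrightarrow> \<beta> d \<bullet> d' = (if d = d' then 1 else 0)"
    using dual_basis[OF ind] by metis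
  have coord: "(\<forall>d\<in>B. 0 \<le> \<beta> d \<bullet> (z - v)) \<and> z - v = (\<Sum>d\<in>B. (\<beta> d \<bullet> (z - v)) *\<^sub>R d)" if "z \<in> S" for z
  proof -
    obtain t where t: "\<forall>d\<in>B. 0 \<le> t d" "z - v = (\<Sum>d\<in>B. t d *\<^sub>R d)" using comb \<open>z \<in> S\<close> by blast
    have "\<beta> d \<bullet> (z - v) = t d" if "d \<in> B" for d
    proof -
      have "\<beta> d \<bullet> (z - v) = (\<Sum>d'\<in>B. if d = d' then t d' else 0)"
        unfolding t(2) inner_sum_right using \<beta> that by (intro sum.cong) auto
      then show ?thesis using finB that by simp
    qed
    then show ?thesis using t by simp
  qed
  show ?thesis
    by (rule that[OF finB, of \<beta>]) (intro ballI vB \<beta> coord; assumption)+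
qed

text \<open>
The points of U are convex combinations of finitely many points of V, with coefficients that are affine
functions of the point. This is what is needed to extend data on V to an affine function that is controlled
on U.
\<close>

definition affine_coordinates :: "'a::euclidean_space set \<Rightarrow> 'a set \<Rightarrow> bool" where
  "affine_coordinates U V \<longleftrightarrow> (\<exists>I (p :: 'a \<Rightarrow> 'a) a k. finite I \<and> p ` I \<subseteq> V \<and>
     (\<forall>z\<in>U. (\<forall>i\<in>I. 0 \<le> a i \<bullet> z + k i) \<and> (\<Sum>i\<in>I. a i \<bullet> z + k i) = 1 \<and>
        z = (\<Sum>i\<in>I. (a i \<bullet> z + k i) *\<^sub>R p i)))"

lemma affine_coordinates_mono:
  assumes "affine_coordinates U V" "U' \<subseteq> U" "V \<subseteq> V'"
  shows "affine_coordinates U' V'"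
proof -
  obtain I :: "'a set" and p a k where "finite I" "p ` I \<subseteq> V"
     "\<forall>z\<in>U. (\<forall>i\<in>I. 0 \<le> a i \<bullet> z + k i) \<and> (\<Sum>i\<in>I. a i \<bullet> z + k i) = 1 \<and>
        z = (\<Sum>i\<in>I. (a i \<bullet> z + k i) *\<^sub>R p i)"
    using assms(1) unfolding affine_coordinates_def by blast
  then show ?thesis
    using assms(2,3) unfolding affine_coordinates_def
    by (intro exI[of _ I] exI[of _ p] exI[of _ a] exI[of _ k]) (simp add: subset_iff)
qed

text \<open>
Let x be a point at which all inequalities that are loose at v keep a fixed slack. Shrinking every edge
coordinate of x by K e (but not below 0) gives the corner p 0 of a simplex with edges parallel to the edges
at v. The simplex contains the points of S within distance e of x, since K is a Lipschitz constant of the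
coordinates, and its size is of order e. Its corners satisfy the inequalities tight at v because their edge
coordinates are nonnegative, and the other ones because they are close to x.
\<close>

lemma affine_coordinates_near_vertex:
  fixes S :: "'a::euclidean_space set"
  assumes S: "simple_polyhedron S" and v: "v extreme_point_of S"
    and F: "finite F" "S = solutions F" and \<kappa>: "\<kappa> > 0"
  obtains C e0 where "C > 0" "e0 > 0"
    "\<And>x e. x \<in> S \<Longrightarrow> (\<And>p. p \<in> F \<Longrightarrow> slack p v \<le> \<kappa> * slack p x) \<Longrightarrow> 0 < e \<Longrightarrow> e \<le> e0 \<Longrightarrow>
       affine_coordinates (S \<inter> cball x e) (S \<inter> cball x (C * e))"
proof -
  obtain B \<beta> where B: "finite B" and vB': "\<forall>d\<in>B. v + d \<in> S"
    and \<beta>': "\<forall>d\<in>B. \<forall>d'\<in>B. \<beta> d \<bullet> d' = (if d = d' then 1 else 0)"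
    and coord: "\<forall>z\<in>S. (\<forall>d\<in>B. 0 \<le> \<beta> d \<bullet> (z - v)) \<and> z - v = (\<Sum>d\<in>B. (\<beta> d \<bullet> (z - v)) *\<^sub>R d)"
    using simple_polyhedron_vertex_coordinates[OF S v] .
  note vB = bspec[OF vB'] and \<beta> = bspec[OF bspec[OF \<beta>']]
    and nn = bspec[OF conjunct1[OF bspec[OF coord]]] and rep = conjunct2[OF bspec[OF coord]]
  have B0: "0 \<notin> B" using \<beta>[of 0 0] by auto
  have vs: "v \<in> S" using v by (simp add: extreme_point_of_def)
  define K where "K = (\<Sum>d\<in>B. norm (\<beta> d)) + 1"
  define G where "G = (\<Sum>d\<in>B. norm d) + 1"
  define A where "A = (\<Sum>p\<in>F. norm (fst p)) + 1"
  define m where "m = real (card B) + 1"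
  have pos: "K \<ge> 1" "G \<ge> 1" "A \<ge> 1" "m \<ge> 1" by (auto simp: K_def G_def A_def m_def sum_nonneg)
  have Kd: "norm (\<beta> d) \<le> K" if "d \<in> B" for d
    using member_le_sum[of d B "\<lambda>d. norm (\<beta> d)"] that B by (simp add: K_def)
  have Gd: "norm d \<le> G" if "d \<in> insert 0 B" for d
    using member_le_sum[of d B norm] that B pos by (auto simp: G_def)
  have Ap: "norm (fst p) \<le> A" if "p \<in> F" for p
    using member_le_sum[of p F "\<lambda>p. norm (fst p)"] that F by (simp add: A_def)
  define C where "C = K * G + 2 * K * m * G"
  have C: "C > 0" unfolding C_def using pos by (intro add_pos_pos mult_pos_pos) auto
  obtain \<delta> where \<delta>: "\<delta> > 0" "\<And>p. p \<in> loose F v \<Longrightarrow> \<delta> \<le> slack p v / \<kappa>"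
  proof -
    let ?D = "insert 1 ((\<lambda>p. slack p v / \<kappa>) ` loose F v)"
    have "finite ?D" using F by (simp add: loose_def)
    then have "Min ?D > 0" "\<And>p. p \<in> loose F v \<Longrightarrow> Min ?D \<le> slack p v / \<kappa>"
      using \<kappa> by (auto simp: loose_def)
    then show ?thesis using that by blast
  qed
  define e0 where "e0 = \<delta> / (A * C)"
  have e0: "e0 > 0" using \<delta> C pos by (simp add: e0_def)
  show ?thesis
  proof (rule that[OF C e0])
    fix x e assume x: "x \<in> S" and slk: "\<And>p. p \<in> F \<Longrightarrow> slack p v \<le> \<kappa> * slack p x" and e: "0 < e" "e \<le> e0"
    define t where "t d z = \<beta> d \<bullet> (z - v)" for d z
    \<comment> \<open>\<open>insert 0 B\<close> indexes the corners of the simplex: 0 stands for the corner with edge coordinates \<open>\<alpha>\<close>\<close>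
    define \<alpha> where "\<alpha> d = max 0 (t d x - K * e)" for d
    define s where "s = 2 * K * e * m"
    have s: "s > 0" using pos e by (simp add: s_def)
    define p0 where "p0 = v + (\<Sum>d\<in>B. \<alpha> d *\<^sub>R d)"
    define p where "p d = p0 + s *\<^sub>R d" for d
    have tl: "\<bar>t d z - t d x\<bar> \<le> K * e" if "d \<in> B" "z \<in> cball x e" for d z
    proof -
      have "\<bar>t d z - t d x\<bar> = \<bar>\<beta> d \<bullet> (z - x)\<bar>" by (simp add: t_def inner_diff_right)
      also have "\<dots> \<le> norm (\<beta> d) * norm (z - x)" by (rule Cauchy_Schwarz_ineq2)
      also have "\<dots> \<le> K * e" using Kd[OF that(1)] that(2) e pos
        by (intro mult_mono) (auto simp: dist_norm norm_minus_commute)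
      finally show ?thesis .
    qed
    have \<alpha>x: "\<bar>\<alpha> d - t d x\<bar> \<le> K * e" if "d \<in> B" for d
      using nn[OF x that] pos e by (auto simp: \<alpha>_def t_def max_def)
    have "p0 - x = (\<Sum>d\<in>B. (\<alpha> d - t d x) *\<^sub>R d)"
    proof -
      have "p0 - x = (\<Sum>d\<in>B. \<alpha> d *\<^sub>R d) - (x - v)" by (simp add: p0_def)
      also have "\<dots> = (\<Sum>d\<in>B. (\<alpha> d - t d x) *\<^sub>R d)"
        by (subst rep[OF x]) (simp add: t_def scaleR_diff_left sum_subtractf)
      finally show ?thesis .
    qed
    then have "norm (p0 - x) \<le> (\<Sum>d\<in>B. norm ((\<alpha> d - t d x) *\<^sub>R d))" by (simp only: norm_sum)
    also have "\<dots> \<le> (\<Sum>d\<in>B. K * e * norm d)"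
      using \<alpha>x by (intro sum_mono) (auto intro!: mult_right_mono)
    also have "\<dots> \<le> K * e * G" using pos e by (simp add: G_def sum_distrib_left[symmetric])
    finally have p0x: "norm (p0 - x) \<le> K * e * G" .
    have px: "norm (p d - x) \<le> C * e" if "d \<in> insert 0 B" for d
    proof -
      have "norm (p d - x) \<le> norm (p0 - x) + norm (s *\<^sub>R d)"
        unfolding p_def by (metis add_diff_eq add.commute norm_triangle_ineq)
      also have "\<dots> \<le> K * e * G + s * G"
        using p0x Gd[OF that] s by (intro add_mono) auto
      finally show ?thesis by (simp add: C_def s_def algebra_simps)
    qed
    have pcone: "\<exists>\<gamma>. (\<forall>d\<in>B. 0 \<le> \<gamma> d) \<and> p d' = v + (\<Sum>d\<in>B. \<gamma> d *\<^sub>R d)" if "d' \<in> insert 0 B" for d'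
    proof -
      have "(\<Sum>d\<in>B. (\<alpha> d + (if d = d' then s else 0)) *\<^sub>R d)
          = (\<Sum>d\<in>B. \<alpha> d *\<^sub>R d) + (\<Sum>d\<in>B. if d = d' then s *\<^sub>R d' else 0)"
        unfolding sum.distrib[symmetric] by (intro sum.cong) (auto simp: algebra_simps)
      also have "(\<Sum>d\<in>B. if d = d' then s *\<^sub>R d' else 0) = s *\<^sub>R d'"
        using that B B0 by (auto simp: sum.delta)
      finally have "p d' = v + (\<Sum>d\<in>B. (\<alpha> d + (if d = d' then s else 0)) *\<^sub>R d)"
        by (simp add: p_def p0_def)
      moreover have "\<forall>d\<in>B. 0 \<le> \<alpha> d + (if d = d' then s else 0)" using s by (auto simp: \<alpha>_def)
      ultimately show ?thesis by (intro exI[of _ "\<lambda>d. \<alpha> d + (if d = d' then s else 0)"] conjI)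
    qed
    have pS: "p d' \<in> S" if d': "d' \<in> insert 0 B" for d'
      unfolding F(2) solutions_def
    proof (intro CollectI ballI)
      fix q assume q: "q \<in> F"
      show "0 \<le> slack q (p d')"
      proof (cases "slack q v = 0")
        case True
        obtain \<gamma> where \<gamma>: "\<forall>d\<in>B. 0 \<le> \<gamma> d" "p d' = v + (\<Sum>d\<in>B. \<gamma> d *\<^sub>R d)" using pcone[OF d'] by blast
        have "fst q \<bullet> d \<le> 0" if "d \<in> B" for d
        proof -
          have "0 \<le> slack q (v + d)" using vB[OF that] F q by (auto simp: solutions_def)
          then show ?thesis using True by (simp add: slack_add)
        qed
        then have "(\<Sum>d\<in>B. \<gamma> d * (fst q \<bullet> d)) \<le> 0"
          using \<gamma> by (intro sum_nonpos) (auto intro: mult_nonneg_nonpos)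
        then show ?thesis unfolding \<gamma>(2) slack_add using True by (simp add: inner_sum_right)
      next
        case False
        then have "q \<in> loose F v" using q vs F by (force simp: loose_def solutions_def)
        then have "\<delta> \<le> slack q v / \<kappa>" using \<delta> by blast
        also have "\<dots> \<le> slack q x" using slk[OF q] \<kappa> by (simp add: field_simps)
        finally have 1: "\<delta> \<le> slack q x" .
        have "fst q \<bullet> (p d' - x) \<le> norm (fst q) * norm (p d' - x)" by (rule norm_cauchy_schwarz)
        also have "\<dots> \<le> A * (C * e)" using Ap[OF q] px[OF d'] pos by (intro mult_mono) auto
        also have "\<dots> \<le> A * (C * e0)" using e pos C by (intro mult_left_mono) auto
        also have "\<dots> = \<delta>" using pos C by (simp add: e0_def)
        finally show ?thesis using 1 slack_add[of q x "p d' - x"] by simp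
      qed
    qed
    define a where "a d = (if d = 0 then - (\<Sum>d\<in>B. (1/s) *\<^sub>R \<beta> d) else (1/s) *\<^sub>R \<beta> d)" for d
    define k where "k d = (if d = 0 then 1 + (\<Sum>d\<in>B. (\<beta> d \<bullet> v + \<alpha> d) / s) else - ((\<beta> d \<bullet> v + \<alpha> d) / s))" for d
    have bB: "a d \<bullet> z + k d = (t d z - \<alpha> d) / s" if "d \<in> B" for d z
      using that B0 by (auto simp: a_def k_def t_def inner_diff_right diff_divide_distrib add_divide_distrib)
    have b0: "a 0 \<bullet> z + k 0 = 1 - (\<Sum>d\<in>B. (t d z - \<alpha> d) / s)" for z
    proof -
      have "a 0 \<bullet> z + k 0 = 1 - ((\<Sum>d\<in>B. (\<beta> d \<bullet> z) / s) - (\<Sum>d\<in>B. (\<beta> d \<bullet> v + \<alpha> d) / s))"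
        by (simp add: a_def k_def inner_sum_left)
      also have "\<dots> = 1 - (\<Sum>d\<in>B. (t d z - \<alpha> d) / s)"
        unfolding sum_subtractf[symmetric]
        by (simp add: t_def inner_diff_right diff_divide_distrib add_divide_distrib algebra_simps)
      finally show ?thesis .
    qed
    have "(\<forall>i\<in>insert 0 B. 0 \<le> a i \<bullet> z + k i) \<and> (\<Sum>i\<in>insert 0 B. a i \<bullet> z + k i) = 1 \<and>
        z = (\<Sum>i\<in>insert 0 B. (a i \<bullet> z + k i) *\<^sub>R p i)" if z: "z \<in> S \<inter> cball x e" for z
    proof -
      have ge: "0 \<le> t d z - \<alpha> d" if "d \<in> B" for d
        using tl[OF that, of z] z nn[of z d] that by (auto simp: \<alpha>_def t_def)
      have le: "t d z - \<alpha> d \<le> 2 * K * e" if "d \<in> B" for d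
        using tl[OF that, of z] z by (auto simp: \<alpha>_def)
      have "(\<Sum>d\<in>B. (t d z - \<alpha> d) / s) \<le> (\<Sum>d\<in>B. 2 * K * e / s)"
        using le s by (intro sum_mono divide_right_mono) auto
      also have "\<dots> = real (card B) / m" using pos e by (simp add: s_def)
      also have "\<dots> \<le> 1" using pos by (simp add: m_def)
      finally have sle: "(\<Sum>d\<in>B. (t d z - \<alpha> d) / s) \<le> 1" .
      have nonneg: "0 \<le> a i \<bullet> z + k i" if "i \<in> insert 0 B" for i
        using that b0[of z] sle bB[of i z] ge[of i] s by (cases "i = 0") auto
      have sB: "(\<Sum>i\<in>B. a i \<bullet> z + k i) = (\<Sum>d\<in>B. (t d z - \<alpha> d) / s)"
        using bB by (intro sum.cong) auto
      have one: "(\<Sum>i\<in>insert 0 B. a i \<bullet> z + k i) = 1"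
        using B B0 sB b0[of z] by simp
      have split: "(\<Sum>i\<in>insert 0 B. b i *\<^sub>R (p0 + s *\<^sub>R i))
          = (\<Sum>i\<in>insert 0 B. b i) *\<^sub>R p0 + (\<Sum>i\<in>insert 0 B. (b i * s) *\<^sub>R i)" for b :: "'a \<Rightarrow> real"
        by (simp only: scaleR_add_right sum.distrib scaleR_sum_left scaleR_scaleR)
      have "(\<Sum>i\<in>insert 0 B. (a i \<bullet> z + k i) *\<^sub>R p i)
          = (\<Sum>i\<in>insert 0 B. a i \<bullet> z + k i) *\<^sub>R p0 + (\<Sum>i\<in>insert 0 B. ((a i \<bullet> z + k i) * s) *\<^sub>R i)"
        using split[of "\<lambda>i. a i \<bullet> z + k i"] by (simp only: p_def)
      also have "(\<Sum>i\<in>insert 0 B. ((a i \<bullet> z + k i) * s) *\<^sub>R i) = (\<Sum>d\<in>B. (t d z - \<alpha> d) *\<^sub>R d)"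
        using B B0 bB s by (simp cong: sum.cong)
      also have "\<dots> = (z - v) - (\<Sum>d\<in>B. \<alpha> d *\<^sub>R d)"
        using rep[of z] z by (simp add: t_def scaleR_diff_left sum_subtractf)
      finally have "z = (\<Sum>i\<in>insert 0 B. (a i \<bullet> z + k i) *\<^sub>R p i)"
        unfolding one by (simp add: p0_def)
      then show ?thesis using nonneg one by blast
    qed
    then have "finite (insert 0 B) \<and> p ` insert 0 B \<subseteq> S \<inter> cball x (C * e) \<and>
      (\<forall>z\<in>S \<inter> cball x e. (\<forall>i\<in>insert 0 B. 0 \<le> a i \<bullet> z + k i) \<and> (\<Sum>i\<in>insert 0 B. a i \<bullet> z + k i) = 1 \<and>
        z = (\<Sum>i\<in>insert 0 B. (a i \<bullet> z + k i) *\<^sub>R p i))"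
      using B pS px by (intro conjI ballI) (auto simp: dist_norm norm_minus_commute)
    then show "affine_coordinates (S \<inter> cball x e) (S \<inter> cball x (C * e))"
      unfolding affine_coordinates_def by (intro exI)
  qed
qed

text \<open>
A polyhedron has finitely many vertices, so the constants obtained near the single vertices can be made uniform.
\<close>

theorem simple_polyhedron_affine_coordinates:
  fixes S :: "'a::euclidean_space set"
  assumes S: "simple_polyhedron S" and vertex: "\<exists>v. v extreme_point_of S"
  obtains C e0 where "C > 0" "e0 > 0"
    "\<And>x e. x \<in> S \<Longrightarrow> 0 < e \<Longrightarrow> e \<le> e0 \<Longrightarrow> affine_coordinates (S \<inter> cball x e) (S \<inter> cball x (C * e))"
proof -
  have poly: "polyhedron S" using S by (simp add: simple_polyhedron_def)
  obtain F where F: "finite F" "S = solutions F" using polyhedron_eq_solutions[OF poly] .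
  obtain v0 where v0: "v0 extreme_point_of solutions F" using vertex F by blast
  have pointed: "d = 0" if "\<And>p. p \<in> F \<Longrightarrow> fst p \<bullet> d = 0" for d
    by (rule extreme_point_tight_normals[OF F(1) v0]) (use that in auto)
  let ?V = "{v. v extreme_point_of S}"
  have finV: "finite ?V" by (rule finite_polyhedron_extreme_points[OF poly])
  define \<kappa> :: real where "\<kappa> = 2 ^ card F"
  have \<kappa>: "\<kappa> > 0" by (simp add: \<kappa>_def)
  have "\<forall>v\<in>?V. \<exists>C e0. C > 0 \<and> e0 > 0 \<and> (\<forall>x e. x \<in> S \<longrightarrow> (\<forall>p\<in>F. slack p v \<le> \<kappa> * slack p x) \<longrightarrow> 0 < e \<longrightarrow> e \<le> e0 \<longrightarrow>
       affine_coordinates (S \<inter> cball x e) (S \<inter> cball x (C * e)))"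
  proof
    fix v assume "v \<in> ?V"
    then have v: "v extreme_point_of S" by simp
    show "\<exists>C e0. C > 0 \<and> e0 > 0 \<and> (\<forall>x e. x \<in> S \<longrightarrow> (\<forall>p\<in>F. slack p v \<le> \<kappa> * slack p x) \<longrightarrow> 0 < e \<longrightarrow> e \<le> e0 \<longrightarrow>
       affine_coordinates (S \<inter> cball x e) (S \<inter> cball x (C * e)))"
      by (rule affine_coordinates_near_vertex[OF S v F \<kappa>]) blast
  qed
  then obtain c \<epsilon> where c: "\<And>v. v \<in> ?V \<Longrightarrow> c v > 0" "\<And>v. v \<in> ?V \<Longrightarrow> \<epsilon> v > 0"
    and cov: "\<And>v x e. v \<in> ?V \<Longrightarrow> x \<in> S \<Longrightarrow> (\<forall>p\<in>F. slack p v \<le> \<kappa> * slack p x) \<Longrightarrow> 0 < e \<Longrightarrow> e \<le> \<epsilon> v \<Longrightarrow>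
       affine_coordinates (S \<inter> cball x e) (S \<inter> cball x (c v * e))"
    by metis
  define C where "C = Max (c ` ?V)"
  define e0 where "e0 = Min (\<epsilon> ` ?V)"
  have ne: "?V \<noteq> {}" using vertex by blast
  have C: "c v \<le> C" "e0 \<le> \<epsilon> v" if "v \<in> ?V" for v
    using that finV by (auto simp: C_def e0_def)
  show ?thesis
  proof (rule that[of C e0])
    show "e0 > 0" unfolding e0_def using finV ne c by (subst Min_gr_iff) auto
    obtain v where "v \<in> ?V" using ne by blast
    then show "C > 0" using C c less_le_trans by blast
    fix x e assume x: "x \<in> S" and e: "0 < e" "e \<le> e0"
    obtain v where v: "v extreme_point_of S" "\<forall>p\<in>F. slack p v \<le> 2 ^ card (loose F x) * slack p x"
      using exists_vertex_slack_bound[OF F(1) pointed] x F by metis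
    have "slack p v \<le> \<kappa> * slack p x" if "p \<in> F" for p
    proof -
      have "slack p v \<le> 2 ^ card (loose F x) * slack p x" using v that by blast
      also have "\<dots> \<le> \<kappa> * slack p x"
        unfolding \<kappa>_def using x F that
        by (intro mult_right_mono power_increasing card_mono) (auto simp: loose_def solutions_def)
      finally show ?thesis .
    qed
    then have "affine_coordinates (S \<inter> cball x e) (S \<inter> cball x (c v * e))"
      using v x e C(2)[of v] by (intro cov) auto
    then show "affine_coordinates (S \<inter> cball x e) (S \<inter> cball x (C * e))"
    proof (rule affine_coordinates_mono)
      have "c v * e \<le> C * e" using C(1)[of v] v e by (intro mult_right_mono) auto
      then show "S \<inter> cball x (c v * e) \<subseteq> S \<inter> cball x (C * e)" by auto
    qed simp
  qed
qed

section \<open>Piecewise linear form of the optimal value of a linear program\<close>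

text \<open>
Maximum of finitely many linear forms: the support function of the finite set A. It is meaningful only
for finite nonempty A.
\<close>

definition support_value :: "'a::real_inner set \<Rightarrow> 'a \<Rightarrow> real" where
  "support_value A b = Max ((\<lambda>l. l \<bullet> b) ` A)"

lemma support_value_ge: "finite A \<Longrightarrow> l \<in> A \<Longrightarrow> l \<bullet> b \<le> support_value A b"
  by (simp add: support_value_def)

lemma support_value_le_iff:
  "finite A \<Longrightarrow> A \<noteq> {} \<Longrightarrow> support_value A b \<le> r \<longleftrightarrow> (\<forall>l\<in>A. l \<bullet> b \<le> r)"
  by (simp add: support_value_def)

lemma support_value_Lipschitz:
  assumes A: "finite A" "A \<noteq> {}"
  shows "\<bar>support_value A b - support_value A b'\<bar> \<le> (\<Sum>l\<in>A. norm l) * norm (b - b')"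
proof -
  have "support_value A b \<le> support_value A b' + (\<Sum>l\<in>A. norm l) * norm (b - b')" for b b'
    unfolding support_value_le_iff[OF A]
  proof
    fix l assume l: "l \<in> A"
    have "l \<bullet> b = l \<bullet> b' + l \<bullet> (b - b')" by (simp add: inner_diff_right)
    also have "l \<bullet> (b - b') \<le> norm l * norm (b - b')" by (rule norm_cauchy_schwarz)
    also have "\<dots> \<le> (\<Sum>l\<in>A. norm l) * norm (b - b')"
      using A l by (intro mult_right_mono member_le_sum) auto
    finally show "l \<bullet> b \<le> support_value A b' + (\<Sum>l\<in>A. norm l) * norm (b - b')"
      using support_value_ge[OF A(1) l, of b'] by linarith
  qed
  from this[of b b'] this[of b' b] show ?thesis by (simp add: norm_minus_commute abs_le_iff)
qed

lemma continuous_support_value: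
  assumes "finite A" "A \<noteq> {}"
  shows "continuous_on UNIV (support_value A)"
proof (rule lipschitz_on_continuous_on[OF lipschitz_onI])
  show "dist (support_value A b) (support_value A b') \<le> (\<Sum>l\<in>A. norm l) * dist b b'" for b b'
    using support_value_Lipschitz[OF assms, of b b'] by (simp add: dist_norm)
qed (simp add: sum_nonneg)

lemma support_value_convex:
  assumes A: "finite A" "A \<noteq> {}" and u: "0 \<le> u" "0 \<le> v" "u + v = 1"
  shows "support_value A (u *\<^sub>R b + v *\<^sub>R b') \<le> u * support_value A b + v * support_value A b'"
  unfolding support_value_le_iff[OF A]
proof
  fix l assume l: "l \<in> A"
  show "l \<bullet> (u *\<^sub>R b + v *\<^sub>R b') \<le> u * support_value A b + v * support_value A b'"
    unfolding inner_add_right inner_scaleR_right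
    using u l A by (intro add_mono mult_left_mono support_value_ge)
qed

text \<open>
The pairs of a right-hand side b and a bound s on the optimal value form a finitely generated convex
cone, with generators coming from the unit vectors and their negatives (for y), the negative unit vectors (slack in the
constraints) and an upward step in s. A finitely generated cone is a polyhedron. Its defining inequalities
that involve s give \<open>\<Lambda>\<close>, the vectors of dual solutions; the other ones give \<open>\<M>\<close>, the feasibility conditions.
An empty \<open>\<Lambda>\<close> means that every feasible program is unbounded. Attainment of the optimal value is included,
since s may be the maximum itself.
\<close>

lemma linear_program_value:
  fixes W :: "real^'r^'m" and q :: "real^'r"
  obtains \<Lambda> \<M> :: "(real^'m) set" where "finite \<Lambda>" "finite \<M>"
    "\<forall>b s. (\<exists>y. b \<le> W *v y \<and> q \<bullet> y \<le> s) \<longleftrightarrow> (\<forall>\<mu>\<in>\<M>. \<mu> \<bullet> b \<le> 0) \<and> (\<forall>l\<in>\<Lambda>. l \<bullet> b \<le> s)"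
proof -
  define E :: "((real^'m) \<times> real) set" where "E = {(b, s). \<exists>y. b \<le> W *v y \<and> q \<bullet> y \<le> s}"
  define G :: "((real^'m) \<times> real) set" where
    "G = insert (0, 1) ((\<lambda>e. (W *v e, q \<bullet> e)) ` (Basis \<union> uminus ` Basis) \<union> (\<lambda>e. (- e, 0)) ` Basis)"
  have finG: "finite G" by (simp add: G_def)
  have coneE: "convex_cone E"
    unfolding convex_cone_iff
  proof (intro conjI ballI allI impI)
    show "0 \<in> E" by (auto simp: E_def zero_prod_def intro!: exI[of _ 0])
    fix x y assume "x \<in> E" "y \<in> E"
    then obtain b s v b' s' v' where "x = (b, s)" "b \<le> W *v v" "q \<bullet> v \<le> s"
      "y = (b', s')" "b' \<le> W *v v'" "q \<bullet> v' \<le> s'" by (auto simp: E_def)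
    then show "x + y \<in> E"
      by (auto simp: E_def matrix_vector_right_distrib inner_add_right intro!: exI[of _ "v + v'"] add_mono)
  next
    fix x and c :: real assume "x \<in> E" and c: "0 \<le> c"
    then obtain b s v where x: "x = (b, s)" "b \<le> W *v v" "q \<bullet> v \<le> s" by (auto simp: E_def)
    have "c *\<^sub>R b \<le> W *v (c *\<^sub>R v)"
      using x c by (simp add: matrix_vector_mult_scaleR scaleR_left_mono)
    moreover have "q \<bullet> (c *\<^sub>R v) \<le> c * s" using x c by (simp add: mult_left_mono)
    ultimately show "c *\<^sub>R x \<in> E" unfolding x(1) E_def by auto
  qed
  have GE: "G \<subseteq> E"
  proof -
    have "(0, 1) \<in> E" by (auto simp: E_def intro!: exI[of _ 0])
    moreover have "(W *v e, q \<bullet> e) \<in> E" for e by (auto simp: E_def)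
    moreover have "(- e, 0) \<in> E" if "e \<in> Basis" for e
      using that by (auto simp: E_def eucl_le[of "- e"] inner_Basis intro!: exI[of _ 0])
    ultimately show ?thesis by (auto simp: G_def)
  qed
  have EG: "E \<subseteq> convex_cone hull G"
  proof safe
    let ?H = "convex_cone hull G"
    have cc: "convex_cone ?H" by (rule convex_cone_convex_cone_hull)
    have sumH: "(\<Sum>i\<in>I. f i) \<in> ?H" if "\<And>i. i \<in> I \<Longrightarrow> f i \<in> ?H" for I :: "(real^'x::finite) set" and f
      using that by (induction I rule: infinite_finite_induct)
        (auto simp: convex_cone_hull_contains_0 intro: convex_cone_hull_add)
    fix b s assume "(b, s) \<in> E"
    then obtain y where y: "b \<le> W *v y" "q \<bullet> y \<le> s" by (auto simp: E_def)
    have 1: "(W *v y, q \<bullet> y) \<in> ?H"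
    proof -
      have inG: "(W *v x, q \<bullet> x) \<in> G" if "x \<in> Basis \<union> uminus ` Basis" for x
        using that unfolding G_def by blast
      have "(\<bar>y \<bullet> e\<bar>) *\<^sub>R (W *v (sgn (y \<bullet> e) *\<^sub>R e), q \<bullet> (sgn (y \<bullet> e) *\<^sub>R e)) \<in> ?H" if "e \<in> Basis" for e
      proof (cases "y \<bullet> e = 0")
        case False
        then have "sgn (y \<bullet> e) *\<^sub>R e \<in> Basis \<union> uminus ` Basis" using that by (auto simp: sgn_if)
        then show ?thesis by (intro convex_cone_hull_mul hull_inc inG) simp_all
      qed (use convex_cone_hull_contains_0[of G] in \<open>simp add: zero_prod_def\<close>)
      then have "(\<Sum>e\<in>Basis. (\<bar>y \<bullet> e\<bar>) *\<^sub>R (W *v (sgn (y \<bullet> e) *\<^sub>R e), q \<bullet> (sgn (y \<bullet> e) *\<^sub>R e))) \<in> ?H"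
        by (rule sumH)
      also have "(\<Sum>e\<in>Basis. (\<bar>y \<bullet> e\<bar>) *\<^sub>R (W *v (sgn (y \<bullet> e) *\<^sub>R e), q \<bullet> (sgn (y \<bullet> e) *\<^sub>R e)))
         = (\<Sum>e\<in>Basis. (W *v ((y \<bullet> e) *\<^sub>R e), q \<bullet> ((y \<bullet> e) *\<^sub>R e)))"
        by (intro sum.cong refl) (simp add: matrix_vector_mult_scaleR abs_mult_sgn mult.assoc[symmetric])
      also have "\<dots> = (W *v (\<Sum>e\<in>Basis. (y \<bullet> e) *\<^sub>R e), q \<bullet> (\<Sum>e\<in>Basis. (y \<bullet> e) *\<^sub>R e))"
        by (simp add: prod_eq_iff fst_sum snd_sum inner_sum_right linear_sum[OF matrix_vector_mul_linear] o_def)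
      finally show ?thesis by (simp add: euclidean_representation)
    qed
    have 2: "(- (W *v y - b), 0) \<in> ?H"
    proof -
      have "((W *v y - b) \<bullet> e) *\<^sub>R (- e, 0::real) \<in> ?H" if "e \<in> Basis" for e
        using that y(1) by (intro convex_cone_hull_mul hull_inc) (auto simp: G_def eucl_le[of b] inner_diff_left)
      then have "(\<Sum>e\<in>Basis. ((W *v y - b) \<bullet> e) *\<^sub>R (- e, 0::real)) \<in> ?H" by (rule sumH)
      also have "(\<Sum>e\<in>Basis. ((W *v y - b) \<bullet> e) *\<^sub>R (- e, 0::real)) = (- (\<Sum>e\<in>Basis. ((W *v y - b) \<bullet> e) *\<^sub>R e), 0)"
        by (simp add: prod_eq_iff fst_sum snd_sum sum_negf)
      finally show ?thesis by (simp only: euclidean_representation)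
    qed
    have 3: "(s - q \<bullet> y) *\<^sub>R (0, 1) \<in> ?H"
      using y(2) by (intro convex_cone_hull_mul hull_inc) (auto simp: G_def)
    have "(b, s) = (W *v y, q \<bullet> y) + (- (W *v y - b), 0) + (s - q \<bullet> y) *\<^sub>R (0, 1)" by simp
    then show "(b, s) \<in> ?H" using 1 2 3 by (metis convex_cone_hull_add)
  qed
  have "E = convex_cone hull G"
    using EG hull_minimal[of G E convex_cone, OF GE coneE] by blast
  then have "polyhedron E" using polyhedron_convex_cone_hull[OF finG] by simp
  then obtain \<H> where fin: "finite \<H>" and E: "E = \<Inter>\<H>"
    and half: "\<forall>h\<in>\<H>. \<exists>a b. a \<noteq> 0 \<and> h = {x. a \<bullet> x \<le> b}"
    unfolding polyhedron_def by blast
  then obtain a \<gamma> where h: "\<And>h. h \<in> \<H> \<Longrightarrow> h = {x. a h \<bullet> x \<le> \<gamma> h}" by metis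
  have bound: "a h \<bullet> x \<le> \<gamma> h" if "h \<in> \<H>" "x \<in> E" for h x
  proof -
    have "x \<in> h" using that E by blast
    then have "x \<in> {x. a h \<bullet> x \<le> \<gamma> h}" using h[OF that(1)] by (rule back_subst)
    then show ?thesis by simp
  qed
  have pos: "0 \<le> \<gamma> h" if "h \<in> \<H>" for h
    using bound[OF that convex_cone_contains_0[OF coneE]] by simp
  have neg: "a h \<bullet> x \<le> 0" if "h \<in> \<H>" "x \<in> E" for h x
  proof (rule ccontr)
    assume n: "\<not> a h \<bullet> x \<le> 0"
    define c where "c = (\<gamma> h + 1) / (a h \<bullet> x)"
    have "c *\<^sub>R x \<in> E"
      using n pos[OF that(1)] by (intro convex_cone_scaleR[OF coneE _ that(2)]) (simp add: c_def)
    then have "a h \<bullet> (c *\<^sub>R x) \<le> \<gamma> h" by (rule bound[OF that(1)])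
    then show False using n by (simp add: c_def)
  qed
  have memE: "x \<in> E \<longleftrightarrow> (\<forall>h\<in>\<H>. a h \<bullet> x \<le> 0)" for x
  proof
    show "x \<in> E \<Longrightarrow> \<forall>h\<in>\<H>. a h \<bullet> x \<le> 0" using neg by blast
    assume "\<forall>h\<in>\<H>. a h \<bullet> x \<le> 0"
    then have "x \<in> {x. a h \<bullet> x \<le> \<gamma> h}" if "h \<in> \<H>" for h using that pos order_trans by blast
    then have "x \<in> h" if "h \<in> \<H>" for h using that h[OF that] by blast
    then show "x \<in> E" unfolding E by blast
  qed
  define \<alpha> where "\<alpha> h = fst (a h)" for h
  define \<beta> where "\<beta> h = snd (a h)" for h
  have ab: "a h \<bullet> (b, s) = \<alpha> h \<bullet> b + \<beta> h * s" for h b s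
    by (simp add: \<alpha>_def \<beta>_def inner_prod_def)
  \<comment> \<open>s may be increased arbitrarily\<close>
  have \<beta>: "\<beta> h \<le> 0" if "h \<in> \<H>" for h
  proof -
    have "(0, 1) \<in> E" using GE by (auto simp: G_def)
    then have "a h \<bullet> (0, 1) \<le> 0" by (rule neg[OF that])
    then show ?thesis by (simp add: ab)
  qed
  define \<M> where "\<M> = \<alpha> ` {h \<in> \<H>. \<beta> h = 0}"
  define \<Lambda> where "\<Lambda> = (\<lambda>h. (1 / - \<beta> h) *\<^sub>R \<alpha> h) ` {h \<in> \<H>. \<beta> h < 0}"
  show ?thesis
  proof (rule that[of \<Lambda> \<M>])
    show "finite \<Lambda>" "finite \<M>" using fin by (auto simp: \<Lambda>_def \<M>_def)
    have main: "(\<exists>y. b \<le> W *v y \<and> q \<bullet> y \<le> s) \<longleftrightarrow> (\<forall>\<mu>\<in>\<M>. \<mu> \<bullet> b \<le> 0) \<and> (\<forall>l\<in>\<Lambda>. l \<bullet> b \<le> s)"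
      for b :: "real^'m" and s :: real
    proof -
      have *: "a h \<bullet> (b, s) \<le> 0 \<longleftrightarrow> (if \<beta> h = 0 then \<alpha> h \<bullet> b \<le> 0 else ((1 / - \<beta> h) *\<^sub>R \<alpha> h) \<bullet> b \<le> s)"
        if "h \<in> \<H>" for h
        using \<beta>[OF that] by (auto simp: ab field_simps)
      have "(\<exists>y. b \<le> W *v y \<and> q \<bullet> y \<le> s) \<longleftrightarrow> (b, s) \<in> E" by (simp add: E_def)
      also have "\<dots> \<longleftrightarrow> (\<forall>h\<in>\<H>. if \<beta> h = 0 then \<alpha> h \<bullet> b \<le> 0 else ((1 / - \<beta> h) *\<^sub>R \<alpha> h) \<bullet> b \<le> s)"
        unfolding memE using * by blast
      also have "\<dots> \<longleftrightarrow> (\<forall>\<mu>\<in>\<M>. \<mu> \<bullet> b \<le> 0) \<and> (\<forall>l\<in>\<Lambda>. l \<bullet> b \<le> s)"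
        using \<beta> by (fastforce simp: \<M>_def \<Lambda>_def)
      finally show ?thesis .
    qed
    then show "\<forall>b s. (\<exists>y. b \<le> W *v y \<and> q \<bullet> y \<le> s) \<longleftrightarrow> (\<forall>\<mu>\<in>\<M>. \<mu> \<bullet> b \<le> 0) \<and> (\<forall>l\<in>\<Lambda>. l \<bullet> b \<le> s)"
      by blast
  qed
qed

section \<open>The strong law of large numbers\<close>

context sequence_space
begin

text \<open>
The largest of 0 and the first n partial sums of \<open>g (\<omega> 0) + g (\<omega> 1) + \<dots>\<close>, written as a recursion over the first
sample because it is compared with the same quantity for the shifted sequence.
\<close>

primrec excess :: "('a \<Rightarrow> real) \<Rightarrow> nat \<Rightarrow> (nat \<Rightarrow> 'a) \<Rightarrow> real" where
  "excess g 0 \<omega> = 0"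
| "excess g (Suc n) \<omega> = max 0 (g (\<omega> 0) + excess g n (\<lambda>i. \<omega> (Suc i)))"

lemma excess_nonneg: "0 \<le> excess g n \<omega>"
  by (cases n) auto

lemma excess_mono_Suc: "excess g n \<omega> \<le> excess g (Suc n) \<omega>"
proof (induction n arbitrary: \<omega>)
  case (Suc n)
  show ?case
    using Suc[of "\<lambda>i. \<omega> (Suc i)"] by (subst (1 2) excess.simps) (intro max.mono add_left_mono order_refl)
qed simp

lemma excess_mono: "m \<le> n \<Longrightarrow> excess g m \<omega> \<le> excess g n \<omega>"
  using excess_mono_Suc by (rule lift_Suc_mono_le)

lemma partial_sum_le_excess: "(\<Sum>i<n. g (\<omega> i)) \<le> excess g n \<omega>"
proof (induction n arbitrary: \<omega>)
  case (Suc n)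
  show ?case
    using Suc[of "\<lambda>i. \<omega> (Suc i)"] by (simp add: sum.lessThan_Suc_shift del: sum.lessThan_Suc)
qed simp

lemma excess_le_sum_abs: "excess g n \<omega> \<le> (\<Sum>i<n. \<bar>g (\<omega> i)\<bar>)"
proof (induction n arbitrary: \<omega>)
  case (Suc n)
  have "0 \<le> (\<Sum>i<n. \<bar>g (\<omega> (Suc i))\<bar>)" by (intro sum_nonneg) auto
  then show ?case
    using Suc[of "\<lambda>i. \<omega> (Suc i)"] by (auto simp: sum.lessThan_Suc_shift simp del: sum.lessThan_Suc)
qed simp

lemma measurable_excess [measurable]:
  assumes [measurable]: "g \<in> borel_measurable M"
  shows "excess g n \<in> borel_measurable S"
proof (induction n)
  case (Suc n)
  have [measurable]: "(\<lambda>\<omega> i. \<omega> (Suc i)) \<in> measurable S S"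
    by (rule measurable_PiM_single') (auto simp: space_PiM PiE_iff)
  note Suc[measurable]
  show ?case by simp
qed simp

lemma integrable_component:
  assumes "integrable M (g :: 'a \<Rightarrow> real)"
  shows "integrable S (\<lambda>\<omega>. g (\<omega> i))"
proof -
  have "(\<lambda>\<omega>. \<omega> i) \<in> measurable S M" by measurable
  moreover have "integrable (distr S M (\<lambda>\<omega>. \<omega> i)) g"
    using assms PiM_component[of i] by simp
  ultimately show ?thesis by (rule integrable_distr)
qed

lemma integrable_excess:
  assumes g: "integrable M g"
  shows "integrable S (excess g n)"
proof (rule Bochner_Integration.integrable_bound)
  have [measurable]: "g \<in> borel_measurable M" using g by auto
  show "integrable S (\<lambda>\<omega>. \<Sum>i<n. \<bar>g (\<omega> i)\<bar>)"
    by (intro Bochner_Integration.integrable_sum integrable_abs integrable_component g)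
  show "excess g n \<in> borel_measurable S" by measurable
  show "AE \<omega> in S. norm (excess g n \<omega>) \<le> norm (\<Sum>i<n. \<bar>g (\<omega> i)\<bar>)"
    using excess_nonneg[of g n] excess_le_sum_abs[of g n]
    by (intro AE_I2) (auto simp: intro: order_trans[OF _ abs_ge_self])
qed

text \<open>
Splitting off the first coordinate of an i.i.d. sequence: the rest has the same distribution as the whole
sequence and is independent of the first coordinate.
\<close>

lemma integral_sequence_iter:
  fixes f :: "(nat \<Rightarrow> 'a) \<Rightarrow> real"
  assumes f: "integrable S f"
  shows "(\<integral>\<omega>. f \<omega> \<partial>S) = (\<integral>\<omega>. (\<integral>s. f (case_nat s \<omega>) \<partial>M) \<partial>S)"
    and "integrable S (\<lambda>\<omega>. \<integral>s. f (case_nat s \<omega>) \<partial>M)"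
proof -
  interpret Q: pair_sigma_finite M S ..
  have m[measurable]: "(\<lambda>(s, \<omega>). case_nat s \<omega>) \<in> measurable (M \<Otimes>\<^sub>M S) S"
    by measurable
  have i: "integrable (M \<Otimes>\<^sub>M S) (\<lambda>x. f (case x of (s, \<omega>) \<Rightarrow> case_nat s \<omega>))"
    using f by (subst (asm) PiM_iter[symmetric]) (auto intro: integrable_distr[OF m])
  then have i': "integrable (M \<Otimes>\<^sub>M S) (case_prod (\<lambda>s \<omega>. f (case_nat s \<omega>)))"
    by (simp add: case_prod_beta')
  have "(\<integral>\<omega>. f \<omega> \<partial>S) = (\<integral>x. f (case x of (s, \<omega>) \<Rightarrow> case_nat s \<omega>) \<partial>(M \<Otimes>\<^sub>M S))"
    using f by (subst PiM_iter[symmetric], subst integral_distr[OF m]) auto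
  also have "\<dots> = (\<integral>\<omega>. (\<integral>s. f (case_nat s \<omega>) \<partial>M) \<partial>S)"
    using Q.integral_snd[OF i'] by (simp add: case_prod_beta')
  finally show "(\<integral>\<omega>. f \<omega> \<partial>S) = (\<integral>\<omega>. (\<integral>s. f (case_nat s \<omega>) \<partial>M) \<partial>S)" .
  show "integrable S (\<lambda>\<omega>. \<integral>s. f (case_nat s \<omega>) \<partial>M)"
    using Q.integrable_snd[OF i'] by simp
qed

text \<open>
Prepending one term changes the supremum of the partial sums by a finite amount.
\<close>

lemma unbounded_excess_shift:
  "(\<forall>K::nat. \<exists>n. real K < excess g n (case_nat s \<omega>)) \<longleftrightarrow> (\<forall>K::nat. \<exists>n. real K < excess g n \<omega>)"
proof -
  have 1: "excess g (Suc n) (case_nat s \<omega>) = max 0 (g s + excess g n \<omega>)" for n by simp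
  show ?thesis
  proof safe
    fix K :: nat
    assume a: "\<forall>K::nat. \<exists>n. real K < excess g n (case_nat s \<omega>)"
    obtain L :: nat where L: "real K + \<bar>g s\<bar> \<le> real L" using real_arch_simple by blast
    obtain n where n: "real L < excess g n (case_nat s \<omega>)" using a by blast
    have "real L < excess g (Suc n) (case_nat s \<omega>)"
      using n excess_mono_Suc[of g n "case_nat s \<omega>"] by linarith
    then have "real K < excess g n \<omega>" using L unfolding 1 by (auto simp: max_def split: if_splits)
    then show "\<exists>n. real K < excess g n \<omega>" ..
  next
    fix K :: nat
    assume a: "\<forall>K::nat. \<exists>n. real K < excess g n \<omega>"
    obtain L :: nat where L: "real K + \<bar>g s\<bar> \<le> real L" using real_arch_simple by blast
    obtain n where n: "real L < excess g n \<omega>" using a by blast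
    then have "real K < excess g (Suc n) (case_nat s \<omega>)" using L unfolding 1 by auto
    then show "\<exists>n. real K < excess g n (case_nat s \<omega>)" ..
  qed
qed

text \<open>
Let A be the event that the partial sums are unbounded above. It is invariant under the shift, hence
independent of the first term. On A, the increase of the n-th excess when one more term is prepended is
\<open>max (- excess g n \<omega>) (g s)\<close>, which tends to the prepended value g s. The mean increase over A is
nonnegative because the excess grows with n and the shifted sequence has the same law. In the limit,
the probability of A times the mean of g is nonnegative, so A is a null set if the mean is negative.
This is the maximal inequality argument for the ergodic theorem, in the independent case.
\<close>

lemma AE_bounded_partial_sums:
  assumes g: "integrable M (g :: 'a \<Rightarrow> real)" and neg: "(\<integral>s. g s \<partial>M) < 0"
  shows "AE \<omega> in S. \<exists>K::nat. \<forall>n. (\<Sum>i<n. g (\<omega> i)) \<le> real K"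
proof -
  have gm[measurable]: "g \<in> borel_measurable M" using g by auto
  define A where "A = {\<omega> \<in> space S. \<forall>K::nat. \<exists>n. real K < excess g n \<omega>}"
  have A[measurable]: "A \<in> sets S" unfolding A_def by measurable
  \<comment> \<open>mean increase of the excess when one more term is prepended to \<open>\<omega>\<close>\<close>
  define k where "k n \<omega> = (\<integral>s. max (- excess g n \<omega>) (g s) \<partial>M)" for n \<omega>
  have int_max: "integrable M (\<lambda>s. max c (g s))" for c
    by (intro integrable_max g) simp
  have iE: "integrable S (\<lambda>\<omega>. indicator A \<omega> * excess g n \<omega>)" for n
    using integrable_real_mult_indicator[OF A integrable_excess[OF g, of n]] by (simp add: mult.commute)
  have split: "(\<integral>s. indicator A (case_nat s \<omega>) * excess g (Suc n) (case_nat s \<omega>) \<partial>M)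
      = indicator A \<omega> * excess g n \<omega> + indicator A \<omega> * k n \<omega>" if "\<omega> \<in> space S" for n \<omega>
  proof -
    have "(\<integral>s. indicator A (case_nat s \<omega>) * excess g (Suc n) (case_nat s \<omega>) \<partial>M)
       = (\<integral>s. indicator A \<omega> * (excess g n \<omega> + max (- excess g n \<omega>) (g s)) \<partial>M)"
    proof (rule Bochner_Integration.integral_cong[OF refl])
      fix s assume s: "s \<in> space M"
      have "case_nat s \<omega> \<in> space S"
        using that s by (auto simp: space_PiM PiE_iff split: nat.split)
      then have "case_nat s \<omega> \<in> A \<longleftrightarrow> \<omega> \<in> A"
        using that unbounded_excess_shift[of g s \<omega>] by (auto simp: A_def)
      then show "indicator A (case_nat s \<omega>) * excess g (Suc n) (case_nat s \<omega>)
          = indicator A \<omega> * (excess g n \<omega> + max (- excess g n \<omega>) (g s))"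
        by (auto simp: indicator_def)
    qed
    also have "\<dots> = indicator A \<omega> * (excess g n \<omega> + k n \<omega>)"
      using int_max by (simp add: k_def M.prob_space)
    finally show ?thesis by (simp add: algebra_simps)
  qed
  have nonneg: "0 \<le> (\<integral>\<omega>. indicator A \<omega> * k n \<omega> \<partial>S)" for n
  proof -
    let ?f = "\<lambda>n \<omega>. indicator A \<omega> * excess g n \<omega>"
    have "(\<integral>\<omega>. ?f n \<omega> \<partial>S) \<le> (\<integral>\<omega>. ?f (Suc n) \<omega> \<partial>S)"
      by (intro integral_mono iE mult_left_mono excess_mono_Suc) auto
    moreover have "(\<integral>\<omega>. ?f (Suc n) \<omega> - ?f n \<omega> \<partial>S) = (\<integral>\<omega>. indicator A \<omega> * k n \<omega> \<partial>S)"
    proof -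
      have "(\<integral>\<omega>. ?f (Suc n) \<omega> - ?f n \<omega> \<partial>S)
          = (\<integral>\<omega>. (\<integral>s. ?f (Suc n) (case_nat s \<omega>) \<partial>M) \<partial>S) - (\<integral>\<omega>. ?f n \<omega> \<partial>S)"
        using iE[of "Suc n"] iE[of n] integral_sequence_iter(1)[OF iE[of "Suc n"]] by simp
      also have "\<dots> = (\<integral>\<omega>. (\<integral>s. ?f (Suc n) (case_nat s \<omega>) \<partial>M) - ?f n \<omega> \<partial>S)"
        using integral_sequence_iter(2)[OF iE[of "Suc n"]] iE[of n] by simp
      also have "\<dots> = (\<integral>\<omega>. indicator A \<omega> * k n \<omega> \<partial>S)"
        proof (rule Bochner_Integration.integral_cong[OF refl])
          fix \<omega> assume "\<omega> \<in> space S"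
          from split[OF this, of n] show "(\<integral>s. ?f (Suc n) (case_nat s \<omega>) \<partial>M) - ?f n \<omega> = indicator A \<omega> * k n \<omega>"
            by linarith
        qed
      finally show ?thesis .
    qed
    moreover have "(\<integral>\<omega>. ?f (Suc n) \<omega> - ?f n \<omega> \<partial>S) = (\<integral>\<omega>. ?f (Suc n) \<omega> \<partial>S) - (\<integral>\<omega>. ?f n \<omega> \<partial>S)"
      using iE by (intro Bochner_Integration.integral_diff)
    ultimately show ?thesis by linarith
  qed
  have kb: "\<bar>k n \<omega>\<bar> \<le> (\<integral>s. \<bar>g s\<bar> \<partial>M)" for n \<omega>
  proof -
    have "\<bar>k n \<omega>\<bar> \<le> (\<integral>s. \<bar>max (- excess g n \<omega>) (g s)\<bar> \<partial>M)"
      unfolding k_def by (rule integral_abs_bound)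
    also have "\<dots> \<le> (\<integral>s. \<bar>g s\<bar> \<partial>M)"
      using excess_nonneg[of g n \<omega>]
      by (intro integral_mono integrable_abs int_max g) (auto simp: max_def)
    finally show ?thesis .
  qed
  have km[measurable]: "k n \<in> borel_measurable S" for n
    unfolding k_def by measurable
  have lim: "(\<lambda>n. k n \<omega>) \<longlonglongrightarrow> (\<integral>s. g s \<partial>M)" if inA: "\<omega> \<in> A" for \<omega>
    unfolding k_def
  proof (rule integral_dominated_convergence[where w = "\<lambda>s. \<bar>g s\<bar>"])
    show "AE s in M. (\<lambda>n. max (- excess g n \<omega>) (g s)) \<longlonglongrightarrow> g s"
    proof (rule AE_I2, rule tendsto_eventually)
      fix s
      obtain K :: nat where K: "- g s \<le> real K" using real_arch_simple by blast
      obtain n where n: "real K < excess g n \<omega>" using inA unfolding A_def by blast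
      show "\<forall>\<^sub>F n in sequentially. max (- excess g n \<omega>) (g s) = g s"
        using eventually_ge_at_top[of n]
      proof eventually_elim
        case (elim m)
        then show ?case using excess_mono[OF elim, of g \<omega>] n K by auto
      qed
    qed
    show "AE s in M. norm (max (- excess g n \<omega>) (g s)) \<le> \<bar>g s\<bar>" for n
      using excess_nonneg[of g n \<omega>] by (auto simp: max_def)
  qed (use g in auto)
  have "(\<lambda>n. \<integral>\<omega>. indicator A \<omega> * k n \<omega> \<partial>S) \<longlonglongrightarrow> (\<integral>\<omega>. indicator A \<omega> * (\<integral>s. g s \<partial>M) \<partial>S)"
  proof (rule integral_dominated_convergence[where w = "\<lambda>_. \<integral>s. \<bar>g s\<bar> \<partial>M"])
    show "AE \<omega> in S. (\<lambda>n. indicator A \<omega> * k n \<omega>) \<longlonglongrightarrow> indicator A \<omega> * (\<integral>s. g s \<partial>M)"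
      using lim by (intro AE_I2) (auto simp: indicator_def)
    show "AE \<omega> in S. norm (indicator A \<omega> * k n \<omega>) \<le> (\<integral>s. \<bar>g s\<bar> \<partial>M)" for n
      using kb by (intro AE_I2) (auto simp: indicator_def)
  qed auto
  then have "0 \<le> (\<integral>\<omega>. indicator A \<omega> * (\<integral>s. g s \<partial>M) \<partial>S)"
    using nonneg by (intro LIMSEQ_le_const) auto
  also have "\<dots> = P.prob A * (\<integral>s. g s \<partial>M)"
    using A sets.sets_into_space[OF A] by (simp add: Int_absorb2)
  finally have "P.prob A = 0" using neg by (simp add: zero_le_mult_iff measure_le_0_iff)
  then have "AE \<omega> in S. \<omega> \<notin> A"
    using A by (subst AE_iff_measurable[of A])
       (use sets.sets_into_space[OF A] in \<open>auto simp: P.emeasure_eq_measure\<close>)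
  then show ?thesis
    using AE_space
  proof eventually_elim
    case (elim \<omega>)
    then obtain K :: nat where "\<And>n. excess g n \<omega> \<le> real K"
      by (auto simp: A_def not_less)
    then show ?case
      using partial_sum_le_excess order_trans by blast
  qed
qed

text \<open>
Apply the boundedness of partial sums to g and to -g, with the mean subtracted and a further small
positive constant 1/(d+1), so that the terms have negative mean.
\<close>

theorem strong_law_of_large_numbers:
  assumes g: "integrable M (g :: 'a \<Rightarrow> real)"
  shows "AE \<omega> in S. (\<lambda>n. (\<Sum>i<n. g (\<omega> i)) / real n) \<longlonglongrightarrow> (\<integral>s. g s \<partial>M)"
proof -
  have upper: "AE \<omega> in S. \<forall>d::nat. \<exists>K::nat. \<forall>n. (\<Sum>i<n. h (\<omega> i) - (\<integral>s. h s \<partial>M) - 1 / Suc d) \<le> real K"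
    if h: "integrable M (h :: 'a \<Rightarrow> real)" for h
  proof (subst AE_all_countable, rule allI)
    fix d :: nat
    show "AE \<omega> in S. \<exists>K::nat. \<forall>n. (\<Sum>i<n. h (\<omega> i) - (\<integral>s. h s \<partial>M) - 1 / Suc d) \<le> real K"
      using h by (intro AE_bounded_partial_sums) (auto simp: M.prob_space)
  qed
  have eventually_le: "\<forall>\<^sub>F n in sequentially. (\<Sum>i<n. h (\<omega> i)) / real n \<le> m + e"
    if b: "\<forall>d::nat. \<exists>K::nat. \<forall>n. (\<Sum>i<n. h (\<omega> i) - m - 1 / Suc d) \<le> real K" and e: "e > 0"
    for h :: "'a \<Rightarrow> real" and \<omega> m e
  proof -
    obtain d where d: "1 / Suc d < e / 2" using nat_approx_posE[of "e/2"] e by auto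
    obtain K :: nat where K: "\<And>n. (\<Sum>i<n. h (\<omega> i) - m - 1 / Suc d) \<le> real K" using b by blast
    obtain n0 :: nat where n0: "2 * real K / e < real n0" using reals_Archimedean2 by blast
    show ?thesis using eventually_gt_at_top[of "max 1 n0"]
    proof eventually_elim
      case (elim n)
      have "real K < real n0 * (e/2)" using n0 e by (simp add: field_simps)
      also have "\<dots> \<le> real n * (e/2)" using elim e by (intro mult_right_mono) auto
      finally have n: "real n > 0" "real K < real n * (e/2)" using elim by auto
      have "(\<Sum>i<n. h (\<omega> i)) \<le> real K + real n * m + real n * (1 / Suc d)"
        using K[of n] by (simp add: sum_subtractf)
      also have "\<dots> \<le> real n * (e/2) + real n * m + real n * (e/2)"
        using n d by (intro add_mono mult_left_mono) auto
      finally show ?case using n by (simp add: field_simps)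
    qed
  qed
  have "AE \<omega> in S. \<forall>d::nat. \<exists>K::nat. \<forall>n. (\<Sum>i<n. - g (\<omega> i) - (- (\<integral>s. g s \<partial>M)) - 1 / Suc d) \<le> real K"
    using upper[of "\<lambda>s. - g s"] g by simp
  with upper[OF g] show ?thesis
  proof eventually_elim
    case (elim \<omega>)
    show ?case
    proof (rule LIMSEQ_I)
      fix e :: real assume e: "e > 0"
      have "\<forall>\<^sub>F n in sequentially. (\<Sum>i<n. g (\<omega> i)) / real n \<le> (\<integral>s. g s \<partial>M) + e/2"
        using e by (intro eventually_le[OF elim(1)]) simp
      moreover have "\<forall>\<^sub>F n in sequentially. (\<Sum>i<n. - g (\<omega> i)) / real n \<le> - (\<integral>s. g s \<partial>M) + e/2"
        using e by (intro eventually_le[OF elim(2)]) simp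
      ultimately have "\<forall>\<^sub>F n in sequentially. norm ((\<Sum>i<n. g (\<omega> i)) / real n - (\<integral>s. g s \<partial>M)) < e"
      proof eventually_elim
        case (elim n)
        then show ?case using e by (auto simp: sum_negf)
      qed
      then show "\<exists>no. \<forall>n\<ge>no. norm ((\<Sum>i<n. g (\<omega> i)) / real n - (\<integral>s. g s \<partial>M)) < e"
        by (simp add: eventually_sequentially)
    qed
  qed
qed

end

lemma (in prob_space) indep_vars_shift:
  assumes "indep_vars (\<lambda>_. N) X {1::nat..}"
  shows "indep_vars (\<lambda>_. N) (\<lambda>i. X (Suc i)) UNIV"
proof -
  let ?F = "\<lambda>i. {X i -` A \<inter> space M |A. A \<in> sets N}"
  have ind: "indep_sets ?F {1..}" using assms by (simp add: indep_vars_def2)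
  have "indep_sets (\<lambda>i. ?F (Suc i)) UNIV"
  proof (rule indep_setsI)
    show "?F (Suc i) \<subseteq> events" for i using ind by (simp add: indep_sets_def)
    fix A J assume J: "J \<noteq> {}" "finite J" and A: "\<forall>j\<in>J. A j \<in> ?F (Suc j)"
    have "prob (\<Inter>j\<in>Suc ` J. A (j - 1)) = (\<Prod>j\<in>Suc ` J. prob (A (j - 1)))"
      using J A by (intro indep_setsD[OF ind]) auto
    then show "prob (\<Inter>j\<in>J. A j) = (\<Prod>j\<in>J. prob (A j))"
      by (simp add: prod.reindex image_image)
  qed
  then show ?thesis using assms by (simp add: indep_vars_def2)
qed

text \<open>
Independence with common law P says that the sequence is distributed as the product of copies of P, to which the
law on the sequence space applies. The samples are numbered from 1.
\<close>

lemma (in prob_space) strong_law_iid: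
  fixes g :: "'b \<Rightarrow> real"
  assumes indep: "indep_vars (\<lambda>_. N) \<xi> {1::nat..}"
    and distr: "\<And>i. i \<ge> 1 \<Longrightarrow> distr M N (\<xi> i) = P"
    and g: "integrable P g"
  shows "AE \<omega> in M. (\<lambda>n. (\<Sum>i=1..n. g (\<xi> i \<omega>)) / real n) \<longlonglongrightarrow> (\<integral>z. g z \<partial>P)"
proof -
  have rv: "random_variable N (\<xi> (Suc i))" for i
    using indep by (auto simp: indep_vars_def)
  have P_prob: "prob_space P" using prob_space_distr[OF rv[of 0]] distr[of 1] by simp
  have setsP: "sets P = sets N" using distr[of 1] sets_distr[of M N "\<xi> 1"] by simp
  interpret PP: prob_space P by (rule P_prob)
  interpret seq: sequence_space P
    by unfold_locales
  define Y where "Y \<omega> = (\<lambda>i. \<xi> (Suc i) \<omega>)" for \<omega>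
  have "indep_vars (\<lambda>_. N) (\<lambda>i \<omega>. \<xi> (Suc i) \<omega>) UNIV"
    using indep by (rule indep_vars_shift)
  then have "distr M (\<Pi>\<^sub>M i\<in>UNIV. N) Y = (\<Pi>\<^sub>M i\<in>UNIV. P)"
    by (subst (asm) indep_vars_iff_distr_eq_PiM) (simp_all add: rv distr Y_def[abs_def] restrict_UNIV)
  then have "AE \<omega> in distr M (\<Pi>\<^sub>M i\<in>UNIV. N) Y. (\<lambda>n. (\<Sum>i<n. g (\<omega> i)) / real n) \<longlonglongrightarrow> (\<integral>z. g z \<partial>P)"
    using seq.strong_law_of_large_numbers[OF g] by (simp only:)
  moreover have "Y \<in> measurable M (\<Pi>\<^sub>M i\<in>UNIV. N)"
    unfolding Y_def using rv by (intro measurable_PiM_single') (auto intro: measurable_space[OF rv])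
  ultimately have "AE \<omega> in M. (\<lambda>n. (\<Sum>i<n. g (Y \<omega> i)) / real n) \<longlonglongrightarrow> (\<integral>z. g z \<partial>P)"
    by (rule AE_distrD[rotated])
  then show ?thesis by (simp add: Y_def sum.atLeast1_atMost_eq)
qed

text \<open>
The exceptional null set may depend on x. A countable dense set of x has a common null set, and a common
Lipschitz constant carries the convergence to all other x.
\<close>

lemma AE_pointwise_convergence_Lipschitz:
  fixes F :: "nat \<Rightarrow> 'x::euclidean_space \<Rightarrow> 'a \<Rightarrow> real" and G :: "'x \<Rightarrow> real"
  assumes pt: "\<And>x. AE \<omega> in M. (\<lambda>n. F n x \<omega>) \<longlonglongrightarrow> G x"
    and F: "\<And>n x y \<omega>. \<bar>F n x \<omega> - F n y \<omega>\<bar> \<le> L * dist x y"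
    and G: "\<And>x y. \<bar>G x - G y\<bar> \<le> L * dist x y"
  shows "AE \<omega> in M. \<forall>x. (\<lambda>n. F n x \<omega>) \<longlonglongrightarrow> G x"
proof -
  obtain D :: "'x set" where D: "countable D" "\<And>X. open X \<Longrightarrow> X \<noteq> {} \<Longrightarrow> \<exists>d\<in>D. d \<in> X"
    using countable_dense_exists by blast
  have "AE \<omega> in M. \<forall>x\<in>D. (\<lambda>n. F n x \<omega>) \<longlonglongrightarrow> G x"
    using D(1) pt by (subst AE_ball_countable) auto
  then show ?thesis
  proof eventually_elim
    case (elim \<omega>)
    show ?case
    proof (intro allI LIMSEQ_I)
      fix x and e :: real assume e: "0 < e"
      define r where "r = e / (3 * (\<bar>L\<bar> + 1))"
      have "r > 0" using e by (simp add: r_def add_nonneg_pos)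
      then obtain d where d: "d \<in> D" "d \<in> ball x r" using D(2)[of "ball x r"] by auto
      have "L * dist x d \<le> (\<bar>L\<bar> + 1) * r"
        using d by (intro mult_mono) auto
      also have "\<dots> = e / 3" by (simp add: r_def field_simps)
      finally have Ld: "L * dist x d \<le> e / 3" .
      obtain n0 where n0: "\<And>n. n \<ge> n0 \<Longrightarrow> norm (F n d \<omega> - G d) < e / 3"
        using LIMSEQ_D[OF elim[rule_format, OF d(1)], of "e/3"] e by auto
      show "\<exists>n0. \<forall>n\<ge>n0. norm (F n x \<omega> - G x) < e"
      proof (intro exI[of _ n0] allI impI)
        fix n assume "n0 \<le> n"
        then show "norm (F n x \<omega> - G x) < e"
          using n0[of n] F[of n x \<omega> d] G[of x d] Ld unfolding real_norm_def by linarith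
      qed
    qed
  qed
qed

lemma Lipschitz_continuous_convergence:
  fixes F :: "nat \<Rightarrow> 'x::metric_space \<Rightarrow> real"
  assumes F: "\<And>n x y. \<bar>F n x - F n y\<bar> \<le> L * dist x y" and lim: "(\<lambda>n. F n x) \<longlonglongrightarrow> G"
    and r: "strict_mono r" and y: "y \<longlonglongrightarrow> x"
  shows "(\<lambda>k. F (r k) (y k)) \<longlonglongrightarrow> G"
proof -
  have "(\<lambda>k. F (r k) (y k) - F (r k) x) \<longlonglongrightarrow> 0"
  proof (rule Lim_null_comparison)
    show "\<forall>\<^sub>F k in sequentially. norm (F (r k) (y k) - F (r k) x) \<le> L * dist (y k) x"
      using F by simp
    show "(\<lambda>k. L * dist (y k) x) \<longlonglongrightarrow> 0"
      using tendsto_mult_right_zero[OF tendsto_dist[OF y tendsto_const[of x], simplified]] by simp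
  qed
  moreover have "(\<lambda>k. F (r k) x) \<longlonglongrightarrow> G"
    using LIMSEQ_subseq_LIMSEQ[OF lim r] by (simp add: o_def)
  ultimately show ?thesis using tendsto_add by fastforce
qed

section \<open>Convergence of convex approximations\<close>

text \<open>
Suppose that along a subsequence some points x k violate the bound. They are pulled along the segment
to xs into the ball of radius R around xs, which contains all minimizers in its interior. By convexity the
new points z k stay feasible with values not much above v, so they accumulate at a minimizer l. As l is an
interior point of the ball, the pulling was eventually void, and the values of z k lie below v - \<open>\<delta>\<close>; this
contradicts the minimality of v.
\<close>

lemma eventually_lower_bound_convex:
  fixes f :: "'a::euclidean_space \<Rightarrow> real" and fN :: "nat \<Rightarrow> 'a \<Rightarrow> real"
  assumes conv: "\<And>N. convex_on UNIV (fN N)"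
    and lim: "\<And>r y l. strict_mono r \<Longrightarrow> y \<longlonglongrightarrow> l \<Longrightarrow> (\<lambda>k. fN (r k) (y k)) \<longlonglongrightarrow> f l"
    and XN: "\<And>N. convex (XN N)" "\<And>N. xs \<in> XN N"
    and Xlim: "\<And>r y l. strict_mono r \<Longrightarrow> (\<And>k. y k \<in> XN (r k)) \<Longrightarrow> y \<longlonglongrightarrow> l \<Longrightarrow> l \<in> X"
    and opt: "\<And>x. x \<in> X \<Longrightarrow> v \<le> f x" "f xs \<le> v" and bdd: "bounded {x \<in> X. f x \<le> v}"
    and \<delta>: "\<delta> > 0"
  shows "\<forall>\<^sub>F N in sequentially. \<forall>x\<in>XN N. v - \<delta> \<le> fN N x"
proof (rule ccontr)
  assume "\<not> ?thesis"
  from not_eventually_sequentiallyD[OF this]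
  obtain r0 :: "nat \<Rightarrow> nat" where r0: "strict_mono r0" "\<forall>k. \<not> (\<forall>x\<in>XN (r0 k). v - \<delta> \<le> fN (r0 k) x)"
    by blast
  then obtain x where x: "\<And>k. x k \<in> XN (r0 k)" "\<And>k. fN (r0 k) (x k) < v - \<delta>"
    by (metis not_le)
  obtain R where R: "R > 0" "{x \<in> X. f x \<le> v} \<subseteq> ball xs R"
    using bounded_subset_ballD[OF bdd] by blast
  define t where "t k = (if dist xs (x k) \<le> R then 1 else R / dist xs (x k))" for k
  define z where "z k = (1 - t k) *\<^sub>R xs + t k *\<^sub>R x k" for k
  have t: "0 \<le> t k" "t k \<le> 1" for k
    using R by (auto simp: t_def not_le intro!: divide_le_eq_1_pos[THEN iffD2])
  have dz: "dist xs (z k) = t k * dist xs (x k)" for k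
  proof -
    have "z k - xs = t k *\<^sub>R (x k - xs)" by (simp add: z_def algebra_simps)
    then have "norm (z k - xs) = t k * norm (x k - xs)" using t[of k] by simp
    then show ?thesis by (simp add: dist_norm norm_minus_commute)
  qed
  have zR: "z k \<in> cball xs R" for k
    using R by (auto simp: dz t_def)
  have zX: "z k \<in> XN (r0 k)" for k
    unfolding z_def using XN x t[of k] by (intro convexD) auto
  have zf: "fN (r0 k) (z k) \<le> max (fN (r0 k) xs) (v - \<delta>)" for k
  proof -
    have "fN (r0 k) (z k) \<le> (1 - t k) * fN (r0 k) xs + t k * fN (r0 k) (x k)"
      unfolding z_def using conv[of "r0 k"] t[of k] by (intro convex_onD) auto
    also have "\<dots> \<le> (1 - t k) * max (fN (r0 k) xs) (v - \<delta>) + t k * max (fN (r0 k) xs) (v - \<delta>)"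
      using t[of k] x(2)[of k] by (intro add_mono mult_left_mono) auto
    finally show ?thesis by (simp add: algebra_simps)
  qed
  obtain l and s :: "nat \<Rightarrow> nat" where l: "strict_mono s" "(z \<circ> s) \<longlonglongrightarrow> l"
    using compact_cball[of xs R] zR unfolding compact_def by blast
  have rs: "strict_mono (\<lambda>k. r0 (s k))"
    using strict_mono_o[OF r0(1) l(1)] by (simp add: o_def)
  have fl: "(\<lambda>k. fN (r0 (s k)) (z (s k))) \<longlonglongrightarrow> f l"
    using lim[OF rs l(2)] by (simp add: o_def)
  have fxs: "(\<lambda>k. fN (r0 (s k)) xs) \<longlonglongrightarrow> f xs"
    using lim[OF rs tendsto_const] .
  have "f l \<le> max (f xs) (v - \<delta>)"
    by (rule LIMSEQ_le[OF fl tendsto_max[OF fxs tendsto_const]]) (use zf in auto)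
  then have flv: "f l \<le> v" using opt(2) \<delta> by auto
  have lX: "l \<in> X" by (rule Xlim[OF rs _ l(2)]) (simp add: zX)
  have "l \<in> ball xs R" using R(2) flv lX by blast
  then have "\<forall>\<^sub>F k in sequentially. (z \<circ> s) k \<in> ball xs R"
    using topological_tendstoD[OF l(2) open_ball] by blast
  then have "\<forall>\<^sub>F k in sequentially. fN (r0 (s k)) (z (s k)) \<le> v - \<delta>"
  proof eventually_elim
    case (elim k)
    have "t (s k) = 1"
    proof (rule ccontr)
      assume n: "t (s k) \<noteq> 1"
      then have "t (s k) = R / dist xs (x (s k))" "dist xs (x (s k)) > R"
        by (auto simp: t_def split: if_splits)
      then have "dist xs (z (s k)) = R" using R by (auto simp: dz)
      then show False using elim by simp
    qed
    then have "z (s k) = x (s k)" by (simp add: z_def)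
    then show ?case using x(2)[of "s k"] by simp
  qed
  then have "f l \<le> v - \<delta>" using fl by (intro tendsto_upperbound) auto
  then show False using opt(1)[OF lX] \<delta> by simp
qed

text \<open>
The part of the argument that is common to the two approximations: \<open>vals\<close> and D stand for the values and optimal
decisions of either of them, bounded below in terms of the sample problem and above by near-optimality.
\<close>

lemma consistent_approximation:
  fixes f :: "'a::euclidean_space \<Rightarrow> real" and fN :: "nat \<Rightarrow> 'a \<Rightarrow> real" and vals :: "nat \<Rightarrow> ereal"
  assumes conv: "\<And>N. convex_on UNIV (fN N)"
    and lim: "\<And>r y l. strict_mono r \<Longrightarrow> y \<longlonglongrightarrow> l \<Longrightarrow> (\<lambda>k. fN (r k) (y k)) \<longlonglongrightarrow> f l"
    and XN: "\<And>N. convex (XN N)" "\<And>N. xs \<in> XN N"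
    and Xlim: "\<And>r y l. strict_mono r \<Longrightarrow> (\<And>k. y k \<in> XN (r k)) \<Longrightarrow> y \<longlonglongrightarrow> l \<Longrightarrow> l \<in> X"
    and opt: "\<And>x. x \<in> X \<Longrightarrow> v \<le> f x" "f xs \<le> v" and bdd: "bounded {x \<in> X. f x \<le> v}"
    and lower: "\<And>N l. N \<ge> 1 \<Longrightarrow> (\<And>x. x \<in> XN N \<Longrightarrow> l \<le> fN N x) \<Longrightarrow> ereal l \<le> vals N"
    and upper: "\<And>\<delta>. \<delta> > 0 \<Longrightarrow> \<forall>\<^sub>F N in sequentially. vals N \<le> ereal (v + \<delta>)"
    and dec: "\<And>N x. N \<ge> 1 \<Longrightarrow> x \<in> D N \<Longrightarrow> x \<in> XN N \<and> ereal (fN N x) \<le> vals N"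
  shows "vals \<longlonglongrightarrow> ereal v"
    and "accumulation_point_of_decisions D a \<Longrightarrow> a \<in> X \<and> f a \<le> v"
proof -
  have low: "\<forall>\<^sub>F N in sequentially. ereal (v - \<delta>) \<le> vals N" if "\<delta> > 0" for \<delta>
  proof -
    have "\<forall>\<^sub>F N in sequentially. \<forall>x\<in>XN N. v - \<delta> \<le> fN N x"
      using eventually_lower_bound_convex[of fN f XN xs X v \<delta>, OF conv lim XN Xlim opt bdd that] .
    then show ?thesis
      using eventually_ge_at_top[of 1]
    proof eventually_elim
      case (elim N)
      then show ?case using lower[of N "v - \<delta>"] by blast
    qed
  qed
  show vlim: "vals \<longlonglongrightarrow> ereal v"
  proof (rule order_tendstoI)
    fix b assume "b < ereal v"
    then obtain b' where b': "b < ereal b'" "ereal b' < ereal v" using ereal_dense2 by blast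
    then have "\<forall>\<^sub>F N in sequentially. ereal (v - (v - b')) \<le> vals N" by (intro low) simp
    then show "\<forall>\<^sub>F N in sequentially. b < vals N"
      by eventually_elim (use b' in \<open>simp add: less_le_trans\<close>)
  next
    fix b assume "ereal v < b"
    then obtain b' where b': "ereal b' < b" "ereal v < ereal b'" using ereal_dense2 by blast
    then have "\<forall>\<^sub>F N in sequentially. vals N \<le> ereal (v + (b' - v))" by (intro upper) simp
    then show "\<forall>\<^sub>F N in sequentially. vals N < b"
      by eventually_elim (use b' in \<open>simp add: le_less_trans\<close>)
  qed
  assume "accumulation_point_of_decisions D a"
  then obtain x and r :: "nat \<Rightarrow> nat" where r: "strict_mono r" "\<And>k. x (r k) \<in> D (r k)" "(x \<circ> r) \<longlonglongrightarrow> a"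
    unfolding accumulation_point_of_decisions_def by blast
  \<comment> \<open>the sample size r 0 may be 0, where the bounds are not available\<close>
  define s where "s k = r (Suc k)" for k
  have s: "strict_mono s" using r(1) by (simp add: s_def strict_mono_def)
  have s1: "s k \<ge> 1" for k
    using strict_mono_imp_increasing[OF r(1), of "Suc k"] by (simp add: s_def)
  have y: "(\<lambda>k. x (s k)) \<longlonglongrightarrow> a"
    using LIMSEQ_Suc[OF r(3)] by (simp add: s_def o_def)
  have d: "x (s k) \<in> XN (s k)" "ereal (fN (s k) (x (s k))) \<le> vals (s k)" for k
    using dec[OF s1, of "x (s k)" k] r(2)[of "Suc k"] by (simp_all add: s_def)
  have "a \<in> X" using Xlim[OF s d(1) y] .
  moreover have "f a \<le> v"
  proof -
    have "(\<lambda>k. ereal (fN (s k) (x (s k)))) \<longlonglongrightarrow> ereal (f a)"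
      using lim[OF s y] by simp
    moreover have "(\<lambda>k. vals (s k)) \<longlonglongrightarrow> ereal v"
      using LIMSEQ_subseq_LIMSEQ[OF vlim s] by (simp add: o_def)
    ultimately have "ereal (f a) \<le> ereal v"
      by (rule LIMSEQ_le) (use d(2) in blast)
    then show ?thesis by simp
  qed
  ultimately show "a \<in> X \<and> f a \<le> v" by simp
qed

section \<open>Norms on Euclidean spaces\<close>

text \<open>
Norms on a Euclidean space are equivalent: a norm is convex, hence continuous, and attains a positive minimum on the
unit sphere.
\<close>

lemma is_norm_dominates_norm:
  fixes \<nu> :: "'a::euclidean_space \<Rightarrow> real"
  assumes "is_norm \<nu>"
  obtains \<kappa> where "\<kappa> > 0" "\<And>x. norm x \<le> \<kappa> * \<nu> x"
proof -
  have zero: "\<nu> x = 0 \<longleftrightarrow> x = 0" and scale: "\<nu> (a *\<^sub>R x) = \<bar>a\<bar> * \<nu> x"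
    and tri: "\<nu> (x + y) \<le> \<nu> x + \<nu> y" for a x y
    using assms unfolding is_norm_def by blast+
  have nonneg: "0 \<le> \<nu> x" for x
    using tri[of x "- x"] scale[of "-1" x] zero[of 0] by simp
  have "convex_on UNIV \<nu>"
  proof (rule convex_onI)
    show "\<nu> ((1 - t) *\<^sub>R x + t *\<^sub>R y) \<le> (1 - t) * \<nu> x + t * \<nu> y" if "0 < t" "t < 1" for t x y
      using tri[of "(1 - t) *\<^sub>R x" "t *\<^sub>R y"] that by (simp add: scale)
  qed simp
  then have cont: "continuous_on UNIV \<nu>" by (intro convex_on_continuous) auto
  have ne: "sphere (0::'a) 1 \<noteq> {}"
    using nonempty_Basis norm_Basis by (auto simp: ex_in_conv[symmetric] dist_norm)
  obtain u where u: "u \<in> sphere (0::'a) 1" "\<And>x. x \<in> sphere 0 1 \<Longrightarrow> \<nu> u \<le> \<nu> x"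
    using continuous_attains_inf[OF compact_sphere ne continuous_on_subset[OF cont subset_UNIV]] by blast
  have "u \<noteq> 0" using u(1) by auto
  then have pos: "\<nu> u > 0" using zero[of u] nonneg[of u] by simp
  show ?thesis
  proof (rule that[of "1 / \<nu> u"])
    show "0 < 1 / \<nu> u" using pos by simp
    fix x :: 'a
    show "norm x \<le> 1 / \<nu> u * \<nu> x"
    proof (cases "x = 0")
      case False
      then have "\<nu> u \<le> \<nu> ((1 / norm x) *\<^sub>R x)" by (intro u(2)) simp
      then show ?thesis using False pos by (simp add: scale field_simps)
    qed (use nonneg pos in simp)
  qed
qed

section \<open>Recourse problems\<close>

text \<open>
The right-hand side that is left for the recourse decision once x is chosen and z is observed.
\<close>

definition residual :: "real^'n^'m \<Rightarrow> real^'d^'m \<Rightarrow> real^'m \<Rightarrow> real^'n \<Rightarrow> real^'d \<Rightarrow> real^'m" where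
  "residual T H h0 x z = rhs H h0 z - T *v x"

lemma residual_convex_decision:
  assumes "u + v = 1"
  shows "residual T H h0 (u *\<^sub>R x + v *\<^sub>R x') z = u *\<^sub>R residual T H h0 x z + v *\<^sub>R residual T H h0 x' z"
proof -
  have "rhs H h0 z = u *\<^sub>R rhs H h0 z + v *\<^sub>R rhs H h0 z"
    using assms by (metis scaleR_add_left scaleR_one)
  then show ?thesis
    by (simp add: residual_def matrix_vector_right_distrib matrix_vector_mult_scaleR algebra_simps)
qed

lemma residual_Lipschitz:
  fixes T :: "real^'n^'m" and H :: "real^'d^'m"
  obtains L where "L > 0"
    "\<And>x x' z z'. norm (residual T H h0 x z - residual T H h0 x' z') \<le> L * (norm (x - x') + norm (z - z'))"
proof -
  obtain K where K: "K > 0" "\<And>x. norm (T *v x) \<le> norm x * K"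
    using bounded_linear.pos_bounded[OF matrix_vector_mul_bounded_linear[of T]] by blast
  obtain G where G: "G > 0" "\<And>x. norm (H *v x) \<le> norm x * G"
    using bounded_linear.pos_bounded[OF matrix_vector_mul_bounded_linear[of H]] by blast
  show ?thesis
  proof (rule that[of "K + G"])
    fix x x' :: "real^'n" and z z' :: "real^'d"
    have "residual T H h0 x z - residual T H h0 x' z' = - (H *v (z - z')) - T *v (x - x')"
      by (simp add: residual_def rhs_def matrix_vector_mult_diff_distrib)
    then have "norm (residual T H h0 x z - residual T H h0 x' z') \<le> norm (H *v (z - z')) + norm (T *v (x - x'))"
      by (metis norm_minus_cancel norm_triangle_ineq4)
    also have "\<dots> \<le> norm (z - z') * G + norm (x - x') * K" using K G by (intro add_mono)
    also have "\<dots> \<le> (K + G) * (norm (x - x') + norm (z - z'))"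
      using K(1) G(1) by (simp add: algebra_simps)
    finally show "norm (residual T H h0 x z - residual T H h0 x' z') \<le> (K + G) * (norm (x - x') + norm (z - z'))" .
  qed (use K G in simp)
qed

lemma support_value_residual_Lipschitz:
  fixes T :: "real^'n^'m" and H :: "real^'d^'m"
  assumes A: "finite A" "A \<noteq> {}"
  obtains L where "L > 0"
    "\<And>x x' z z'. \<bar>support_value A (residual T H h0 x z) - support_value A (residual T H h0 x' z')\<bar>
       \<le> L * (norm (x - x') + norm (z - z'))"
proof -
  obtain K where K: "K > 0"
    "\<And>x x' z z'. norm (residual T H h0 x z - residual T H h0 x' z') \<le> K * (norm (x - x') + norm (z - z'))"
    using residual_Lipschitz[of T H h0] by metis
  define S where "S = (\<Sum>l\<in>A. norm l)"
  have S: "S \<ge> 0" by (simp add: S_def sum_nonneg)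
  show ?thesis
  proof (rule that[of "(S + 1) * K"])
    show "(S + 1) * K > 0" using S K by simp
    fix x x' :: "real^'n" and z z' :: "real^'d"
    have "\<bar>support_value A (residual T H h0 x z) - support_value A (residual T H h0 x' z')\<bar>
       \<le> S * norm (residual T H h0 x z - residual T H h0 x' z')"
      unfolding S_def by (rule support_value_Lipschitz[OF A])
    also have "\<dots> \<le> (S + 1) * (K * (norm (x - x') + norm (z - z')))"
      using S K by (intro mult_mono) auto
    finally show "\<bar>support_value A (residual T H h0 x z) - support_value A (residual T H h0 x' z')\<bar>
       \<le> (S + 1) * K * (norm (x - x') + norm (z - z'))" by (simp add: mult.assoc)
  qed
qed

lemma measurable_support_value_residual:
  fixes T :: "real^'n^'m" and H :: "real^'d^'m"
  assumes A: "finite A" "A \<noteq> {}"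
  shows "(\<lambda>z. support_value A (residual T H h0 x z)) \<in> borel_measurable borel"
proof (rule borel_measurable_continuous_onI)
  have "continuous_on UNIV (\<lambda>z. residual T H h0 x z)"
    unfolding residual_def rhs_def by (intro continuous_intros)
  then show "continuous_on UNIV (\<lambda>z. support_value A (residual T H h0 x z))"
    by (rule continuous_on_compose2[OF continuous_support_value[OF A]]) simp
qed

lemma integrable_support_value_residual:
  fixes T :: "real^'n^'m" and H :: "real^'d^'m"
  assumes A: "finite A" "A \<noteq> {}" and P: "prob_space P" "sets P = sets borel" and nrm: "integrable P norm"
  shows "integrable P (\<lambda>z. support_value A (residual T H h0 x z))"
proof -
  interpret prob_space P by fact
  obtain L where L: "L > 0"
    "\<And>x x' z z'. \<bar>support_value A (residual T H h0 x z) - support_value A (residual T H h0 x' z')\<bar>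
       \<le> L * (norm (x - x') + norm (z - z'))"
    using support_value_residual_Lipschitz[OF A, of T H h0] by metis
  show ?thesis
  proof (rule Bochner_Integration.integrable_bound)
    show "integrable P (\<lambda>z. \<bar>support_value A (residual T H h0 x 0)\<bar> + L * norm z)"
      using nrm by simp
    show "(\<lambda>z. support_value A (residual T H h0 x z)) \<in> borel_measurable P"
      using measurable_support_value_residual[OF A] P(2) by (simp cong: measurable_cong_sets)
    show "AE z in P. norm (support_value A (residual T H h0 x z))
        \<le> norm (\<bar>support_value A (residual T H h0 x 0)\<bar> + L * norm z)"
    proof (rule AE_I2)
      fix z
      show "norm (support_value A (residual T H h0 x z)) \<le> norm (\<bar>support_value A (residual T H h0 x 0)\<bar> + L * norm z)"
        using L(2)[of x z x 0] unfolding real_norm_def by simp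
    qed
  qed
qed

lemma ereal_expectation_integrable:
  assumes g: "integrable M g" and eq: "AE z in M. f z = ereal (g z)"
  shows "ereal_expectation M f = ereal (\<integral>z. g z \<partial>M)"
proof -
  have 1: "(\<integral>\<^sup>+ z. e2ennreal (f z) \<partial>M) = (\<integral>\<^sup>+ z. ennreal (g z) \<partial>M)"
    using eq by (intro nn_integral_cong_AE) (auto simp: ennreal_def e2ennreal_def sup_ereal_def)
  have 2: "(\<integral>\<^sup>+ z. e2ennreal (- f z) \<partial>M) = (\<integral>\<^sup>+ z. ennreal (- g z) \<partial>M)"
    using eq by (intro nn_integral_cong_AE) (auto simp: ennreal_def e2ennreal_def)
  obtain r q where "0 \<le> r" "0 \<le> q" "(\<integral>\<^sup>+ z. ennreal (g z) \<partial>M) = ennreal r"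
    "(\<integral>\<^sup>+ z. ennreal (- g z) \<partial>M) = ennreal q" "(\<integral>z. g z \<partial>M) = r - q"
    using integrableE[OF g] by metis
  then show ?thesis by (simp add: ereal_expectation_def 1 2)
qed

text \<open>
The positive part has infinite integral, and subtracting the negative part does not change this, as
\<open>\<infinity> - \<infinity> = \<infinity>\<close> for extended reals.
\<close>

lemma ereal_expectation_infinite:
  assumes A: "A \<in> sets M" "emeasure M A > 0" and inf: "\<And>z. z \<in> A \<Longrightarrow> f z = \<infinity>"
  shows "ereal_expectation M f = \<infinity>"
proof -
  have "\<infinity> = \<infinity> * emeasure M A" using A(2) by (simp add: ennreal_top_mult)
  also have "\<dots> = (\<integral>\<^sup>+ z. \<infinity> * indicator A z \<partial>M)"
    by (rule nn_integral_cmult_indicator[OF A(1), symmetric])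
  also have "\<dots> \<le> (\<integral>\<^sup>+ z. e2ennreal (f z) \<partial>M)"
    using inf by (intro nn_integral_mono) (auto simp: indicator_def)
  finally have "(\<integral>\<^sup>+ z. e2ennreal (f z) \<partial>M) = \<infinity>" by (simp add: top_unique)
  then show ?thesis by (simp add: ereal_expectation_def)
qed

text \<open>
The conclusion of \<open>linear_program_value\<close> is fixed as an assumption on \<open>\<Lambda>\<close> and \<open>\<M>\<close>. With \<open>\<Lambda>\<close> nonempty the second-stage
cost is never \<open>- \<infinity>\<close>.
\<close>

locale recourse =
  fixes T :: "real^'n^'m" and W :: "real^'r^'m" and H :: "real^'d^'m"
    and c :: "real^'n" and q :: "real^'r" and h0 :: "real^'m"
    and \<Lambda> \<M> :: "(real^'m) set"
  assumes finite_\<Lambda>: "finite \<Lambda>" and finite_\<M>: "finite \<M>" and \<Lambda>_nonempty: "\<Lambda> \<noteq> {}"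
    and duality: "(\<exists>y. b \<le> W *v y \<and> q \<bullet> y \<le> s) \<longleftrightarrow> (\<forall>\<mu>\<in>\<M>. \<mu> \<bullet> b \<le> 0) \<and> (\<forall>l\<in>\<Lambda>. l \<bullet> b \<le> s)"
begin

abbreviation res :: "real^'n \<Rightarrow> real^'d \<Rightarrow> real^'m" where
  "res \<equiv> residual T H h0"

definition cost :: "real^'n \<Rightarrow> real^'d \<Rightarrow> real" where
  "cost x z = support_value \<Lambda> (res x z)"

text \<open>
The constraint violation. Inserting 0 turns the largest form into a nonnegative function that vanishes exactly at the feasible
pairs, so that feasibility can be treated by averages just as the cost is.
\<close>

definition violation :: "real^'n \<Rightarrow> real^'d \<Rightarrow> real" where
  "violation x z = support_value (insert 0 \<M>) (res x z)"

definition feasible :: "real^'n \<Rightarrow> real^'d \<Rightarrow> bool" where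
  "feasible x z \<longleftrightarrow> (\<forall>\<mu>\<in>\<M>. \<mu> \<bullet> res x z \<le> 0)"

lemma feasible_iff_violation: "feasible x z \<longleftrightarrow> violation x z \<le> 0"
  using support_value_le_iff[of "insert 0 \<M>" "res x z" 0] finite_\<M>
  by (simp add: feasible_def violation_def)

lemma violation_nonneg: "0 \<le> violation x z"
  using support_value_ge[of "insert 0 \<M>" 0 "res x z"] finite_\<M> by (simp add: violation_def)

lemma constraint_iff: "rhs H h0 z \<le> T *v x + W *v y \<longleftrightarrow> res x z \<le> W *v y"
  by (simp add: residual_def diff_le_eq add.commute)

lemma recourse_cost_ge:
  assumes "rhs H h0 z \<le> T *v x + W *v y"
  shows "feasible x z" "cost x z \<le> q \<bullet> y"
proof -
  have "res x z \<le> W *v y \<and> q \<bullet> y \<le> q \<bullet> y" using assms by (simp add: constraint_iff)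
  then have d: "(\<forall>\<mu>\<in>\<M>. \<mu> \<bullet> res x z \<le> 0) \<and> (\<forall>l\<in>\<Lambda>. l \<bullet> res x z \<le> q \<bullet> y)"
    using duality by blast
  then show "feasible x z" by (simp add: feasible_def)
  show "cost x z \<le> q \<bullet> y"
    using d support_value_le_iff[OF finite_\<Lambda> \<Lambda>_nonempty] by (simp add: cost_def)
qed

lemma optimal_recourse:
  assumes "feasible x z"
  obtains y where "rhs H h0 z \<le> T *v x + W *v y" "q \<bullet> y \<le> cost x z"
proof -
  have "\<exists>y. res x z \<le> W *v y \<and> q \<bullet> y \<le> cost x z"
    unfolding duality using assms support_value_ge[OF finite_\<Lambda>] by (simp add: feasible_def cost_def)
  then show ?thesis using that by (auto simp: constraint_iff)
qed

lemma second_stage_cost_eq: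
  "second_stage_cost q T W H h0 x z = (if feasible x z then ereal (cost x z) else \<infinity>)"
proof (cases "feasible x z")
  case True
  obtain y where y: "rhs H h0 z \<le> T *v x + W *v y" "q \<bullet> y \<le> cost x z"
    using optimal_recourse[OF True] .
  have "second_stage_cost q T W H h0 x z \<le> ereal (q \<bullet> y)"
    unfolding second_stage_cost_def using y by (intro INF_lower) auto
  also have "\<dots> \<le> ereal (cost x z)" using y by simp
  finally have "second_stage_cost q T W H h0 x z \<le> ereal (cost x z)" .
  moreover have "ereal (cost x z) \<le> second_stage_cost q T W H h0 x z"
    unfolding second_stage_cost_def using recourse_cost_ge by (intro INF_greatest) auto
  ultimately show ?thesis using True by (simp add: antisym)
next
  case False
  then have "{y. rhs H h0 z \<le> T *v x + W *v y} = {}" using recourse_cost_ge(1) by blast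
  then show ?thesis using False by (simp add: second_stage_cost_def top_ereal_def)
qed

lemma cost_convex:
  assumes "0 \<le> u" "0 \<le> v" "u + v = 1"
  shows "cost (u *\<^sub>R x + v *\<^sub>R x') z \<le> u * cost x z + v * cost x' z"
  unfolding cost_def residual_convex_decision[OF assms(3)]
  by (rule support_value_convex[OF finite_\<Lambda> \<Lambda>_nonempty assms])

lemma feasible_convex:
  assumes "feasible x z" "feasible x' z" "0 \<le> u" "0 \<le> v" "u + v = 1"
  shows "feasible (u *\<^sub>R x + v *\<^sub>R x') z"
  unfolding feasible_def residual_convex_decision[OF assms(5)] inner_add_right inner_scaleR_right
  using assms by (auto simp: feasible_def intro!: add_nonpos_nonpos mult_nonneg_nonpos)

lemma cost_Lipschitz:
  obtains L where "L > 0"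
    "\<And>x x' z z'. \<bar>cost x z - cost x' z'\<bar> \<le> L * (norm (x - x') + norm (z - z'))"
  using support_value_residual_Lipschitz[OF finite_\<Lambda> \<Lambda>_nonempty, of T H h0] unfolding cost_def by metis

lemma violation_Lipschitz:
  obtains L where "L > 0"
    "\<And>x x' z z'. \<bar>violation x z - violation x' z'\<bar> \<le> L * (norm (x - x') + norm (z - z'))"
  using support_value_residual_Lipschitz[of "insert 0 \<M>" T H h0] finite_\<M> unfolding violation_def by auto

lemma measurable_violation: "violation x \<in> borel_measurable borel"
  unfolding violation_def[abs_def] using measurable_support_value_residual[of "insert 0 \<M>"] finite_\<M> by simp

definition sample_cost :: "nat \<Rightarrow> (nat \<Rightarrow> real^'d) \<Rightarrow> real^'n \<Rightarrow> real" where
  "sample_cost N w x = c \<bullet> x + (\<Sum>i=1..N. cost x (w i)) / real N"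

definition sample_feasible :: "nat \<Rightarrow> (nat \<Rightarrow> real^'d) \<Rightarrow> (real^'n) set" where
  "sample_feasible N w = {x. \<forall>i\<in>{1..N}. feasible x (w i)}"

text \<open>
A policy is feasible at the sample points, which belong to the uncertainty sets, and cannot be cheaper there than optimal recourse.
\<close>

lemma sro_lower_bound:
  assumes z: "(x, y) \<in> sro_feasible T W H h0 N U" and w: "\<And>i. i \<in> {1..N} \<Longrightarrow> w i \<in> U i"
  shows "x \<in> sample_feasible N w" "ereal (sample_cost N w x) \<le> sro_objective c q N U (x, y)"
proof -
  have con: "rhs H h0 (w i) \<le> T *v x + W *v y (w i)" if "i \<in> {1..N}" for i
    using z w[OF that] that by (auto simp: sro_feasible_def)
  show "x \<in> sample_feasible N w"
    using recourse_cost_ge(1)[OF con] by (auto simp: sample_feasible_def)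
  have "ereal (\<Sum>i=1..N. cost x (w i)) \<le> (\<Sum>i\<in>{1..N}. SUP \<zeta>\<in>U i. ereal (q \<bullet> y \<zeta>))"
    unfolding sum_ereal[symmetric]
  proof (rule sum_mono)
    fix i assume i: "i \<in> {1..N}"
    have "ereal (cost x (w i)) \<le> ereal (q \<bullet> y (w i))" using recourse_cost_ge(2)[OF con[OF i]] by simp
    also have "\<dots> \<le> (SUP \<zeta>\<in>U i. ereal (q \<bullet> y \<zeta>))" using w[OF i] by (intro SUP_upper)
    finally show "ereal (cost x (w i)) \<le> (SUP \<zeta>\<in>U i. ereal (q \<bullet> y \<zeta>))" .
  qed
  then have "ereal (1 / real N) * ereal (\<Sum>i=1..N. cost x (w i))
      \<le> ereal (1 / real N) * (\<Sum>i\<in>{1..N}. SUP \<zeta>\<in>U i. ereal (q \<bullet> y \<zeta>))"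
    by (intro ereal_mult_left_mono) auto
  then have "ereal (c \<bullet> x) + ereal (1 / real N) * ereal (\<Sum>i=1..N. cost x (w i))
      \<le> sro_objective c q N U (x, y)"
    unfolding sro_objective_def case_prod_conv by (rule add_left_mono)
  then show "ereal (sample_cost N w x) \<le> sro_objective c q N U (x, y)"
    by (simp add: sample_cost_def)
qed

lemma mp_lower_bound:
  assumes z: "(x, y) \<in> mp_feasible T W H h0 N U" and w: "\<And>i. i \<in> {1..N} \<Longrightarrow> w i \<in> U i"
  shows "x \<in> sample_feasible N w" "ereal (sample_cost N w x) \<le> mp_objective c q N U (x, y)"
proof -
  have con: "rhs H h0 (w i) \<le> T *v x + W *v y i (w i)" if "i \<in> {1..N}" for i
    using z w[OF that] that by (auto simp: mp_feasible_def)
  show "x \<in> sample_feasible N w"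
    using recourse_cost_ge(1)[OF con] by (auto simp: sample_feasible_def)
  have "ereal (\<Sum>i=1..N. cost x (w i)) \<le> (\<Sum>i\<in>{1..N}. SUP \<zeta>\<in>U i. ereal (q \<bullet> y i \<zeta>))"
    unfolding sum_ereal[symmetric]
  proof (rule sum_mono)
    fix i assume i: "i \<in> {1..N}"
    have "ereal (cost x (w i)) \<le> ereal (q \<bullet> y i (w i))" using recourse_cost_ge(2)[OF con[OF i]] by simp
    also have "\<dots> \<le> (SUP \<zeta>\<in>U i. ereal (q \<bullet> y i \<zeta>))" using w[OF i] by (intro SUP_upper)
    finally show "ereal (cost x (w i)) \<le> (SUP \<zeta>\<in>U i. ereal (q \<bullet> y i \<zeta>))" .
  qed
  then have "ereal (1 / real N) * ereal (\<Sum>i=1..N. cost x (w i))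
      \<le> ereal (1 / real N) * (\<Sum>i\<in>{1..N}. SUP \<zeta>\<in>U i. ereal (q \<bullet> y i \<zeta>))"
    by (intro ereal_mult_left_mono) auto
  then have "ereal (c \<bullet> x) + ereal (1 / real N) * ereal (\<Sum>i=1..N. cost x (w i))
      \<le> mp_objective c q N U (x, y)"
    unfolding mp_objective_def case_prod_conv by (rule add_left_mono)
  then show "ereal (sample_cost N w x) \<le> mp_objective c q N U (x, y)"
    by (simp add: sample_cost_def)
qed

lemma scaled_sum_le:
  assumes N: "N \<ge> 1" and s: "\<And>i. i \<in> {1..N} \<Longrightarrow> s i \<le> ereal (cost x (w i) + \<eta>)"
  shows "ereal (c \<bullet> x) + ereal (1 / real N) * (\<Sum>i\<in>{1..N}. s i) \<le> ereal (sample_cost N w x + \<eta>)"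
proof -
  have "(\<Sum>i\<in>{1..N}. s i) \<le> (\<Sum>i\<in>{1..N}. ereal (cost x (w i) + \<eta>))" by (rule sum_mono[OF s])
  also have "\<dots> = ereal ((\<Sum>i=1..N. cost x (w i)) + real N * \<eta>)" by (simp add: sum.distrib)
  finally have "ereal (1 / real N) * (\<Sum>i\<in>{1..N}. s i)
      \<le> ereal (1 / real N) * ereal ((\<Sum>i=1..N. cost x (w i)) + real N * \<eta>)"
    by (intro ereal_mult_left_mono) auto
  also have "\<dots> = ereal ((\<Sum>i=1..N. cost x (w i)) / real N + \<eta>)"
    using N by (simp add: field_simps)
  finally have "ereal (c \<bullet> x) + ereal (1 / real N) * (\<Sum>i\<in>{1..N}. s i)
      \<le> ereal (c \<bullet> x) + ereal ((\<Sum>i=1..N. cost x (w i)) / real N + \<eta>)"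
    by (rule add_left_mono)
  then show ?thesis by (simp add: sample_cost_def add.assoc)
qed

text \<open>
The policy solves the recourse problem separately for each scenario; an arbitrary policy is allowed.
\<close>

lemma sro_upper_bound:
  assumes N: "N \<ge> 1" and U: "\<And>i \<zeta>. i \<in> {1..N} \<Longrightarrow> \<zeta> \<in> U i \<Longrightarrow> feasible x \<zeta> \<and> cost x \<zeta> \<le> cost x (w i) + \<eta>"
  shows "sro_value c q T W H h0 N U \<le> ereal (sample_cost N w x + \<eta>)"
proof -
  have "\<exists>y. feasible x \<zeta> \<longrightarrow> rhs H h0 \<zeta> \<le> T *v x + W *v y \<and> q \<bullet> y \<le> cost x \<zeta>" for \<zeta>
    using optimal_recourse by metis
  then obtain y where y: "\<And>\<zeta>. feasible x \<zeta> \<Longrightarrow> rhs H h0 \<zeta> \<le> T *v x + W *v y \<zeta> \<and> q \<bullet> y \<zeta> \<le> cost x \<zeta>"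
    by metis
  have "(x, y) \<in> sro_feasible T W H h0 N U" using y U by (auto simp: sro_feasible_def)
  then have "sro_value c q T W H h0 N U \<le> sro_objective c q N U (x, y)"
    unfolding sro_value_def by (rule INF_lower)
  also have "\<dots> \<le> ereal (sample_cost N w x + \<eta>)"
    unfolding sro_objective_def case_prod_conv
  proof (rule scaled_sum_le[OF N], rule SUP_least)
    fix i \<zeta> assume "i \<in> {1..N}" "\<zeta> \<in> U i"
    then show "ereal (q \<bullet> y \<zeta>) \<le> ereal (cost x (w i) + \<eta>)"
      using U[of i \<zeta>] y[of \<zeta>] by simp
  qed
  finally show ?thesis .
qed

text \<open>
Interpolate optimal recourse decisions at the points of V with the affine coordinates. Feasibility and the
cost bound survive convex combinations because the constraints are jointly linear in the scenario and the
recourse decision.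
\<close>

lemma affine_policy_from_coordinates:
  assumes UV: "affine_coordinates U V" and V: "\<And>\<zeta>. \<zeta> \<in> V \<Longrightarrow> feasible x \<zeta> \<and> cost x \<zeta> \<le> r"
  obtains y :: "real^'d \<Rightarrow> real^'r" where "affine_map y"
    "\<And>\<zeta>. \<zeta> \<in> U \<Longrightarrow> rhs H h0 \<zeta> \<le> T *v x + W *v y \<zeta>" "\<And>\<zeta>. \<zeta> \<in> U \<Longrightarrow> q \<bullet> y \<zeta> \<le> r"
proof -
  obtain I :: "(real^'d) set" and p a k where I: "finite I" "p ` I \<subseteq> V"
     and co: "\<forall>z\<in>U. (\<forall>i\<in>I. 0 \<le> a i \<bullet> z + k i) \<and> (\<Sum>i\<in>I. a i \<bullet> z + k i) = 1 \<and>
        z = (\<Sum>i\<in>I. (a i \<bullet> z + k i) *\<^sub>R p i)"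
    using UV unfolding affine_coordinates_def by blast
  have "\<exists>y. rhs H h0 (p i) \<le> T *v x + W *v y \<and> q \<bullet> y \<le> r" if "i \<in> I" for i
  proof -
    have "feasible x (p i)" "cost x (p i) \<le> r" using V I(2) that by auto
    then obtain y where "rhs H h0 (p i) \<le> T *v x + W *v y" "q \<bullet> y \<le> cost x (p i)"
      using optimal_recourse by metis
    then show ?thesis using \<open>cost x (p i) \<le> r\<close> by (intro exI[of _ y]) simp
  qed
  then obtain Y where Y: "\<And>i. i \<in> I \<Longrightarrow> rhs H h0 (p i) \<le> T *v x + W *v Y i" "\<And>i. i \<in> I \<Longrightarrow> q \<bullet> Y i \<le> r"
    by metis
  define b where "b i z = a i \<bullet> z + k i" for i z
  define y where "y z = (\<Sum>i\<in>I. b i z *\<^sub>R Y i)" for z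
  have nn: "0 \<le> b i z" if "z \<in> U" "i \<in> I" for z i using co that by (simp add: b_def)
  have one: "(\<Sum>i\<in>I. b i z) = 1" if "z \<in> U" for z using co that by (simp add: b_def)
  have rep: "z = (\<Sum>i\<in>I. b i z *\<^sub>R p i)" if "z \<in> U" for z using co that by (simp add: b_def)
  show ?thesis
  proof (rule that[of y])
    have lin: "linear (\<lambda>z. \<Sum>i\<in>I. (a i \<bullet> z) *\<^sub>R Y i)"
      by (intro linear_compose_sum ballI linearI) (simp_all add: inner_add_right scaleR_add_left)
    show "affine_map y"
      unfolding affine_map_def
    proof (intro exI allI)
      show "y z = matrix (\<lambda>z. \<Sum>i\<in>I. (a i \<bullet> z) *\<^sub>R Y i) *v z + (\<Sum>i\<in>I. k i *\<^sub>R Y i)" for z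
        using fun_cong[OF matrix_vector_mul(2)[OF lin], of z] by (simp add: y_def b_def scaleR_add_left sum.distrib)
    qed
    fix z assume z: "z \<in> U"
    have "q \<bullet> y z = (\<Sum>i\<in>I. b i z * (q \<bullet> Y i))" by (simp add: y_def inner_sum_right)
    also have "\<dots> \<le> (\<Sum>i\<in>I. b i z * r)"
      using nn[OF z] Y by (intro sum_mono mult_left_mono) auto
    also have "\<dots> = r" using one[OF z] by (simp add: sum_distrib_right[symmetric])
    finally show "q \<bullet> y z \<le> r" .
    have avg: "v = (\<Sum>i\<in>I. b i z *\<^sub>R v)" for v :: "real^'m"
      using one[OF z] by (simp add: scaleR_sum_left[symmetric])
    have "H *v z = (\<Sum>i\<in>I. b i z *\<^sub>R (H *v p i))"
      using arg_cong[OF rep[OF z], of "(*v) H"]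
      by (simp add: linear_sum[OF matrix_vector_mul_linear] matrix_vector_mult_scaleR o_def)
    then have "rhs H h0 z = (\<Sum>i\<in>I. b i z *\<^sub>R rhs H h0 (p i))"
      using avg[of h0] by (simp add: rhs_def scaleR_diff_right sum_subtractf algebra_simps)
    also have "\<dots> \<le> (\<Sum>i\<in>I. b i z *\<^sub>R (T *v x + W *v Y i))"
      using nn[OF z] Y by (intro sum_mono scaleR_left_mono) auto
    also have "\<dots> = T *v x + W *v y z"
      using avg[of "T *v x"]
      by (simp add: scaleR_add_right sum.distrib y_def linear_sum[OF matrix_vector_mul_linear] matrix_vector_mult_scaleR o_def)
    finally show "rhs H h0 z \<le> T *v x + W *v y z" .
  qed
qed

lemma mp_upper_bound:
  assumes N: "N \<ge> 1" and UV: "\<And>i. i \<in> {1..N} \<Longrightarrow> affine_coordinates (U i) (V i)"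
    and V: "\<And>i \<zeta>. i \<in> {1..N} \<Longrightarrow> \<zeta> \<in> V i \<Longrightarrow> feasible x \<zeta> \<and> cost x \<zeta> \<le> cost x (w i) + \<eta>"
  shows "mp_value c q T W H h0 N U \<le> ereal (sample_cost N w x + \<eta>)"
proof -
  have "\<exists>y. affine_map y \<and> (\<forall>\<zeta>\<in>U i. rhs H h0 \<zeta> \<le> T *v x + W *v y \<zeta> \<and> q \<bullet> y \<zeta> \<le> cost x (w i) + \<eta>)"
    if "i \<in> {1..N}" for i
    using affine_policy_from_coordinates[OF UV[OF that] V[OF that]] by metis
  then obtain y where y: "\<And>i. i \<in> {1..N} \<Longrightarrow> affine_map (y i)"
    "\<And>i \<zeta>. i \<in> {1..N} \<Longrightarrow> \<zeta> \<in> U i \<Longrightarrow> rhs H h0 \<zeta> \<le> T *v x + W *v y i \<zeta>"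
    "\<And>i \<zeta>. i \<in> {1..N} \<Longrightarrow> \<zeta> \<in> U i \<Longrightarrow> q \<bullet> y i \<zeta> \<le> cost x (w i) + \<eta>"
    by metis
  have "(x, y) \<in> mp_feasible T W H h0 N U" using y by (auto simp: mp_feasible_def)
  then have "mp_value c q T W H h0 N U \<le> mp_objective c q N U (x, y)"
    unfolding mp_value_def by (rule INF_lower)
  also have "\<dots> \<le> ereal (sample_cost N w x + \<eta>)"
    unfolding mp_objective_def case_prod_conv
  proof (rule scaled_sum_le[OF N], rule SUP_least)
    fix i \<zeta> assume "i \<in> {1..N}" "\<zeta> \<in> U i"
    then show "ereal (q \<bullet> y i \<zeta>) \<le> ereal (cost x (w i) + \<eta>)" using y(3) by simp
  qed
  finally show ?thesis .
qed

end

section \<open>Consistency along a fixed sample\<close>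

lemma average_Lipschitz:
  fixes s t :: "nat \<Rightarrow> real"
  assumes "\<And>i. \<bar>s i - t i\<bar> \<le> B"
  shows "\<bar>(\<Sum>i=1..N. s i) / real N - (\<Sum>i=1..N. t i) / real N\<bar> \<le> B"
proof (cases "N = 0")
  case True
  then show ?thesis using assms[of 0] by simp
next
  case False
  have "\<bar>(\<Sum>i=1..N. s i - t i)\<bar> \<le> (\<Sum>i=1..N. \<bar>s i - t i\<bar>)" by (rule sum_abs)
  also have "\<dots> \<le> (\<Sum>i=1..N. B)" by (rule sum_mono[OF assms])
  finally have "\<bar>(\<Sum>i=1..N. s i - t i)\<bar> \<le> real N * B" by simp
  moreover have "(\<Sum>i=1..N. s i) / real N - (\<Sum>i=1..N. t i) / real N = (\<Sum>i=1..N. s i - t i) / real N"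
    by (simp add: sum_subtractf diff_divide_distrib)
  ultimately show ?thesis using False by (simp add: field_simps)
qed

context recourse
begin

lemma sample_cost_Lipschitz:
  assumes "\<And>x x' z z'. \<bar>cost x z - cost x' z'\<bar> \<le> L * (norm (x - x') + norm (z - z'))"
  shows "\<bar>sample_cost N w x - sample_cost N w x'\<bar> \<le> (norm c + L) * dist x x'"
proof -
  have "\<bar>cost x (w i) - cost x' (w i)\<bar> \<le> L * dist x x'" for i
    using assms[of x "w i" x' "w i"] by (simp add: dist_norm)
  then have "\<bar>(\<Sum>i=1..N. cost x (w i)) / real N - (\<Sum>i=1..N. cost x' (w i)) / real N\<bar> \<le> L * dist x x'"
    by (rule average_Lipschitz)
  moreover have "\<bar>c \<bullet> x - c \<bullet> x'\<bar> \<le> norm c * dist x x'"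
    using Cauchy_Schwarz_ineq2[of c "x - x'"] by (simp add: inner_diff_right dist_norm)
  ultimately show ?thesis by (simp add: sample_cost_def algebra_simps abs_le_iff)
qed

lemma convex_sample_cost: "convex_on UNIV (sample_cost N w)"
proof (rule convex_onI)
  fix t :: real and x y :: "real^'n" assume t: "0 < t" "t < 1"
  define z where "z = (1 - t) *\<^sub>R x + t *\<^sub>R y"
  have "(\<Sum>i=1..N. cost z (w i)) \<le> (\<Sum>i=1..N. (1 - t) * cost x (w i) + t * cost y (w i))"
    unfolding z_def using t by (intro sum_mono cost_convex) auto
  then have "(\<Sum>i=1..N. cost z (w i)) / real N
      \<le> ((1 - t) * (\<Sum>i=1..N. cost x (w i)) + t * (\<Sum>i=1..N. cost y (w i))) / real N"
    by (intro divide_right_mono) (simp_all add: sum.distrib sum_distrib_left)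
  also have "\<dots> = (1 - t) * ((\<Sum>i=1..N. cost x (w i)) / real N) + t * ((\<Sum>i=1..N. cost y (w i)) / real N)"
    by (simp add: add_divide_distrib)
  finally have "(\<Sum>i=1..N. cost z (w i)) / real N
      \<le> (1 - t) * ((\<Sum>i=1..N. cost x (w i)) / real N) + t * ((\<Sum>i=1..N. cost y (w i)) / real N)" .
  moreover have "c \<bullet> z = (1 - t) * (c \<bullet> x) + t * (c \<bullet> y)" by (simp add: z_def inner_add_right)
  ultimately show "sample_cost N w ((1 - t) *\<^sub>R x + t *\<^sub>R y) \<le> (1 - t) * sample_cost N w x + t * sample_cost N w y"
    unfolding z_def[symmetric] sample_cost_def distrib_left by linarith
qed simp

lemma convex_sample_feasible: "convex (sample_feasible N w)"
  by (auto simp: convex_def sample_feasible_def intro!: feasible_convex)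

text \<open>
For each constraint there are two cases. If x0 leaves more slack than xs, by a positive gap, a weight t on x0 gains
t times the gap, which covers the change of the right-hand side within a small distance of a sample point.
Otherwise xs leaves at least the slack of x0, so the constraint holds on all of \<open>\<Xi>\<close> for both and for
their combinations. As there are finitely many constraints, one distance serves for all of them.
\<close>

lemma feasible_nearby:
  fixes w :: "nat \<Rightarrow> real^'d"
  assumes xs: "\<And>i. i \<ge> 1 \<Longrightarrow> feasible xs (w i)" and x0: "\<And>\<zeta>. \<zeta> \<in> \<Xi> \<Longrightarrow> feasible x0 \<zeta>"
    and t: "0 < t" "t \<le> 1"
  obtains e where "e > 0"
    "\<And>i \<zeta>. i \<ge> 1 \<Longrightarrow> \<zeta> \<in> \<Xi> \<inter> cball (w i) e \<Longrightarrow> feasible ((1 - t) *\<^sub>R xs + t *\<^sub>R x0) \<zeta>"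
proof -
  let ?x = "(1 - t) *\<^sub>R xs + t *\<^sub>R x0"
  obtain L where L: "L > 0"
    "\<And>x x' z z'. norm (res x z - res x' z') \<le> L * (norm (x - x') + norm (z - z'))"
    using residual_Lipschitz[of T H h0] by metis
  have "\<exists>e>0. \<forall>i\<ge>1. \<forall>\<zeta>\<in>\<Xi> \<inter> cball (w i) e. \<mu> \<bullet> res ?x \<zeta> \<le> 0" if \<mu>: "\<mu> \<in> \<M>" for \<mu>
  proof -
    define gap where "gap = \<mu> \<bullet> (T *v x0) - \<mu> \<bullet> (T *v xs)"
    have split: "\<mu> \<bullet> res ?x \<zeta> = (1 - t) * (\<mu> \<bullet> res xs \<zeta>) + t * (\<mu> \<bullet> res x0 \<zeta>)" for \<zeta>
      using residual_convex_decision[of "1 - t" t T H h0 xs x0 \<zeta>] by (simp add: inner_add_right)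
    have diff: "\<mu> \<bullet> res xs \<zeta> = \<mu> \<bullet> res x0 \<zeta> + gap" for \<zeta>
      by (simp add: gap_def residual_def inner_diff_right)
    show ?thesis
    proof (cases "gap \<le> 0")
      case True
      have "\<mu> \<bullet> res ?x \<zeta> \<le> 0" if "\<zeta> \<in> \<Xi>" for \<zeta>
      proof -
        have "\<mu> \<bullet> res x0 \<zeta> \<le> 0" using x0[OF that] \<mu> by (simp add: feasible_def)
        then show ?thesis unfolding split using diff[of \<zeta>] True t
          by (intro add_nonpos_nonpos mult_nonneg_nonpos) auto
      qed
      then show ?thesis by (intro exI[of _ 1]) auto
    next
      case False
      define e where "e = t * gap / ((norm \<mu> + 1) * L)"
      have pos: "(norm \<mu> + 1) * L > 0" using L by (simp add: add_nonneg_pos)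
      have e: "e > 0" using False t pos by (simp add: e_def)
      have "\<mu> \<bullet> res ?x \<zeta> \<le> 0" if i: "i \<ge> 1" and \<zeta>: "\<zeta> \<in> cball (w i) e" for i \<zeta>
      proof -
        have "\<mu> \<bullet> res xs \<zeta> - \<mu> \<bullet> res xs (w i) \<le> norm \<mu> * norm (res xs \<zeta> - res xs (w i))"
          by (metis inner_diff_right norm_cauchy_schwarz)
        also have "\<dots> \<le> (norm \<mu> + 1) * (L * e)"
          using L(2)[of xs \<zeta> xs "w i"] \<zeta> L(1)
          by (intro mult_mono) (auto simp: dist_norm norm_minus_commute intro: order_trans)
        also have "\<dots> = t * gap" using pos L(1) by (simp add: e_def field_simps)
        finally have 1: "\<mu> \<bullet> res xs \<zeta> - \<mu> \<bullet> res xs (w i) \<le> t * gap" .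
        have "\<mu> \<bullet> res ?x \<zeta> = \<mu> \<bullet> res xs \<zeta> - t * gap"
          unfolding split using diff[of \<zeta>] by (simp add: algebra_simps)
        moreover have "\<mu> \<bullet> res xs (w i) \<le> 0" using xs[OF i] \<mu> by (simp add: feasible_def)
        ultimately show ?thesis using 1 by linarith
      qed
      then show ?thesis using e by blast
    qed
  qed
  then obtain e where e: "\<And>\<mu>. \<mu> \<in> \<M> \<Longrightarrow> e \<mu> > 0"
    "\<And>\<mu> i \<zeta>. \<mu> \<in> \<M> \<Longrightarrow> i \<ge> 1 \<Longrightarrow> \<zeta> \<in> \<Xi> \<inter> cball (w i) (e \<mu>) \<Longrightarrow> \<mu> \<bullet> res ?x \<zeta> \<le> 0"
    by metis
  define e0 where "e0 = Min (insert 1 (e ` \<M>))"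
  have le: "e0 \<le> e \<mu>" if "\<mu> \<in> \<M>" for \<mu> using that finite_\<M> by (simp add: e0_def)
  show ?thesis
  proof (rule that[of e0])
    show "e0 > 0" using finite_\<M> e(1) by (simp add: e0_def)
    fix i \<zeta> assume i: "i \<ge> (1::nat)" and \<zeta>: "\<zeta> \<in> \<Xi> \<inter> cball (w i) e0"
    show "feasible ?x \<zeta>"
      unfolding feasible_def
    proof
      fix \<mu> assume \<mu>: "\<mu> \<in> \<M>"
      then have "\<zeta> \<in> \<Xi> \<inter> cball (w i) (e \<mu>)" using \<zeta> le[OF \<mu>] by auto
      then show "\<mu> \<bullet> res ?x \<zeta> \<le> 0" using e(2)[OF \<mu> i] by blast
    qed
  qed
qed

text \<open>
The deterministic part of the theorem: w is a sample along which the average costs and average violations converge,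
to f and g. The condition \<open>g x \<le> 0\<close> takes the place of almost sure feasibility of x.
\<close>

lemma values_and_decisions_converge:
  fixes \<Xi> :: "(real^'d) set" and w :: "nat \<Rightarrow> real^'d"
  assumes simple: "simple_polyhedron \<Xi>" and vertex: "\<exists>v. v extreme_point_of \<Xi>"
    and \<nu>: "\<kappa> > 0" "\<And>x. norm x \<le> \<kappa> * \<nu> x" "\<nu> 0 = 0"
    and \<epsilon>: "\<And>N. \<epsilon> N \<ge> 0" "\<epsilon> \<longlonglongrightarrow> 0"
    and w\<Xi>: "\<And>i. i \<ge> 1 \<Longrightarrow> w i \<in> \<Xi>" and xs: "\<And>i. i \<ge> 1 \<Longrightarrow> feasible xs (w i)"
    and x0: "\<And>\<zeta>. \<zeta> \<in> \<Xi> \<Longrightarrow> feasible x0 \<zeta>"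
    and f: "\<And>x. (\<lambda>N. sample_cost N w x) \<longlonglongrightarrow> f x"
    and g: "\<And>x. (\<lambda>N. (\<Sum>i=1..N. violation x (w i)) / real N) \<longlonglongrightarrow> g x"
    and opt: "\<And>x. g x \<le> 0 \<Longrightarrow> v \<le> f x" "f xs \<le> v" and bdd: "bounded {x. g x \<le> 0 \<and> f x \<le> v}"
  defines "U \<equiv> \<lambda>N i. uncertainty_set \<nu> \<Xi> (\<epsilon> N) (w i)"
  shows "(\<lambda>N. sro_value c q T W H h0 N (U N)) \<longlonglongrightarrow> ereal v"
    and "(\<lambda>N. mp_value c q T W H h0 N (U N)) \<longlonglongrightarrow> ereal v"
    and "accumulation_point_of_decisions (\<lambda>N. sro_decisions c q T W H h0 N (U N)) a \<Longrightarrow> g a \<le> 0 \<and> f a \<le> v"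
    and "accumulation_point_of_decisions (\<lambda>N. mp_decisions c q T W H h0 N (U N)) a \<Longrightarrow> g a \<le> 0 \<and> f a \<le> v"
proof -
  obtain L where L: "L > 0" "\<And>x x' z z'. \<bar>cost x z - cost x' z'\<bar> \<le> L * (norm (x - x') + norm (z - z'))"
    using cost_Lipschitz by metis
  obtain K where K: "K > 0" "\<And>x x' z z'. \<bar>violation x z - violation x' z'\<bar> \<le> K * (norm (x - x') + norm (z - z'))"
    using violation_Lipschitz by metis
  obtain C e0 where C: "C > 0" "e0 > 0" and cov: "\<And>x e. x \<in> \<Xi> \<Longrightarrow> 0 < e \<Longrightarrow> e \<le> e0 \<Longrightarrow>
      affine_coordinates (\<Xi> \<inter> cball x e) (\<Xi> \<inter> cball x (C * e))"
    using simple_polyhedron_affine_coordinates[OF simple vertex] by metis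
  have wU: "w i \<in> U N i" if "i \<in> {1..N}" for i N
    using w\<Xi>[of i] that \<nu>(3) \<epsilon>(1) by (simp add: U_def uncertainty_set_def)
  have lim: "(\<lambda>k. sample_cost (r k) w (y k)) \<longlonglongrightarrow> f l" if "strict_mono r" "y \<longlonglongrightarrow> l" for r y l
    by (rule Lipschitz_continuous_convergence[OF sample_cost_Lipschitz[OF L(2)] f that])
  have limg: "(\<lambda>k. (\<Sum>i=1..r k. violation (y k) (w i)) / real (r k)) \<longlonglongrightarrow> g l"
    if "strict_mono r" "y \<longlonglongrightarrow> l" for r y l
  proof (rule Lipschitz_continuous_convergence[OF _ g that])
    show "\<bar>(\<Sum>i=1..n. violation x (w i)) / real n - (\<Sum>i=1..n. violation y (w i)) / real n\<bar> \<le> K * dist x y" for n x y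
      using K(2)[of x _ y] by (intro average_Lipschitz) (metis add.right_neutral diff_self dist_norm norm_zero)
  qed
  have X: "convex (sample_feasible N w)" "xs \<in> sample_feasible N w" for N
    using convex_sample_feasible xs by (auto simp: sample_feasible_def)
  have Xlim: "l \<in> {x. g x \<le> 0}" if r: "strict_mono r" and y: "\<And>k. y k \<in> sample_feasible (r k) w" "y \<longlonglongrightarrow> l" for r y l
  proof -
    have "violation (y k) (w i) = 0" if "i \<in> {1..r k}" for k i
      using y(1)[of k] that violation_nonneg[of "y k" "w i"]
      by (auto simp: sample_feasible_def feasible_iff_violation intro: antisym)
    then have "(\<lambda>k. (\<Sum>i=1..r k. violation (y k) (w i)) / real (r k)) = (\<lambda>k. 0)" by (intro ext) simp
    then have "(\<lambda>k. 0) \<longlonglongrightarrow> g l" using limg[OF r y(2)] by (simp only:)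
    then have "g l = 0" using LIMSEQ_unique tendsto_const by blast
    then show ?thesis by simp
  qed
  have opt': "x \<in> {x. g x \<le> 0} \<Longrightarrow> v \<le> f x" for x using opt(1) by simp
  have bdd': "bounded {x \<in> {x. g x \<le> 0}. f x \<le> v}" using bdd by simp
  have fL: "\<bar>f x - f x'\<bar> \<le> (norm c + L) * dist x x'" for x x'
  proof (rule tendsto_upperbound)
    show "(\<lambda>N. \<bar>sample_cost N w x - sample_cost N w x'\<bar>) \<longlonglongrightarrow> \<bar>f x - f x'\<bar>"
      by (intro tendsto_rabs tendsto_diff f)
    show "\<forall>\<^sub>F N in sequentially. \<bar>sample_cost N w x - sample_cost N w x'\<bar> \<le> (norm c + L) * dist x x'"
      using sample_cost_Lipschitz[OF L(2)] by simp
  qed simp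
  \<comment> \<open>Euclidean radius of the uncertainty sets; the second summand keeps it positive when \<open>\<epsilon> N = 0\<close>\<close>
  define \<eta> where "\<eta> N = \<kappa> * \<epsilon> N + 1 / real (Suc N)" for N
  have \<eta>_pos: "\<eta> N > 0" for N using \<nu>(1) \<epsilon>(1)[of N] by (simp add: \<eta>_def add_nonneg_pos)
  have \<eta>_lim: "\<eta> \<longlonglongrightarrow> 0"
    using tendsto_add[OF tendsto_mult_right_zero[OF \<epsilon>(2), of \<kappa>] LIMSEQ_inverse_real_of_nat]
    unfolding \<eta>_def[abs_def] by (simp add: inverse_eq_divide)
  have U\<eta>: "U N i \<subseteq> \<Xi> \<inter> cball (w i) (\<eta> N)" for N i
  proof
    fix \<zeta> assume "\<zeta> \<in> U N i"
    then have z: "\<zeta> \<in> \<Xi>" "\<nu> (\<zeta> - w i) \<le> \<epsilon> N" by (auto simp: U_def uncertainty_set_def)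
    have "norm (\<zeta> - w i) \<le> \<kappa> * \<nu> (\<zeta> - w i)" by (rule \<nu>(2))
    also have "\<dots> \<le> \<kappa> * \<epsilon> N" using z \<nu>(1) by (intro mult_left_mono) auto
    also have "\<dots> \<le> \<eta> N" by (simp add: \<eta>_def)
    finally show "\<zeta> \<in> \<Xi> \<inter> cball (w i) (\<eta> N)" using z by (simp add: dist_norm norm_minus_commute)
  qed
  have upper: "\<forall>\<^sub>F N in sequentially. sro_value c q T W H h0 N (U N) \<le> ereal (v + \<delta>) \<and>
      mp_value c q T W H h0 N (U N) \<le> ereal (v + \<delta>)" if \<delta>: "\<delta> > 0" for \<delta>
  proof -
    \<comment> \<open>step towards x0, so short that f grows by at most a quarter of \<open>\<delta>\<close>\<close>
    define t where "t = min 1 (\<delta> / (4 * ((norm c + L) * dist xs x0 + 1)))"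
    have dpos: "(norm c + L) * dist xs x0 \<ge> 0" using L(1) by (intro mult_nonneg_nonneg) auto
    have t: "0 < t" "t \<le> 1" using \<delta> dpos by (auto simp: t_def add_nonneg_pos)
    define xt where "xt = (1 - t) *\<^sub>R xs + t *\<^sub>R x0"
    have "xt - xs = t *\<^sub>R (x0 - xs)" by (simp add: xt_def algebra_simps)
    then have dxt: "dist xt xs = t * dist xs x0" using t by (simp add: dist_norm norm_minus_commute)
    have "f xt \<le> f xs + (norm c + L) * dist xt xs" using fL[of xt xs] by linarith
    also have "(norm c + L) * dist xt xs = t * ((norm c + L) * dist xs x0)" by (simp add: dxt)
    also have "\<dots> \<le> \<delta> / (4 * ((norm c + L) * dist xs x0 + 1)) * ((norm c + L) * dist xs x0 + 1)"
      using dpos t by (intro mult_mono) (auto simp: t_def)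
    also have "\<dots> = \<delta> / 4" using dpos by (simp add: field_simps add_nonneg_eq_0_iff)
    finally have fxt: "f xt < v + \<delta> / 2" using opt(2) \<delta> by linarith
    obtain e where e: "e > 0" "\<And>i \<zeta>. i \<ge> 1 \<Longrightarrow> \<zeta> \<in> \<Xi> \<inter> cball (w i) e \<Longrightarrow> feasible xt \<zeta>"
      using feasible_nearby[where w = w and \<Xi> = \<Xi>, OF xs x0 t] unfolding xt_def by metis
    have "\<forall>\<^sub>F N in sequentially. sample_cost N w xt < v + \<delta> / 2"
      using f fxt by (rule order_tendstoD(2))
    moreover have "\<forall>\<^sub>F N in sequentially. \<eta> N < min e0 (min (e / (C + 1)) (\<delta> / (2 * L * (C + 1))))"
      using \<eta>_lim C L(1) e(1) \<delta> by (intro order_tendstoD(2)) auto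
    ultimately show ?thesis
      using eventually_ge_at_top[of 1]
    proof eventually_elim
      case (elim N)
      have N: "N \<ge> 1" and \<eta>0: "\<eta> N \<le> e0" and "\<eta> N < e / (C + 1)" and "\<eta> N < \<delta> / (2 * L * (C + 1))"
        using elim by auto
      then have "\<eta> N * (C + 1) < e" "\<eta> N * (2 * L * (C + 1)) < \<delta>"
        using C L(1) by (simp_all add: pos_less_divide_eq)
      then have \<eta>1: "(C + 1) * \<eta> N \<le> e" and \<eta>2: "L * ((C + 1) * \<eta> N) \<le> \<delta> / 2"
        by (simp_all add: algebra_simps)
      \<comment> \<open>the factor C + 1 makes V i contain both the corners of the simplices and the uncertainty sets\<close>
      define V where "V i = \<Xi> \<inter> cball (w i) ((C + 1) * \<eta> N)" for i
      have V: "feasible xt \<zeta> \<and> cost xt \<zeta> \<le> cost xt (w i) + \<delta> / 2" if "i \<in> {1..N}" "\<zeta> \<in> V i" for i \<zeta>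
      proof
        show "feasible xt \<zeta>" using that \<eta>1 by (intro e(2)[of i]) (auto simp: V_def)
        have "cost xt \<zeta> - cost xt (w i) \<le> L * norm (\<zeta> - w i)" using L(2)[of xt \<zeta> xt "w i"] by simp
        also have "\<dots> \<le> L * ((C + 1) * \<eta> N)"
          using that L(1) by (intro mult_left_mono) (auto simp: V_def dist_norm norm_minus_commute)
        finally show "cost xt \<zeta> \<le> cost xt (w i) + \<delta> / 2" using \<eta>2 by linarith
      qed
      have UV: "U N i \<subseteq> V i" for i
      proof -
        have "\<eta> N \<le> (C + 1) * \<eta> N" using C(1) \<eta>_pos[of N] by simp
        then show ?thesis using U\<eta>[of N i] by (fastforce simp: V_def)
      qed
      have AC: "affine_coordinates (U N i) (V i)" if "i \<in> {1..N}" for i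
      proof (rule affine_coordinates_mono)
        show "affine_coordinates (\<Xi> \<inter> cball (w i) (\<eta> N)) (\<Xi> \<inter> cball (w i) (C * \<eta> N))"
          using that by (intro cov w\<Xi> \<eta>_pos \<eta>0) auto
        show "U N i \<subseteq> \<Xi> \<inter> cball (w i) (\<eta> N)" by (rule U\<eta>)
        have "C * \<eta> N \<le> (C + 1) * \<eta> N" using \<eta>_pos[of N] by simp
        then show "\<Xi> \<inter> cball (w i) (C * \<eta> N) \<subseteq> V i" by (auto simp: V_def)
      qed
      have le: "ereal (sample_cost N w xt + \<delta> / 2) \<le> ereal (v + \<delta>)" using elim by simp
      have "sro_value c q T W H h0 N (U N) \<le> ereal (sample_cost N w xt + \<delta> / 2)"
        by (rule sro_upper_bound[OF N]) (use V UV in blast)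
      moreover have "mp_value c q T W H h0 N (U N) \<le> ereal (sample_cost N w xt + \<delta> / 2)"
        by (rule mp_upper_bound[OF N AC V])
      ultimately show ?case using le order_trans by blast
    qed
  qed
  have sro_dec: "x \<in> sample_feasible N w \<and> ereal (sample_cost N w x) \<le> sro_value c q T W H h0 N (U N)"
    if "x \<in> sro_decisions c q T W H h0 N (U N)" for x N
  proof -
    from that obtain y where y: "(x, y) \<in> sro_feasible T W H h0 N (U N)"
      "sro_objective c q N (U N) (x, y) = sro_value c q T W H h0 N (U N)" by (auto simp: sro_decisions_def)
    then show ?thesis using sro_lower_bound[OF y(1), of w, OF wU] by simp
  qed
  have mp_dec: "x \<in> sample_feasible N w \<and> ereal (sample_cost N w x) \<le> mp_value c q T W H h0 N (U N)"
    if "x \<in> mp_decisions c q T W H h0 N (U N)" for x N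
  proof -
    from that obtain y where y: "(x, y) \<in> mp_feasible T W H h0 N (U N)"
      "mp_objective c q N (U N) (x, y) = mp_value c q T W H h0 N (U N)" by (auto simp: mp_decisions_def)
    then show ?thesis using mp_lower_bound[OF y(1), of w, OF wU] by simp
  qed
  have sro_low: "ereal l \<le> sro_value c q T W H h0 N (U N)" if "\<And>x. x \<in> sample_feasible N w \<Longrightarrow> l \<le> sample_cost N w x" for l N
    unfolding sro_value_def
  proof (rule INF_greatest, clarify)
    fix x y assume "(x, y) \<in> sro_feasible T W H h0 N (U N)"
    note b = sro_lower_bound[OF this, of w, OF wU]
    have "ereal l \<le> ereal (sample_cost N w x)" using that b(1) by simp
    also note b(2)
    finally show "ereal l \<le> sro_objective c q N (U N) (x, y)" .
  qed
  have mp_low: "ereal l \<le> mp_value c q T W H h0 N (U N)" if "\<And>x. x \<in> sample_feasible N w \<Longrightarrow> l \<le> sample_cost N w x" for l N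
    unfolding mp_value_def
  proof (rule INF_greatest, clarify)
    fix x y assume "(x, y) \<in> mp_feasible T W H h0 N (U N)"
    note b = mp_lower_bound[OF this, of w, OF wU]
    have "ereal l \<le> ereal (sample_cost N w x)" using that b(1) by simp
    also note b(2)
    finally show "ereal l \<le> mp_objective c q N (U N) (x, y)" .
  qed
  have upper_sro: "\<forall>\<^sub>F N in sequentially. sro_value c q T W H h0 N (U N) \<le> ereal (v + \<delta>)" if "\<delta> > 0" for \<delta>
    using upper[OF that] by eventually_elim simp
  have upper_mp: "\<forall>\<^sub>F N in sequentially. mp_value c q T W H h0 N (U N) \<le> ereal (v + \<delta>)" if "\<delta> > 0" for \<delta>
    using upper[OF that] by eventually_elim simp
  have base: "vals \<longlonglongrightarrow> ereal v \<and> (accumulation_point_of_decisions D a \<longrightarrow> g a \<le> 0 \<and> f a \<le> v)"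
    if lower: "\<And>N l. (\<And>x. x \<in> sample_feasible N w \<Longrightarrow> l \<le> sample_cost N w x) \<Longrightarrow> ereal l \<le> vals N"
      and upper: "\<And>\<delta>. \<delta> > 0 \<Longrightarrow> \<forall>\<^sub>F N in sequentially. vals N \<le> ereal (v + \<delta>)"
      and dec: "\<And>N x. x \<in> D N \<Longrightarrow> x \<in> sample_feasible N w \<and> ereal (sample_cost N w x) \<le> vals N"
    for vals D
  proof -
    note approx = consistent_approximation[where f = f and fN = "\<lambda>N. sample_cost N w"
        and XN = "\<lambda>N. sample_feasible N w" and X = "{x. g x \<le> 0}" and xs = xs and v = v and vals = vals and D = D]
    have "vals \<longlonglongrightarrow> ereal v"
      by (rule approx(1)) (fact convex_sample_cost lim X Xlim opt' opt(2) bdd' upper | rule lower dec; blast)+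
    moreover have "a \<in> {x. g x \<le> 0} \<and> f a \<le> v" if "accumulation_point_of_decisions D a"
      by (rule approx(2)) (fact that convex_sample_cost lim X Xlim opt' opt(2) bdd' upper | rule lower dec; blast)+
    ultimately show ?thesis by simp
  qed
  have sro: "(\<lambda>N. sro_value c q T W H h0 N (U N)) \<longlonglongrightarrow> ereal v \<and>
      (accumulation_point_of_decisions (\<lambda>N. sro_decisions c q T W H h0 N (U N)) a \<longrightarrow> g a \<le> 0 \<and> f a \<le> v)"
    by (rule base) (fact sro_low upper_sro sro_dec)+
  have mp: "(\<lambda>N. mp_value c q T W H h0 N (U N)) \<longlonglongrightarrow> ereal v \<and>
      (accumulation_point_of_decisions (\<lambda>N. mp_decisions c q T W H h0 N (U N)) a \<longrightarrow> g a \<le> 0 \<and> f a \<le> v)"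
    by (rule base) (fact mp_low upper_mp mp_dec)+
  show "(\<lambda>N. sro_value c q T W H h0 N (U N)) \<longlonglongrightarrow> ereal v"
    and "accumulation_point_of_decisions (\<lambda>N. sro_decisions c q T W H h0 N (U N)) a \<Longrightarrow> g a \<le> 0 \<and> f a \<le> v"
    using sro by simp_all
  show "(\<lambda>N. mp_value c q T W H h0 N (U N)) \<longlonglongrightarrow> ereal v"
    and "accumulation_point_of_decisions (\<lambda>N. mp_decisions c q T W H h0 N (U N)) a \<Longrightarrow> g a \<le> 0 \<and> f a \<le> v"
    using mp by simp_all
qed

end

section \<open>Almost sure consistency\<close>

context recourse
begin

definition mean_cost :: "(real^'d) measure \<Rightarrow> real^'n \<Rightarrow> real" where
  "mean_cost P x = c \<bullet> x + (\<integral>z. cost x z \<partial>P)"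

text \<open>
Infeasibility with positive probability makes the expectation infinite; otherwise the cost is integrable, being Lipschitz in z.
\<close>

lemma two_stage_objective_eq:
  assumes P: "prob_space P" "sets P = sets borel" and nrm: "integrable P norm"
  shows "two_stage_objective P c q T W H h0 x
    = (if AE z in P. feasible x z then ereal (mean_cost P x) else \<infinity>)"
proof -
  interpret prob_space P by fact
  have int: "integrable P (cost x)"
    unfolding cost_def[abs_def] by (rule integrable_support_value_residual[OF finite_\<Lambda> \<Lambda>_nonempty P nrm])
  show ?thesis
  proof (cases "AE z in P. feasible x z")
    case True
    then have "AE z in P. second_stage_cost q T W H h0 x z = ereal (cost x z)"
      by eventually_elim (simp add: second_stage_cost_eq)
    then show ?thesis
      using True ereal_expectation_integrable[OF int] by (simp add: two_stage_objective_def mean_cost_def)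
  next
    case False
    define A where "A = {z \<in> space P. \<not> feasible x z}"
    have "violation x \<in> borel_measurable P"
      using measurable_violation P(2) by (simp cong: measurable_cong_sets)
    then have A: "A \<in> sets P" unfolding A_def feasible_iff_violation by measurable
    have "emeasure P A \<noteq> 0"
      using False AE_iff_measurable[OF A, of "feasible x"] by (auto simp: A_def)
    then have "ereal_expectation P (second_stage_cost q T W H h0 x) = \<infinity>"
      by (intro ereal_expectation_infinite[OF A]) (auto simp: A_def second_stage_cost_eq zero_less_iff_neq_zero)
    then show ?thesis using False by (simp add: two_stage_objective_def)
  qed
qed

theorem almost_sure_consistency:
  fixes \<Xi> :: "(real^'d) set" and M :: "'a measure" and \<xi> :: "nat \<Rightarrow> 'a \<Rightarrow> real^'d"
  assumes simple: "simple_polyhedron \<Xi>"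
    and vertex: "\<exists>v. v extreme_point_of \<Xi>"
    and norm: "is_norm \<nu>"
    and P_prob: "prob_space P"
    and P_sets: "sets P = sets borel"
    and P_supp: "AE z in P. z \<in> \<Xi>"
    and M_prob: "prob_space M"
    and indep: "prob_space.indep_vars M (\<lambda>_. borel) \<xi> {1..}"
    and distr: "\<And>i. i \<ge> 1 \<Longrightarrow> distr M borel (\<xi> i) = P"
    and eps_nonneg: "\<And>N. \<epsilon> N \<ge> 0"
    and A1: "\<epsilon> \<longlonglongrightarrow> 0"
    and A2_value: "\<bar>two_stage_value P c q T W H h0\<bar> \<noteq> \<infinity>"
    and A2_moment: "integrable P \<nu>"
    and A3_nonempty: "two_stage_decisions P c q T W H h0 \<noteq> {}"
    and A3_bounded: "bounded (two_stage_decisions P c q T W H h0)"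
    and x0: "\<And>\<zeta>. \<zeta> \<in> \<Xi> \<Longrightarrow> feasible x0 \<zeta>"
  defines "U \<equiv> \<lambda>N \<omega> i. uncertainty_set \<nu> \<Xi> (\<epsilon> N) (\<xi> i \<omega>)"
  shows "AE \<omega> in M.
      (\<lambda>N. sro_value c q T W H h0 N (U N \<omega>)) \<longlonglongrightarrow> two_stage_value P c q T W H h0 \<and>
      (\<lambda>N. mp_value c q T W H h0 N (U N \<omega>)) \<longlonglongrightarrow> two_stage_value P c q T W H h0 \<and>
      (\<forall>a. accumulation_point_of_decisions (\<lambda>N. sro_decisions c q T W H h0 N (U N \<omega>)) a
        \<longrightarrow> a \<in> two_stage_decisions P c q T W H h0) \<and>
      (\<forall>a. accumulation_point_of_decisions (\<lambda>N. mp_decisions c q T W H h0 N (U N \<omega>)) a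
        \<longrightarrow> a \<in> two_stage_decisions P c q T W H h0)"
proof -
  interpret P: prob_space P by fact
  interpret M: prob_space M by fact
  obtain v where v: "two_stage_value P c q T W H h0 = ereal v" using A2_value by auto
  obtain \<kappa> where \<kappa>: "\<kappa> > 0" "\<And>x. norm x \<le> \<kappa> * \<nu> x"
    using is_norm_dominates_norm[OF norm] by metis
  have nrm: "integrable P norm"
  proof (rule Bochner_Integration.integrable_bound)
    show "integrable P (\<lambda>x. \<kappa> * \<nu> x)" using A2_moment by simp
    show "norm \<in> borel_measurable P" using P_sets by (simp cong: measurable_cong_sets)
    show "AE x in P. norm (norm x) \<le> norm (\<kappa> * \<nu> x)"
      using \<kappa>(2) by (intro AE_I2) (simp add: order_trans[OF _ abs_ge_self])
  qed
  have obj: "two_stage_objective P c q T W H h0 x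
      = (if AE z in P. feasible x z then ereal (mean_cost P x) else \<infinity>)" for x
    by (rule two_stage_objective_eq[OF P_prob P_sets nrm])
  have dec_iff: "x \<in> two_stage_decisions P c q T W H h0 \<longleftrightarrow> (AE z in P. feasible x z) \<and> mean_cost P x = v" for x
    by (simp add: two_stage_decisions_def obj v)
  have value_le: "v \<le> mean_cost P x" if "AE z in P. feasible x z" for x
  proof -
    have "two_stage_value P c q T W H h0 \<le> two_stage_objective P c q T W H h0 x"
      unfolding two_stage_value_def by (rule INF_lower) simp
    then show ?thesis using that by (simp add: obj v)
  qed
  obtain xs where xs: "AE z in P. feasible xs z" "mean_cost P xs = v"
    using A3_nonempty dec_iff by blast
  define g where "g x = (\<integral>z. violation x z \<partial>P)" for x
  have int_viol: "integrable P (violation x)" for x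
    unfolding violation_def[abs_def]
    using finite_\<M> by (intro integrable_support_value_residual P_prob P_sets nrm) auto
  have int_cost: "integrable P (cost x)" for x
    unfolding cost_def[abs_def] by (rule integrable_support_value_residual[OF finite_\<Lambda> \<Lambda>_nonempty P_prob P_sets nrm])
  have g_feasible: "AE z in P. feasible x z" if "g x \<le> 0" for x
  proof -
    have "g x = 0" using that violation_nonneg by (simp add: g_def antisym)
    then have "AE z in P. violation x z = 0"
      using integral_nonneg_eq_0_iff_AE[OF int_viol] violation_nonneg by (simp add: g_def)
    then show ?thesis by eventually_elim (simp add: feasible_iff_violation)
  qed
  have dec_sub: "x \<in> two_stage_decisions P c q T W H h0" if "g x \<le> 0 \<and> mean_cost P x \<le> v" for x
    using that g_feasible[of x] value_le[of x] unfolding dec_iff by force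
  have bdd: "bounded {x. g x \<le> 0 \<and> mean_cost P x \<le> v}"
    by (rule bounded_subset[OF A3_bounded]) (use dec_sub in blast)
  have rv: "\<xi> i \<in> borel_measurable M" if "i \<ge> 1" for i
    using indep that by (auto simp: M.indep_vars_def)
  have sample_AE: "AE \<omega> in M. \<forall>i\<ge>1. Q (\<xi> i \<omega>)" if "AE z in P. Q z" for Q
  proof -
    have "AE \<omega> in M. i \<ge> 1 \<longrightarrow> Q (\<xi> i \<omega>)" for i
    proof (cases "i \<ge> 1")
      case True
      have "AE z in distr M borel (\<xi> i). Q z" unfolding distr[OF True] by (rule that)
      then show ?thesis using AE_distrD[OF rv[OF True]] by simp
    qed simp
    then show ?thesis by (simp add: AE_all_countable)
  qed
  obtain L where L: "L > 0" "\<And>x x' z z'. \<bar>cost x z - cost x' z'\<bar> \<le> L * (norm (x - x') + norm (z - z'))"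
    using cost_Lipschitz by metis
  obtain K where K: "K > 0" "\<And>x x' z z'. \<bar>violation x z - violation x' z'\<bar> \<le> K * (norm (x - x') + norm (z - z'))"
    using violation_Lipschitz by metis
  have int_Lip: "\<bar>(\<integral>z. F x z \<partial>P) - (\<integral>z. F y z \<partial>P)\<bar> \<le> B * dist x y"
    if F: "\<And>x. integrable P (F x)" and B: "\<And>z. \<bar>F x z - F y z\<bar> \<le> B * dist x y" for F :: "real^'n \<Rightarrow> real^'d \<Rightarrow> real" and x y B
  proof -
    have "\<bar>(\<integral>z. F x z \<partial>P) - (\<integral>z. F y z \<partial>P)\<bar> = \<bar>\<integral>z. F x z - F y z \<partial>P\<bar>" using F by simp
    also have "\<dots> \<le> (\<integral>z. \<bar>F x z - F y z\<bar> \<partial>P)" by (rule integral_abs_bound)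
    also have "\<dots> \<le> (\<integral>z. B * dist x y \<partial>P)" using F B by (intro integral_mono) auto
    finally show ?thesis by (simp add: P.prob_space)
  qed
  have cost_Lip: "\<bar>cost x z - cost y z\<bar> \<le> L * dist x y" for x y z
    using L(2)[of x z y z] by (simp add: dist_norm)
  have viol_Lip: "\<bar>violation x z - violation y z\<bar> \<le> K * dist x y" for x y z
    using K(2)[of x z y z] by (simp add: dist_norm)
  have ae_cost: "AE \<omega> in M. \<forall>x. (\<lambda>N. sample_cost N (\<lambda>i. \<xi> i \<omega>) x) \<longlonglongrightarrow> mean_cost P x"
  proof (rule AE_pointwise_convergence_Lipschitz)
    show "\<bar>sample_cost n (\<lambda>i. \<xi> i \<omega>) x - sample_cost n (\<lambda>i. \<xi> i \<omega>) y\<bar> \<le> (norm c + L) * dist x y" for n x y \<omega>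
      by (rule sample_cost_Lipschitz[OF L(2)])
    show "\<bar>mean_cost P x - mean_cost P y\<bar> \<le> (norm c + L) * dist x y" for x y
    proof -
      have "\<bar>c \<bullet> x - c \<bullet> y\<bar> \<le> norm c * dist x y"
        using Cauchy_Schwarz_ineq2[of c "x - y"] by (simp add: inner_diff_right dist_norm)
      then show ?thesis
        using int_Lip[of cost x y L, OF int_cost cost_Lip] by (simp add: mean_cost_def algebra_simps abs_le_iff)
    qed
    fix x
    have "AE \<omega> in M. (\<lambda>n. (\<Sum>i=1..n. cost x (\<xi> i \<omega>)) / real n) \<longlonglongrightarrow> (\<integral>z. cost x z \<partial>P)"
      by (rule M.strong_law_iid[OF indep distr int_cost])
    then show "AE \<omega> in M. (\<lambda>N. sample_cost N (\<lambda>i. \<xi> i \<omega>) x) \<longlonglongrightarrow> mean_cost P x"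
      by eventually_elim (auto simp: sample_cost_def mean_cost_def intro!: tendsto_add)
  qed
  have ae_viol: "AE \<omega> in M. \<forall>x. (\<lambda>N. (\<Sum>i=1..N. violation x (\<xi> i \<omega>)) / real N) \<longlonglongrightarrow> g x"
  proof (rule AE_pointwise_convergence_Lipschitz)
    show "\<bar>(\<Sum>i=1..n. violation x (\<xi> i \<omega>)) / real n - (\<Sum>i=1..n. violation y (\<xi> i \<omega>)) / real n\<bar> \<le> K * dist x y" for n x y \<omega>
      by (rule average_Lipschitz[OF viol_Lip])
    show "\<bar>g x - g y\<bar> \<le> K * dist x y" for x y
      unfolding g_def by (rule int_Lip[OF int_viol viol_Lip])
    show "AE \<omega> in M. (\<lambda>N. (\<Sum>i=1..N. violation x (\<xi> i \<omega>)) / real N) \<longlonglongrightarrow> g x" for x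
      unfolding g_def by (rule M.strong_law_iid[OF indep distr int_viol])
  qed
  have \<nu>0: "\<nu> 0 = 0" using norm by (simp add: is_norm_def)
  show ?thesis
    using sample_AE[OF P_supp] sample_AE[OF xs(1)] ae_cost ae_viol
  proof eventually_elim
    case (elim \<omega>)
    have opt: "g x \<le> 0 \<Longrightarrow> v \<le> mean_cost P x" for x using g_feasible value_le by blast
    note conv = values_and_decisions_converge[OF simple vertex \<kappa> \<nu>0 eps_nonneg A1 elim(1)[rule_format] elim(2)[rule_format]
        x0 elim(3)[rule_format] elim(4)[rule_format] opt eq_refl[OF xs(2)] bdd, folded U_def]
    show ?case
      unfolding v U_def
      using conv dec_sub by (simp add: U_def)
  qed
qed

end

text \<open>
If the recourse problem is unbounded on the whole support, then so is the two-stage problem. This rules out an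
empty set of dual solutions when the optimal value is finite.
\<close>

lemma two_stage_value_unbounded_recourse:
  assumes P: "prob_space P" and supp: "AE z in P. z \<in> \<Xi>"
    and cost: "\<And>\<zeta>. \<zeta> \<in> \<Xi> \<Longrightarrow> second_stage_cost q T W H h0 x \<zeta> = - \<infinity>"
  shows "two_stage_value P c q T W H h0 = - \<infinity>"
proof -
  interpret prob_space P by fact
  let ?Q = "second_stage_cost q T W H h0 x"
  have "(\<integral>\<^sup>+ z. e2ennreal (?Q z) \<partial>P) = (\<integral>\<^sup>+ z. 0 \<partial>P)"
    using supp by (intro nn_integral_cong_AE) (auto simp: cost e2ennreal_neg)
  moreover have "(\<integral>\<^sup>+ z. e2ennreal (- ?Q z) \<partial>P) = (\<integral>\<^sup>+ z. \<infinity> \<partial>P)"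
    using supp by (intro nn_integral_cong_AE) (auto simp: cost)
  ultimately have "two_stage_objective P c q T W H h0 x = - \<infinity>"
    by (simp add: two_stage_objective_def ereal_expectation_def emeasure_space_1 zero_ennreal.rep_eq)
  then show ?thesis unfolding two_stage_value_def
    by (metis INF_lower UNIV_I ereal_infty_less_eq(2))
qed

theorem corollary1:
  fixes T :: "real^'n^'m" and W :: "real^'r^'m" and H :: "real^'d^'m"
    and c :: "real^'n" and q :: "real^'r" and h0 :: "real^'m"
    and \<Xi> :: "(real^'d) set" and \<nu> :: "real^'d \<Rightarrow> real"
    and P :: "(real^'d) measure" and M :: "'a measure"
    and \<xi> :: "nat \<Rightarrow> 'a \<Rightarrow> real^'d" and \<epsilon> :: "nat \<Rightarrow> real"
  assumes simple: "simple_polyhedron \<Xi>"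
    and vertex: "\<exists>v. v extreme_point_of \<Xi>"
    and norm: "is_norm \<nu>"
    and P_prob: "prob_space P"
    and P_sets: "sets P = sets borel"
    and P_supp: "AE z in P. z \<in> \<Xi>"
    and M_prob: "prob_space M"
    and indep: "prob_space.indep_vars M (\<lambda>_. borel) \<xi> {1..}"
    and distr: "\<And>i. i \<ge> 1 \<Longrightarrow> distr M borel (\<xi> i) = P"
    and eps_nonneg: "\<And>N. \<epsilon> N \<ge> 0"
    and A1: "\<epsilon> \<longlonglongrightarrow> 0"
    and A2_value: "\<bar>two_stage_value P c q T W H h0\<bar> \<noteq> \<infinity>"
    and A2_moment: "integrable P \<nu>"
    and A3_nonempty: "two_stage_decisions P c q T W H h0 \<noteq> {}"
    and A3_bounded: "bounded (two_stage_decisions P c q T W H h0)"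
    and A4a: "\<exists>x. \<forall>\<zeta>\<in>\<Xi>. second_stage_cost q T W H h0 x \<zeta> < \<infinity>"
  shows
    "(AE \<omega> in M.
        (\<lambda>N. sro_value c q T W H h0 N (\<lambda>i. uncertainty_set \<nu> \<Xi> (\<epsilon> N) (\<xi> i \<omega>)))
          \<longlonglongrightarrow> two_stage_value P c q T W H h0 \<and>
        (\<lambda>N. mp_value c q T W H h0 N (\<lambda>i. uncertainty_set \<nu> \<Xi> (\<epsilon> N) (\<xi> i \<omega>)))
          \<longlonglongrightarrow> two_stage_value P c q T W H h0) \<and>
     (AE \<omega> in M. \<forall>a.
        accumulation_point_of_decisions
          (\<lambda>N. sro_decisions c q T W H h0 N (\<lambda>i. uncertainty_set \<nu> \<Xi> (\<epsilon> N) (\<xi> i \<omega>))) a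
        \<longrightarrow> a \<in> two_stage_decisions P c q T W H h0) \<and>
     (AE \<omega> in M. \<forall>a.
        accumulation_point_of_decisions
          (\<lambda>N. mp_decisions c q T W H h0 N (\<lambda>i. uncertainty_set \<nu> \<Xi> (\<epsilon> N) (\<xi> i \<omega>))) a
        \<longrightarrow> a \<in> two_stage_decisions P c q T W H h0)"
proof -
  obtain \<Lambda> \<M> :: "(real^'m) set" where fin: "finite \<Lambda>" "finite \<M>"
    and dual': "\<forall>b s. (\<exists>y. b \<le> W *v y \<and> q \<bullet> y \<le> s) \<longleftrightarrow> (\<forall>\<mu>\<in>\<M>. \<mu> \<bullet> b \<le> 0) \<and> (\<forall>l\<in>\<Lambda>. l \<bullet> b \<le> s)"
    using linear_program_value[of W q] .
  note dual = dual'[rule_format]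
  obtain x0 where x0: "\<And>\<zeta>. \<zeta> \<in> \<Xi> \<Longrightarrow> second_stage_cost q T W H h0 x0 \<zeta> < \<infinity>" using A4a by blast
  have recourse_x0: "\<forall>\<mu>\<in>\<M>. \<mu> \<bullet> residual T H h0 x0 \<zeta> \<le> 0" if "\<zeta> \<in> \<Xi>" for \<zeta>
  proof -
    have "{y. T *v x0 + W *v y \<ge> rhs H h0 \<zeta>} \<noteq> {}"
    proof
      assume "{y. T *v x0 + W *v y \<ge> rhs H h0 \<zeta>} = {}"
      then have "second_stage_cost q T W H h0 x0 \<zeta> = \<infinity>" by (simp add: second_stage_cost_def top_ereal_def)
      then show False using x0[OF that] by simp
    qed
    then obtain y where "residual T H h0 x0 \<zeta> \<le> W *v y"
      by (auto simp: residual_def diff_le_eq add.commute)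
    then show ?thesis using dual[of "residual T H h0 x0 \<zeta>" "q \<bullet> y"] by blast
  qed
  have "\<Lambda> \<noteq> {}"
  proof
    assume \<Lambda>: "\<Lambda> = {}"
    have "second_stage_cost q T W H h0 x0 \<zeta> = - \<infinity>" if in_support: "\<zeta> \<in> \<Xi>" for \<zeta>
    proof (rule ereal_bot)
      fix s
      obtain y where "residual T H h0 x0 \<zeta> \<le> W *v y" "q \<bullet> y \<le> s"
        using dual[of "residual T H h0 x0 \<zeta>" s] recourse_x0[OF in_support] \<Lambda> by blast
      then show "second_stage_cost q T W H h0 x0 \<zeta> \<le> ereal s"
        unfolding second_stage_cost_def by (intro INF_lower2[of y]) (auto simp: residual_def diff_le_eq add.commute)
    qed
    then have "two_stage_value P c q T W H h0 = - \<infinity>"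
      by (rule two_stage_value_unbounded_recourse[OF P_prob P_supp])
    then show False using A2_value by simp
  qed
  then interpret recourse T W H c q h0 \<Lambda> \<M>
    using fin dual by unfold_locales
  have "\<And>\<zeta>. \<zeta> \<in> \<Xi> \<Longrightarrow> feasible x0 \<zeta>" using recourse_x0 by (simp add: feasible_def)
  from almost_sure_consistency[OF simple vertex norm P_prob P_sets P_supp M_prob indep distr eps_nonneg A1
      A2_value A2_moment A3_nonempty A3_bounded this]
  show ?thesis by (auto elim: eventually_mono)
qed

end
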